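(* Let $H$ be a coseparable, $k$-projective weak Hopf algebra over $k$ with bijective antipode and let $A$ be a $k$-projective right $H$-comodule algebra. Let $\mathfrak{E}$ be the $A$-coring defined as the image of the projection $p_R:A\otimes H\to A\otimes H$, $a\otimes h\mapsto\sum a1_{[0]}\otimes h1_{[1]}$. If the map $$\widetilde{\mathrm{can}}_A:A\otimes A\to\mathfrak{E},\qquad a\otimes b\mapsto\sum ab_{[0]}\otimes b_{[1]}$$ is surjective, then $A$ is a weak Hopf-Galois $H$-extension of the coinvariants $B=A^{\mathrm{co}H}$ and it is $H$-equivariantly projective as a left $B$-module.
   Context: $k$ is a commutative ring with unit, algebras are associative unital $k$-algebras, coalgebras are coassociative counital $k$-coalgebras, $\otimes=\otimes_k$, $\Delta(h)=\sum h_{(1)}\otimes h_{(2)}$. A weak bialgebra $H$ is a $k$-module with an algebra and a coalgebra structure $(\Delta,\varepsilon)$ such that $\Delta$ is multiplicative, $(\Delta\otimes H)\Delta(1)=\sum1_{(1)}\otimes1_{(2)}1_{(1')}\otimes1_{(2')}=\sum1_{(1)}\otimes1_{(1')}1_{(2)}\otimes1_{(2')}$ (with $\Delta(1)=\sum1_{(1)}\otimes1_{(2)}=\sum1_{(1')}\otimes1_{(2')}$) and $\varepsilon(hkl)=\sum\varepsilon(hk_{(1)})\varepsilon(k_{(2)}l)=\sum\varepsilon(hk_{(2)})\varepsilon(k_{(1)}l)$. Put $\Pi^L(h)=\sum\varepsilon(1_{(1)}h)1_{(2)}$, $\Pi^R(h)=\sum\varepsilon(h1_{(2)})1_{(1)}$.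 A weak Hopf algebra is a weak bialgebra with a $k$-linear antipode $S:H\to H$ satisfying $\sum h_{(1)}S(h_{(2)})=\Pi^L(h)$, $\sum S(h_{(1)})h_{(2)}=\Pi^R(h)$, $\sum S(h_{(1)})h_{(2)}S(h_{(3)})=S(h)$. A right $H$-comodule algebra is an algebra $A$ with a right $H$-coaction $\varrho:A\to A\otimes H$, $\varrho(a)=\sum a_{[0]}\otimes a_{[1]}$, such that $\varrho(ab)=\varrho(a)\varrho(b)$ and $\sum a_{[0]}\otimes\Pi^L(a_{[1]})=\sum1_{[0]}a\otimes1_{[1]}$ for all $a,b\in A$. $H$ is coseparable if its underlying coalgebra is, i.e. $\Delta$ has a retraction in the category of $H$-bicomodules; equivalently there is a $k$-linear $\delta:H\otimes H\to k$ with $\sum h_{(1)}\delta(h_{(2)}\otimes h')=\sum\delta(h\otimes h'_{(1)})h'_{(2)}$ and $\delta\circ\Delta=\varepsilon$. $\mathfrak{E}=\mathrm{Im}\,p_R$ is an $A$-coring with bimodule structure $b'(\sum a1_{[0]}\otimes h1_{[1]})b=\sum b'ab_{[0]}\otimes hb_{[1]}$, coproduct $p_R(a\otimes h)\mapsto\sum p_R(a\otimes h_{(1)})\otimes_Ap_R(1\otimes h_{(2)})$ and counit $\sum a\otimes h\mapsto\sum a\varepsilon(h)$ restricted to $\mathfrak{E}$. Coinvariants: $A^{\mathrm{co}H}=\{b\in A\mid\forall a\in A,\ \varrho(ba)=b\varrho(a)\}$. With $B=A^{\mathrm{co}H}$, $B\subseteq A$ is a weak Hopf-Galois $H$-extension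 if $\mathrm{can}_A:A\otimes_BA\to\mathfrak{E}$, $a\otimes_Bb\mapsto\sum ab_{[0]}\otimes b_{[1]}$ is an isomorphism of $A$-corings, where $A\otimes_BA$ is the Sweedler coring with coproduct $a\otimes a'\mapsto(a\otimes1)\otimes_A(1\otimes a')$ and counit $a\otimes a'\mapsto aa'$. $A$ is $H$-equivariantly projective as a left $B$-module if $A$ is a projective left $B$-module and the multiplication map $B\otimes A\to A$ has a left $B$-linear, right $H$-colinear section (with $H$-coaction $B\otimes\varrho$ on $B\otimes A$). *)

theory Defs
  imports "HOL-Algebra.Module" "HOL-Algebra.Free_Abelian_Groups"
begin

section \<open>Modules and tensor products\<close>

text \<open>
  Rings and modules are HOL-Algebra structures (so the zero ring is allowed).  A \<open>k\<close>-algebra is a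
  \<^type>\<open>module\<close> record whose ring part carries the multiplication; HOL-Algebra's own locale
  \<^locale>\<open>algebra\<close> is restricted to commutative algebras.
\<close>

definition linear_map ::
  "('r, 'x) ring_scheme \<Rightarrow> ('r, 'm, 'y) module_scheme \<Rightarrow> ('r, 'n, 'z) module_scheme \<Rightarrow> ('m \<Rightarrow> 'n) \<Rightarrow> bool"
  where "linear_map R M N f \<longleftrightarrow>
    f \<in> carrier M \<rightarrow> carrier N \<and>
    (\<forall>x\<in>carrier M. \<forall>y\<in>carrier M. f (x \<oplus>\<^bsub>M\<^esub> y) = f x \<oplus>\<^bsub>N\<^esub> f y) \<and>
    (\<forall>r\<in>carrier R. \<forall>x\<in>carrier M. f (r \<odot>\<^bsub>M\<^esub> x) = r \<odot>\<^bsub>N\<^esub> f x)"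

definition regular_module :: "('r, 'x) ring_scheme \<Rightarrow> ('r, 'r) module"
  where "regular_module R = \<lparr>carrier = carrier R, monoid.mult = monoid.mult R, monoid.one = \<one>\<^bsub>R\<^esub>,
    ring.zero = \<zero>\<^bsub>R\<^esub>, ring.add = ring.add R, smult = monoid.mult R\<rparr>"

definition free_module :: "('r, 'x) ring_scheme \<Rightarrow> 'i set \<Rightarrow> ('r, 'i \<Rightarrow> 'r) module"
  where "free_module R V = \<lparr>
    carrier = {f. (\<forall>i. f i \<in> carrier R) \<and> finite {i. f i \<noteq> \<zero>\<^bsub>R\<^esub>} \<and> {i. f i \<noteq> \<zero>\<^bsub>R\<^esub>} \<subseteq> V},
    monoid.mult = undefined, monoid.one = undefined,
    ring.zero = (\<lambda>i. \<zero>\<^bsub>R\<^esub>), ring.add = (\<lambda>f g i. f i \<oplus>\<^bsub>R\<^esub> g i), smult = (\<lambda>r f i. r \<otimes>\<^bsub>R\<^esub> f i)\<rparr>"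

text \<open>
  A left module (over a possibly non-commutative ring) is projective if it is a direct summand of a
  free module.  Basis sets of the element type of \<open>M\<close> suffice: if \<open>M\<close> is a direct summand of any
  free module, then the canonical map onto \<open>M\<close> from the free module on \<open>carrier M\<close> splits.
\<close>

definition projective_module :: "('r, 'x) ring_scheme \<Rightarrow> ('r, 'm, 'y) module_scheme \<Rightarrow> bool"
  where "projective_module R M \<longleftrightarrow>
    (\<exists>(V :: 'm set) i p. linear_map R M (free_module R V) i \<and> linear_map R (free_module R V) M p \<and>
       (\<forall>m\<in>carrier M. p (i m) = m))"

text \<open>
  The tensor product over \<open>R\<close> of a right module \<open>M\<close> (action \<open>ra\<close>) and a left module \<open>N\<close>
  (action \<open>la\<close>): the free abelian group on \<open>M \<times> N\<close> modulo biadditivity and \<open>R\<close>-balancedness.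
\<close>

type_synonym ('m, 'n) tensor = "('m \<times> 'n \<Rightarrow>\<^sub>0 int) set"

definition tensor_relations ::
  "('m, 'x) ring_scheme \<Rightarrow> ('m \<Rightarrow> 'r \<Rightarrow> 'm) \<Rightarrow> ('r, 'y) ring_scheme \<Rightarrow> ('r \<Rightarrow> 'n \<Rightarrow> 'n) \<Rightarrow>
   ('n, 'z) ring_scheme \<Rightarrow> ('m \<times> 'n \<Rightarrow>\<^sub>0 int) set"
  where "tensor_relations M ra R la N = generate (free_Abelian_group (carrier M \<times> carrier N))
    ({frag_of (m \<oplus>\<^bsub>M\<^esub> m', n) - frag_of (m, n) - frag_of (m', n) | m m' n.
        m \<in> carrier M \<and> m' \<in> carrier M \<and> n \<in> carrier N} \<union>
     {frag_of (m, n \<oplus>\<^bsub>N\<^esub> n') - frag_of (m, n) - frag_of (m, n') | m n n'.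
        m \<in> carrier M \<and> n \<in> carrier N \<and> n' \<in> carrier N} \<union>
     {frag_of (ra m r, n) - frag_of (m, la r n) | m r n.
        m \<in> carrier M \<and> r \<in> carrier R \<and> n \<in> carrier N})"

definition balanced_tensor ::
  "('m, 'x) ring_scheme \<Rightarrow> ('m \<Rightarrow> 'r \<Rightarrow> 'm) \<Rightarrow> ('r, 'y) ring_scheme \<Rightarrow> ('r \<Rightarrow> 'n \<Rightarrow> 'n) \<Rightarrow>
   ('n, 'z) ring_scheme \<Rightarrow> ('m, 'n) tensor ring"
  where "balanced_tensor M ra R la N =
    (let Q = free_Abelian_group (carrier M \<times> carrier N) Mod tensor_relations M ra R la N
     in \<lparr>carrier = carrier Q, monoid.mult = undefined, monoid.one = undefined,
         ring.zero = \<one>\<^bsub>Q\<^esub>, ring.add = monoid.mult Q\<rparr>)"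

definition balanced_pure ::
  "('m, 'x) ring_scheme \<Rightarrow> ('m \<Rightarrow> 'r \<Rightarrow> 'm) \<Rightarrow> ('r, 'y) ring_scheme \<Rightarrow> ('r \<Rightarrow> 'n \<Rightarrow> 'n) \<Rightarrow>
   ('n, 'z) ring_scheme \<Rightarrow> 'm \<Rightarrow> 'n \<Rightarrow> ('m, 'n) tensor"
  where "balanced_pure M ra R la N m n =
    tensor_relations M ra R la N #>\<^bsub>free_Abelian_group (carrier M \<times> carrier N)\<^esub> frag_of (m, n)"

text \<open>
  For a biadditive balanced \<open>f\<close> with values in \<open>P\<close>, \<open>tensor_lift P f\<close> is the induced additive map,
  i.e. \<open>tensor_lift P f (\<Sum> m \<otimes> n) = \<Sum> f m n\<close>; the choice of a representative is then immaterial.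
  It also renders Sweedler notation: \<open>tensor_lift P f (\<Delta> h)\<close> is \<open>\<Sum> f h\<^sub>1 h\<^sub>2\<close>.
\<close>

definition tensor_lift :: "('p, 'x) ring_scheme \<Rightarrow> ('m \<Rightarrow> 'n \<Rightarrow> 'p) \<Rightarrow> ('m, 'n) tensor \<Rightarrow> 'p"
  where "tensor_lift P f t = (let u = (SOME u. u \<in> t)
    in finsum P (\<lambda>(m, n). add_pow P (Poly_Mapping.lookup u (m, n)) (f m n)) (Poly_Mapping.keys u))"

text \<open>
  Over a commutative base ring the left action also serves as right action.  The ring part of
  \<open>ktensor K M N\<close> is the factorwise product; it is meaningful only if \<open>M\<close> and \<open>N\<close> are algebras.
\<close>

definition kpure ::
  "('k, 'x) ring_scheme \<Rightarrow> ('k, 'm, 'y) module_scheme \<Rightarrow> ('k, 'n, 'z) module_scheme \<Rightarrow>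
   'm \<Rightarrow> 'n \<Rightarrow> ('m, 'n) tensor"
  where "kpure K M N = balanced_pure M (\<lambda>m c. c \<odot>\<^bsub>M\<^esub> m) K (smult N) N"

definition ktensor ::
  "('k, 'x) ring_scheme \<Rightarrow> ('k, 'm, 'y) module_scheme \<Rightarrow> ('k, 'n, 'z) module_scheme \<Rightarrow>
   ('k, ('m, 'n) tensor) module"
  where "ktensor K M N =
    (let T = balanced_tensor M (\<lambda>m c. c \<odot>\<^bsub>M\<^esub> m) K (smult N) N
     in \<lparr>carrier = carrier T,
         monoid.mult = (\<lambda>s t. tensor_lift T (\<lambda>m n. tensor_lift T (\<lambda>m' n'.
            kpure K M N (m \<otimes>\<^bsub>M\<^esub> m') (n \<otimes>\<^bsub>N\<^esub> n')) t) s),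
         monoid.one = kpure K M N \<one>\<^bsub>M\<^esub> \<one>\<^bsub>N\<^esub>,
         ring.zero = \<zero>\<^bsub>T\<^esub>, ring.add = ring.add T,
         smult = (\<lambda>c. tensor_lift T (\<lambda>m n. kpure K M N (c \<odot>\<^bsub>M\<^esub> m) n))\<rparr>)"

text \<open>\<open>ktensor_map K M' N' f g\<close> is \<open>f \<otimes> g\<close> with codomain \<open>M' \<otimes> N'\<close>.\<close>

definition ktensor_map ::
  "('k, 'x) ring_scheme \<Rightarrow> ('k, 'p, 'y) module_scheme \<Rightarrow> ('k, 'q, 'z) module_scheme \<Rightarrow>
   ('m \<Rightarrow> 'p) \<Rightarrow> ('n \<Rightarrow> 'q) \<Rightarrow> ('m, 'n) tensor \<Rightarrow> ('p, 'q) tensor"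
  where "ktensor_map K M' N' f g = tensor_lift (ktensor K M' N') (\<lambda>m n. kpure K M' N' (f m) (g n))"

definition ktensor_assoc ::
  "('k, 'x) ring_scheme \<Rightarrow> ('k, 'l, 'w) module_scheme \<Rightarrow> ('k, 'm, 'y) module_scheme \<Rightarrow>
   ('k, 'n, 'z) module_scheme \<Rightarrow> (('l, 'm) tensor, 'n) tensor \<Rightarrow> ('l, ('m, 'n) tensor) tensor"
  where "ktensor_assoc K L M N =
    (let P = ktensor K L (ktensor K M N)
     in tensor_lift P (\<lambda>u n. tensor_lift P (\<lambda>l m.
          kpure K L (ktensor K M N) l (kpure K M N m n)) u))"


section \<open>Weak Hopf algebras and comodule algebras\<close>

locale assoc_algebra = module K A + A: ring A
  for K :: "('k, 'x) ring_scheme" and A :: "('k, 'a, 'y) module_scheme" +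
  assumes smult_mult_left: "\<lbrakk>c \<in> carrier K; x \<in> carrier A; y \<in> carrier A\<rbrakk> \<Longrightarrow>
      (c \<odot>\<^bsub>A\<^esub> x) \<otimes>\<^bsub>A\<^esub> y = c \<odot>\<^bsub>A\<^esub> (x \<otimes>\<^bsub>A\<^esub> y)"
    and smult_mult_right: "\<lbrakk>c \<in> carrier K; x \<in> carrier A; y \<in> carrier A\<rbrakk> \<Longrightarrow>
      x \<otimes>\<^bsub>A\<^esub> (c \<odot>\<^bsub>A\<^esub> y) = c \<odot>\<^bsub>A\<^esub> (x \<otimes>\<^bsub>A\<^esub> y)"

locale coassoc_coalgebra = module K C
  for K :: "('k, 'x) ring_scheme" and C :: "('k, 'c, 'y) module_scheme"
    and \<Delta> :: "'c \<Rightarrow> ('c, 'c) tensor" and \<epsilon> :: "'c \<Rightarrow> 'k" +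
  assumes comult_linear: "linear_map K C (ktensor K C C) \<Delta>"
    and counit_linear: "linear_map K C (regular_module K) \<epsilon>"
    and coassoc: "c \<in> carrier C \<Longrightarrow>
      ktensor_assoc K C C C (ktensor_map K (ktensor K C C) C \<Delta> id (\<Delta> c)) =
      ktensor_map K C (ktensor K C C) id \<Delta> (\<Delta> c)"
    and counit_left: "c \<in> carrier C \<Longrightarrow> tensor_lift C (\<lambda>x y. \<epsilon> x \<odot>\<^bsub>C\<^esub> y) (\<Delta> c) = c"
    and counit_right: "c \<in> carrier C \<Longrightarrow> tensor_lift C (\<lambda>x y. \<epsilon> y \<odot>\<^bsub>C\<^esub> x) (\<Delta> c) = c"

locale weak_bialgebra = assoc_algebra K H + coassoc_coalgebra K H \<Delta> \<epsilon>
  for K :: "('k, 'x) ring_scheme" and H :: "('k, 'h, 'y) module_scheme"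
    and \<Delta> :: "'h \<Rightarrow> ('h, 'h) tensor" and \<epsilon> :: "'h \<Rightarrow> 'k" +
  assumes comult_mult: "\<lbrakk>x \<in> carrier H; y \<in> carrier H\<rbrakk> \<Longrightarrow>
      \<Delta> (x \<otimes>\<^bsub>H\<^esub> y) = \<Delta> x \<otimes>\<^bsub>ktensor K H H\<^esub> \<Delta> y"
    and comult_one1:
      "ktensor_assoc K H H H (ktensor_map K (ktensor K H H) H \<Delta> id (\<Delta> \<one>\<^bsub>H\<^esub>)) =
       tensor_lift (ktensor K H (ktensor K H H)) (\<lambda>x y.
         tensor_lift (ktensor K H (ktensor K H H)) (\<lambda>x' y'.
           kpure K H (ktensor K H H) x (kpure K H H (y \<otimes>\<^bsub>H\<^esub> x') y')) (\<Delta> \<one>\<^bsub>H\<^esub>)) (\<Delta> \<one>\<^bsub>H\<^esub>)"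
    and comult_one2:
      "ktensor_assoc K H H H (ktensor_map K (ktensor K H H) H \<Delta> id (\<Delta> \<one>\<^bsub>H\<^esub>)) =
       tensor_lift (ktensor K H (ktensor K H H)) (\<lambda>x y.
         tensor_lift (ktensor K H (ktensor K H H)) (\<lambda>x' y'.
           kpure K H (ktensor K H H) x (kpure K H H (x' \<otimes>\<^bsub>H\<^esub> y) y')) (\<Delta> \<one>\<^bsub>H\<^esub>)) (\<Delta> \<one>\<^bsub>H\<^esub>)"
    and counit_mult1: "\<lbrakk>h \<in> carrier H; g \<in> carrier H; l \<in> carrier H\<rbrakk> \<Longrightarrow>
      \<epsilon> (h \<otimes>\<^bsub>H\<^esub> g \<otimes>\<^bsub>H\<^esub> l) =
      tensor_lift K (\<lambda>x y. \<epsilon> (h \<otimes>\<^bsub>H\<^esub> x) \<otimes>\<^bsub>K\<^esub> \<epsilon> (y \<otimes>\<^bsub>H\<^esub> l)) (\<Delta> g)"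
    and counit_mult2: "\<lbrakk>h \<in> carrier H; g \<in> carrier H; l \<in> carrier H\<rbrakk> \<Longrightarrow>
      \<epsilon> (h \<otimes>\<^bsub>H\<^esub> g \<otimes>\<^bsub>H\<^esub> l) =
      tensor_lift K (\<lambda>x y. \<epsilon> (h \<otimes>\<^bsub>H\<^esub> y) \<otimes>\<^bsub>K\<^esub> \<epsilon> (x \<otimes>\<^bsub>H\<^esub> l)) (\<Delta> g)"

definition Pi_L ::
  "('k, 'h, 'y) module_scheme \<Rightarrow> ('h \<Rightarrow> ('h, 'h) tensor) \<Rightarrow> ('h \<Rightarrow> 'k) \<Rightarrow> 'h \<Rightarrow> 'h"
  where "Pi_L H \<Delta> \<epsilon> h = tensor_lift H (\<lambda>x y. \<epsilon> (x \<otimes>\<^bsub>H\<^esub> h) \<odot>\<^bsub>H\<^esub> y) (\<Delta> \<one>\<^bsub>H\<^esub>)"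

definition Pi_R ::
  "('k, 'h, 'y) module_scheme \<Rightarrow> ('h \<Rightarrow> ('h, 'h) tensor) \<Rightarrow> ('h \<Rightarrow> 'k) \<Rightarrow> 'h \<Rightarrow> 'h"
  where "Pi_R H \<Delta> \<epsilon> h = tensor_lift H (\<lambda>x y. \<epsilon> (h \<otimes>\<^bsub>H\<^esub> y) \<odot>\<^bsub>H\<^esub> x) (\<Delta> \<one>\<^bsub>H\<^esub>)"

locale weak_hopf_algebra = weak_bialgebra K H \<Delta> \<epsilon>
  for K :: "('k, 'x) ring_scheme" and H :: "('k, 'h, 'y) module_scheme"
    and \<Delta> :: "'h \<Rightarrow> ('h, 'h) tensor" and \<epsilon> :: "'h \<Rightarrow> 'k" +
  fixes S :: "'h \<Rightarrow> 'h"
  assumes antipode_linear: "linear_map K H H S"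
    and antipode_right: "h \<in> carrier H \<Longrightarrow>
      tensor_lift H (\<lambda>x y. x \<otimes>\<^bsub>H\<^esub> S y) (\<Delta> h) = Pi_L H \<Delta> \<epsilon> h"
    and antipode_left: "h \<in> carrier H \<Longrightarrow>
      tensor_lift H (\<lambda>x y. S x \<otimes>\<^bsub>H\<^esub> y) (\<Delta> h) = Pi_R H \<Delta> \<epsilon> h"
    and antipode_both: "h \<in> carrier H \<Longrightarrow>
      tensor_lift H (\<lambda>u z. tensor_lift H (\<lambda>x y. S x \<otimes>\<^bsub>H\<^esub> y \<otimes>\<^bsub>H\<^esub> S z) (\<Delta> u)) (\<Delta> h) = S h"

text \<open>
  \<open>C \<otimes> C\<close> is a \<open>C\<close>-bicomodule via \<open>\<Delta> \<otimes> C\<close> and \<open>C \<otimes> \<Delta>\<close>.  Left and right colinearity of the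
  linear map \<open>r\<close> are written on the generators \<open>x \<otimes> y\<close>.
\<close>

definition coseparable ::
  "('k, 'x) ring_scheme \<Rightarrow> ('k, 'c, 'y) module_scheme \<Rightarrow> ('c \<Rightarrow> ('c, 'c) tensor) \<Rightarrow> bool"
  where "coseparable K C \<Delta> \<longleftrightarrow> (\<exists>r. linear_map K (ktensor K C C) C r \<and>
    (\<forall>x\<in>carrier C. \<forall>y\<in>carrier C. \<Delta> (r (kpure K C C x y)) =
       tensor_lift (ktensor K C C) (\<lambda>x1 x2. kpure K C C x1 (r (kpure K C C x2 y))) (\<Delta> x)) \<and>
    (\<forall>x\<in>carrier C. \<forall>y\<in>carrier C. \<Delta> (r (kpure K C C x y)) =
       tensor_lift (ktensor K C C) (\<lambda>y1 y2. kpure K C C (r (kpure K C C x y1)) y2) (\<Delta> y)) \<and>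
    (\<forall>x\<in>carrier C. r (\<Delta> x) = x))"

locale right_comodule_algebra = H: weak_bialgebra K H \<Delta> \<epsilon> + assoc_algebra K A
  for K :: "('k, 'x) ring_scheme" and H :: "('k, 'h, 'y) module_scheme"
    and \<Delta> :: "'h \<Rightarrow> ('h, 'h) tensor" and \<epsilon> :: "'h \<Rightarrow> 'k"
    and A :: "('k, 'a, 'z) module_scheme" +
  fixes \<rho> :: "'a \<Rightarrow> ('a, 'h) tensor"
  assumes coaction_linear: "linear_map K A (ktensor K A H) \<rho>"
    and coaction_coassoc: "a \<in> carrier A \<Longrightarrow>
      ktensor_assoc K A H H (ktensor_map K (ktensor K A H) H \<rho> id (\<rho> a)) =
      ktensor_map K A (ktensor K H H) id \<Delta> (\<rho> a)"
    and coaction_counit: "a \<in> carrier A \<Longrightarrow> tensor_lift A (\<lambda>x h. \<epsilon> h \<odot>\<^bsub>A\<^esub> x) (\<rho> a) = a"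
    and coaction_mult: "\<lbrakk>a \<in> carrier A; b \<in> carrier A\<rbrakk> \<Longrightarrow>
      \<rho> (a \<otimes>\<^bsub>A\<^esub> b) = \<rho> a \<otimes>\<^bsub>ktensor K A H\<^esub> \<rho> b"
    and coaction_one: "a \<in> carrier A \<Longrightarrow>
      ktensor_map K A H id (Pi_L H \<Delta> \<epsilon>) (\<rho> a) =
      tensor_lift (ktensor K A H) (\<lambda>x h. kpure K A H (x \<otimes>\<^bsub>A\<^esub> a) h) (\<rho> \<one>\<^bsub>A\<^esub>)"


section \<open>Corings\<close>

record ('a, 'c) bimodule = "('a, 'c) module" +
  rsmult :: "'c \<Rightarrow> 'a \<Rightarrow> 'c"

record ('a, 'c) coring = "('a, 'c) bimodule" +
  comult :: "'c \<Rightarrow> ('c, 'c) tensor"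
  counit :: "'c \<Rightarrow> 'a"

definition bitensor ::
  "('a, 'x) ring_scheme \<Rightarrow> ('a, 'm, 'y) bimodule_scheme \<Rightarrow> ('a, 'n, 'z) bimodule_scheme \<Rightarrow>
   ('m, 'n) tensor ring"
  where "bitensor A M N = balanced_tensor M (rsmult M) A (smult N) N"

definition bipure ::
  "('a, 'x) ring_scheme \<Rightarrow> ('a, 'm, 'y) bimodule_scheme \<Rightarrow> ('a, 'n, 'z) bimodule_scheme \<Rightarrow>
   'm \<Rightarrow> 'n \<Rightarrow> ('m, 'n) tensor"
  where "bipure A M N = balanced_pure M (rsmult M) A (smult N) N"

definition coring_iso ::
  "('a, 'x) ring_scheme \<Rightarrow> ('a, 'c, 'y) coring_scheme \<Rightarrow> ('a, 'd, 'z) coring_scheme \<Rightarrow>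
   ('c \<Rightarrow> 'd) \<Rightarrow> bool"
  where "coring_iso A C D f \<longleftrightarrow>
    bij_betw f (carrier C) (carrier D) \<and>
    linear_map A C D f \<and>
    (\<forall>c\<in>carrier C. \<forall>a\<in>carrier A. f (rsmult C c a) = rsmult D (f c) a) \<and>
    (\<forall>c\<in>carrier C.
       comult D (f c) = tensor_lift (bitensor A D D) (\<lambda>x y. bipure A D D (f x) (f y)) (comult C c)) \<and>
    (\<forall>c\<in>carrier C. counit D (f c) = counit C c)"

definition sweedler_bimodule :: "('a, 'x) ring_scheme \<Rightarrow> 'a set \<Rightarrow> ('a, ('a, 'a) tensor) bimodule"
  where "sweedler_bimodule A B =
    (let R = A\<lparr>carrier := B\<rparr>;
         T = balanced_tensor A (monoid.mult A) R (monoid.mult A) A;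
         pure = balanced_pure A (monoid.mult A) R (monoid.mult A) A
     in \<lparr>carrier = carrier T, monoid.mult = undefined, monoid.one = undefined, ring.zero = \<zero>\<^bsub>T\<^esub>, ring.add = ring.add T,
         smult = (\<lambda>a. tensor_lift T (\<lambda>x y. pure (a \<otimes>\<^bsub>A\<^esub> x) y)),
         rsmult = (\<lambda>t a. tensor_lift T (\<lambda>x y. pure x (y \<otimes>\<^bsub>A\<^esub> a)) t)\<rparr>)"

definition sweedler_coring :: "('a, 'x) ring_scheme \<Rightarrow> 'a set \<Rightarrow> ('a, ('a, 'a) tensor) coring"
  where "sweedler_coring A B =
    (let R = A\<lparr>carrier := B\<rparr>;
         pure = balanced_pure A (monoid.mult A) R (monoid.mult A) A;
         W = sweedler_bimodule A B
     in bimodule.extend W (coring.fields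
          (tensor_lift (bitensor A W W) (\<lambda>a a'. bipure A W W (pure a \<one>\<^bsub>A\<^esub>) (pure \<one>\<^bsub>A\<^esub> a')))
          (tensor_lift A (monoid.mult A))))"

definition p_R ::
  "('k, 'x) ring_scheme \<Rightarrow> ('k, 'h, 'y) module_scheme \<Rightarrow> ('k, 'a, 'z) module_scheme \<Rightarrow>
   ('a \<Rightarrow> ('a, 'h) tensor) \<Rightarrow> ('a, 'h) tensor \<Rightarrow> ('a, 'h) tensor"
  where "p_R K H A \<rho> =
    tensor_lift (ktensor K A H) (\<lambda>a h.
      tensor_lift (ktensor K A H) (\<lambda>x y. kpure K A H (a \<otimes>\<^bsub>A\<^esub> x) (h \<otimes>\<^bsub>H\<^esub> y)) (\<rho> \<one>\<^bsub>A\<^esub>))"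

text \<open>
  The bimodule structure of \<open>\<EE>\<close>.  The actions are given on all of \<open>A \<otimes> H\<close> by \<open>b' (a \<otimes> h) = b' a \<otimes> h\<close>
  and \<open>(a \<otimes> h) b = \<Sum> a b\<^sub>0 \<otimes> h b\<^sub>1\<close>; on \<open>p_R (a \<otimes> h)\<close>, multiplicativity of \<open>\<rho>\<close> turns the second into
  \<open>\<Sum> a b\<^sub>0 \<otimes> h b\<^sub>1\<close> again.
\<close>

definition E_bimodule ::
  "('k, 'x) ring_scheme \<Rightarrow> ('k, 'h, 'y) module_scheme \<Rightarrow> ('k, 'a, 'z) module_scheme \<Rightarrow>
   ('a \<Rightarrow> ('a, 'h) tensor) \<Rightarrow> ('a, ('a, 'h) tensor) bimodule"
  where "E_bimodule K H A \<rho> =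
    (let T = ktensor K A H
     in \<lparr>carrier = p_R K H A \<rho> ` carrier T, monoid.mult = undefined, monoid.one = undefined,
         ring.zero = \<zero>\<^bsub>T\<^esub>, ring.add = ring.add T,
         smult = (\<lambda>b. tensor_lift T (\<lambda>a h. kpure K A H (b \<otimes>\<^bsub>A\<^esub> a) h)),
         rsmult = (\<lambda>t b. tensor_lift T (\<lambda>a h.
            tensor_lift T (\<lambda>x y. kpure K A H (a \<otimes>\<^bsub>A\<^esub> x) (h \<otimes>\<^bsub>H\<^esub> y)) (\<rho> b)) t)\<rparr>)"

text \<open>
  The coproduct \<open>p_R u \<mapsto> \<Sum> p_R (a \<otimes> h\<^sub>1) \<otimes>\<^sub>A p_R (1 \<otimes> h\<^sub>2)\<close>, \<open>u = \<Sum> a \<otimes> h\<close>, is evaluated on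
  \<open>t \<in> \<EE>\<close> with \<open>u = t\<close>, as \<open>p_R t = t\<close>.
\<close>

definition E_coring ::
  "('k, 'x) ring_scheme \<Rightarrow> ('k, 'h, 'y) module_scheme \<Rightarrow> ('h \<Rightarrow> ('h, 'h) tensor) \<Rightarrow> ('h \<Rightarrow> 'k) \<Rightarrow>
   ('k, 'a, 'z) module_scheme \<Rightarrow> ('a \<Rightarrow> ('a, 'h) tensor) \<Rightarrow> ('a, ('a, 'h) tensor) coring"
  where "E_coring K H \<Delta> \<epsilon> A \<rho> =
    (let E = E_bimodule K H A \<rho>
     in bimodule.extend E (coring.fields
          (tensor_lift (bitensor A E E) (\<lambda>a h. tensor_lift (bitensor A E E) (\<lambda>h1 h2.
             bipure A E E (p_R K H A \<rho> (kpure K A H a h1)) (p_R K H A \<rho> (kpure K A H \<one>\<^bsub>A\<^esub> h2))) (\<Delta> h)))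
          (tensor_lift A (\<lambda>a h. \<epsilon> h \<odot>\<^bsub>A\<^esub> a))))"


section \<open>Weak Hopf-Galois extensions\<close>

definition coinvariants ::
  "('k, 'x) ring_scheme \<Rightarrow> ('k, 'h, 'y) module_scheme \<Rightarrow> ('k, 'a, 'z) module_scheme \<Rightarrow>
   ('a \<Rightarrow> ('a, 'h) tensor) \<Rightarrow> 'a set"
  where "coinvariants K H A \<rho> = {b \<in> carrier A. \<forall>a\<in>carrier A.
    \<rho> (b \<otimes>\<^bsub>A\<^esub> a) = tensor_lift (ktensor K A H) (\<lambda>x h. kpure K A H (b \<otimes>\<^bsub>A\<^esub> x) h) (\<rho> a)}"

text \<open>
  \<open>a \<otimes> b \<mapsto> \<Sum> a b\<^sub>0 \<otimes> b\<^sub>1\<close>.  Since \<^const>\<open>tensor_lift\<close> does not mention the ring over which its argument is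
  balanced, this is the lifted canonical map on \<open>A \<otimes>\<^sub>k A\<close> as well as the canonical map on \<open>A \<otimes>\<^sub>B A\<close>.
\<close>

definition can_map ::
  "('k, 'x) ring_scheme \<Rightarrow> ('k, 'h, 'y) module_scheme \<Rightarrow> ('k, 'a, 'z) module_scheme \<Rightarrow>
   ('a \<Rightarrow> ('a, 'h) tensor) \<Rightarrow> ('a, 'a) tensor \<Rightarrow> ('a, 'h) tensor"
  where "can_map K H A \<rho> = tensor_lift (ktensor K A H) (\<lambda>a b.
    tensor_lift (ktensor K A H) (\<lambda>x h. kpure K A H (a \<otimes>\<^bsub>A\<^esub> x) h) (\<rho> b))"

definition weak_hopf_galois ::
  "('k, 'x) ring_scheme \<Rightarrow> ('k, 'h, 'y) module_scheme \<Rightarrow> ('h \<Rightarrow> ('h, 'h) tensor) \<Rightarrow> ('h \<Rightarrow> 'k) \<Rightarrow>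
   ('k, 'a, 'z) module_scheme \<Rightarrow> ('a \<Rightarrow> ('a, 'h) tensor) \<Rightarrow> bool"
  where "weak_hopf_galois K H \<Delta> \<epsilon> A \<rho> \<longleftrightarrow>
    coring_iso A (sweedler_coring A (coinvariants K H A \<rho>)) (E_coring K H \<Delta> \<epsilon> A \<rho>) (can_map K H A \<rho>)"

definition equivariantly_projective ::
  "('k, 'x) ring_scheme \<Rightarrow> ('k, 'h, 'y) module_scheme \<Rightarrow> ('k, 'a, 'z) module_scheme \<Rightarrow>
   ('a \<Rightarrow> ('a, 'h) tensor) \<Rightarrow> bool"
  where "equivariantly_projective K H A \<rho> \<longleftrightarrow>
    (let B = A\<lparr>carrier := coinvariants K H A \<rho>\<rparr>
     in projective_module B (regular_module A) \<and>
        (\<exists>s. linear_map K A (ktensor K B A) s \<and>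
          (\<forall>b\<in>carrier B. \<forall>a\<in>carrier A.
             s (b \<otimes>\<^bsub>A\<^esub> a) = tensor_lift (ktensor K B A) (\<lambda>x y. kpure K B A (b \<otimes>\<^bsub>A\<^esub> x) y) (s a)) \<and>
          (\<forall>a\<in>carrier A.
             ktensor_assoc K B A H (ktensor_map K (ktensor K B A) H s id (\<rho> a)) =
             ktensor_map K B (ktensor K A H) id \<rho> (s a)) \<and>
          (\<forall>a\<in>carrier A. tensor_lift A (monoid.mult A) (s a) = a)))"

end

theory Submission
  imports Defs
begin

text \<open>
  A normalised integral turns the surjectivity of the lifted canonical map into an equivariant section.
  Let \<open>\<delta>\<close> be the coseparability form.  The functional \<open>\<phi>(h) = \<Sum> \<delta> (h 1\<^sub>1 \<otimes> 1\<^sub>2)\<close> agrees with \<open>\<epsilon>\<close> on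
  \<open>\<Pi>\<^sup>L(H)\<close>, and \<open>\<Sum> h\<^sub>1 \<phi>(h\<^sub>2)\<close> lies in the span of the second legs of \<open>\<Delta> 1\<close>; hence the trace
  \<open>tr a = \<Sum> a\<^sub>0 \<phi>(a\<^sub>1)\<close> takes values in \<open>B\<close>.  As \<open>H\<close> is \<open>k\<close>-projective, \<open>h \<mapsto> p_R (1 \<otimes> h)\<close> lifts to a linear map
  \<open>H \<rightarrow> A \<otimes> A\<close>, which \<open>\<delta>\<close> averages to a right colinear \<open>\<tau>\<close> with \<open>\<Sum> can (b\<^sub>0 \<tau>(b\<^sub>1)) = \<rho>(b)\<close>.  Writing
  \<open>\<tau>(h) = \<Sum> x \<otimes> y\<close>, the map \<open>b \<mapsto> \<Sum> tr (b\<^sub>0 x) \<otimes> y\<close> with \<open>x \<otimes> y\<close> from \<open>\<tau>(b\<^sub>1)\<close> is left \<open>B\<close>-linear and right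
  colinear.  It splits the multiplication \<open>B \<otimes> A \<rightarrow> A\<close>, because \<open>\<Sum> z\<^sub>0 y \<otimes> z\<^sub>1 = \<Sum> u\<^sub>0 \<otimes> u\<^sub>1 S(g)\<close> for
  \<open>u \<otimes> g = can (z \<otimes> y)\<close>, so that the product of the two legs is \<open>\<Sum> b\<^sub>0 \<phi>(\<Pi>\<^sup>L(b\<^sub>1)) = b\<close>.  The same formula extends
  to \<open>a \<otimes> h \<mapsto> \<Sum> a x\<^sub>0 \<phi>(h\<^sub>1 x\<^sub>1) \<otimes>\<^sub>B y\<close> with \<open>x \<otimes> y\<close> from \<open>\<tau>(h\<^sub>2)\<close>, a left inverse of \<open>can\<close>.
\<close>

text \<open>For an ordinary Hopf algebra the integral is \<open>\<delta> (h \<otimes> 1)\<close>,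
  and it has to be normalised at 1 alone. Here the image of \<open>\<Pi>\<^sup>L\<close> can be
  larger than the scalars and \<open>\<Delta> 1\<close> can differ from
  \<open>1 \<otimes> 1\<close>. An element \<open>z\<close> of that image satisfies
  \<open>\<Delta> z = \<Sum> z 1\<^sub>1 \<otimes> 1\<^sub>2\<close>, so spreading
  \<open>\<Delta> 1\<close> over both arguments of \<open>\<delta>\<close> gives
  \<open>\<delta> (\<Delta> z) = \<epsilon> z\<close>. Projectivity over \<open>B\<close>: the
  section makes \<open>A\<close> a \<open>B\<close>-linear retract of \<open>B \<otimes> A\<close>,
  and \<open>B \<otimes> A\<close> is a retract of a free \<open>B\<close>-module because
  \<open>A\<close> is a retract of a free \<open>k\<close>-module. Sweedler identities are stated
  after evaluation on an arbitrary multilinear map. An equation between threefold tensors becomes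
  one between nested sums, so that associators disappear and rewriting takes place under the map.
  Computations in \<open>A \<otimes>\<^sub>B A\<close> and
  \<open>\<EE> \<otimes>\<^sub>A \<EE>\<close> are carried out in tensor products over
  \<open>k\<close> and then projected.\<close>

section \<open>Balanced tensor products\<close>

definition balanced_map ::
  "('m, 'x) ring_scheme \<Rightarrow> ('m \<Rightarrow> 'r \<Rightarrow> 'm) \<Rightarrow> ('r, 'y) ring_scheme \<Rightarrow> ('r \<Rightarrow> 'n \<Rightarrow> 'n) \<Rightarrow>
   ('n, 'z) ring_scheme \<Rightarrow> ('p, 'w) ring_scheme \<Rightarrow> ('m \<Rightarrow> 'n \<Rightarrow> 'p) \<Rightarrow> bool"
  where "balanced_map M ra R la N P f \<longleftrightarrow>
    (\<forall>m\<in>carrier M. \<forall>n\<in>carrier N. f m n \<in> carrier P) \<and>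
    (\<forall>m\<in>carrier M. \<forall>m'\<in>carrier M. \<forall>n\<in>carrier N. f (m \<oplus>\<^bsub>M\<^esub> m') n = f m n \<oplus>\<^bsub>P\<^esub> f m' n) \<and>
    (\<forall>m\<in>carrier M. \<forall>n\<in>carrier N. \<forall>n'\<in>carrier N. f m (n \<oplus>\<^bsub>N\<^esub> n') = f m n \<oplus>\<^bsub>P\<^esub> f m n') \<and>
    (\<forall>m\<in>carrier M. \<forall>r\<in>carrier R. \<forall>n\<in>carrier N. f (ra m r) n = f m (la r n))"

lemma balanced_mapI:
  assumes "\<And>m n. \<lbrakk>m \<in> carrier M; n \<in> carrier N\<rbrakk> \<Longrightarrow> f m n \<in> carrier P"
    and "\<And>m m' n. \<lbrakk>m \<in> carrier M; m' \<in> carrier M; n \<in> carrier N\<rbrakk> \<Longrightarrow> f (m \<oplus>\<^bsub>M\<^esub> m') n = f m n \<oplus>\<^bsub>P\<^esub> f m' n"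
    and "\<And>m n n'. \<lbrakk>m \<in> carrier M; n \<in> carrier N; n' \<in> carrier N\<rbrakk> \<Longrightarrow> f m (n \<oplus>\<^bsub>N\<^esub> n') = f m n \<oplus>\<^bsub>P\<^esub> f m n'"
    and "\<And>m r n. \<lbrakk>m \<in> carrier M; r \<in> carrier R; n \<in> carrier N\<rbrakk> \<Longrightarrow> f (ra m r) n = f m (la r n)"
  shows "balanced_map M ra R la N P f"
  using assms unfolding balanced_map_def by auto

lemma balanced_map_closed:
  "\<lbrakk>balanced_map M ra R la N P f; m \<in> carrier M; n \<in> carrier N\<rbrakk> \<Longrightarrow> f m n \<in> carrier P"
  unfolding balanced_map_def by auto

lemma balanced_map_add_left:
  "\<lbrakk>balanced_map M ra R la N P f; m \<in> carrier M; m' \<in> carrier M; n \<in> carrier N\<rbrakk>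
   \<Longrightarrow> f (m \<oplus>\<^bsub>M\<^esub> m') n = f m n \<oplus>\<^bsub>P\<^esub> f m' n"
  unfolding balanced_map_def by auto

lemma balanced_map_add_right:
  "\<lbrakk>balanced_map M ra R la N P f; m \<in> carrier M; n \<in> carrier N; n' \<in> carrier N\<rbrakk>
   \<Longrightarrow> f m (n \<oplus>\<^bsub>N\<^esub> n') = f m n \<oplus>\<^bsub>P\<^esub> f m n'"
  unfolding balanced_map_def by auto

lemma balanced_map_act:
  "\<lbrakk>balanced_map M ra R la N P f; m \<in> carrier M; r \<in> carrier R; n \<in> carrier N\<rbrakk>
   \<Longrightarrow> f (ra m r) n = f m (la r n)"
  unfolding balanced_map_def by auto

section \<open>Integer multiples and maps out of a free abelian group\<close>

lemma (in abelian_group) add_pow_int_closed: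
  "x \<in> carrier G \<Longrightarrow> add_pow G (k::int) x \<in> carrier G"
  unfolding add_pow_def using group.int_pow_closed[OF a_group, of x k] by simp

lemma (in abelian_group) add_pow_int_0: "add_pow G (0::int) x = \<zero>"
  unfolding add_pow_def by simp

lemma (in abelian_group) add_pow_int_1: "x \<in> carrier G \<Longrightarrow> add_pow G (1::int) x = x"
  unfolding add_pow_def using group.int_pow_1[OF a_group, of x] by simp

lemma (in abelian_group) add_pow_int_add:
  "x \<in> carrier G \<Longrightarrow> add_pow G (k + l::int) x = add_pow G k x \<oplus> add_pow G l x"
  unfolding add_pow_def using group.int_pow_mult[OF a_group, of x k l] by simp

text \<open>Outside the support of \<open>u\<close> the multiplicity is 0, so the index set may be
  enlarged. Elements with different supports are then compared over the union of these.\<close>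

lemma (in abelian_group) finsum_frag_superset:
  fixes u :: "'i \<Rightarrow>\<^sub>0 int"
  assumes "g \<in> S \<rightarrow> carrier G" "finite X" "Poly_Mapping.keys u \<subseteq> X" "X \<subseteq> S"
  shows "finsum G (\<lambda>x. add_pow G (Poly_Mapping.lookup u x) (g x)) (Poly_Mapping.keys u) =
    finsum G (\<lambda>x. add_pow G (Poly_Mapping.lookup u x) (g x)) X"
  using assms
  by (intro add.finprod_mono_neutral_cong_left)
     (auto simp: in_keys_iff Pi_iff add_pow_int_0 intro!: add_pow_int_closed)

lemma (in abelian_group) finsum_frag_add:
  fixes u :: "'i \<Rightarrow>\<^sub>0 int"
  assumes g: "g \<in> S \<rightarrow> carrier G" and u: "Poly_Mapping.keys u \<subseteq> S" and v: "Poly_Mapping.keys v \<subseteq> S"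
  shows "finsum G (\<lambda>x. add_pow G (Poly_Mapping.lookup (u + v) x) (g x)) (Poly_Mapping.keys (u + v)) =
    finsum G (\<lambda>x. add_pow G (Poly_Mapping.lookup u x) (g x)) (Poly_Mapping.keys u) \<oplus>
    finsum G (\<lambda>x. add_pow G (Poly_Mapping.lookup v x) (g x)) (Poly_Mapping.keys v)"
proof -
  let ?X = "Poly_Mapping.keys u \<union> Poly_Mapping.keys v"
  have X: "finite ?X" "?X \<subseteq> S" using u v by auto
  have c: "x \<in> ?X \<Longrightarrow> g x \<in> carrier G" for x using g X by auto
  have "finsum G (\<lambda>x. add_pow G (Poly_Mapping.lookup (u + v) x) (g x)) (Poly_Mapping.keys (u + v)) =
    finsum G (\<lambda>x. add_pow G (Poly_Mapping.lookup (u + v) x) (g x)) ?X"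
    using X by (intro finsum_frag_superset[OF g]) (auto dest: subsetD[OF keys_add])
  also have "\<dots> = finsum G (\<lambda>x. add_pow G (Poly_Mapping.lookup u x) (g x) \<oplus>
      add_pow G (Poly_Mapping.lookup v x) (g x)) ?X"
    using c by (intro finsum_cong')
      (auto simp: lookup_add add_pow_int_add intro!: a_closed add_pow_int_closed)
  also have "\<dots> = finsum G (\<lambda>x. add_pow G (Poly_Mapping.lookup u x) (g x)) ?X \<oplus>
      finsum G (\<lambda>x. add_pow G (Poly_Mapping.lookup v x) (g x)) ?X"
    using c by (intro finsum_addf) (auto intro!: add_pow_int_closed)
  also have "finsum G (\<lambda>x. add_pow G (Poly_Mapping.lookup u x) (g x)) ?X =
      finsum G (\<lambda>x. add_pow G (Poly_Mapping.lookup u x) (g x)) (Poly_Mapping.keys u)"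
    using X by (intro finsum_frag_superset[OF g, symmetric]) auto
  also have "finsum G (\<lambda>x. add_pow G (Poly_Mapping.lookup v x) (g x)) ?X =
      finsum G (\<lambda>x. add_pow G (Poly_Mapping.lookup v x) (g x)) (Poly_Mapping.keys v)"
    using X by (intro finsum_frag_superset[OF g, symmetric]) auto
  finally show ?thesis .
qed

text \<open>Universal property of the free abelian group, in the form in which
  \<open>tensor_lift\<close> evaluates a representative.\<close>

lemma (in abelian_group) finsum_frag_hom:
  assumes g: "g \<in> S \<rightarrow> carrier G"
  shows "group_hom (free_Abelian_group S) (add_monoid G)
    (\<lambda>u. finsum G (\<lambda>x. add_pow G (Poly_Mapping.lookup u x) (g x)) (Poly_Mapping.keys u))"
proof (rule group_hom.intro)
  show "group_hom_axioms (free_Abelian_group S) (add_monoid G)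
    (\<lambda>u. finsum G (\<lambda>x. add_pow G (Poly_Mapping.lookup u x) (g x)) (Poly_Mapping.keys u))"
  proof (rule group_hom_axioms.intro, rule homI)
    fix u assume "u \<in> carrier (free_Abelian_group S)"
    then show "finsum G (\<lambda>x. add_pow G (Poly_Mapping.lookup u x) (g x)) (Poly_Mapping.keys u)
        \<in> carrier (add_monoid G)"
      using g by (auto intro!: finsum_closed add_pow_int_closed)
  qed (use finsum_frag_add[OF g] in auto)
qed (use a_group in auto)

lemma (in abelian_group) finsum_frag_of:
  assumes "g x \<in> carrier G"
  shows "finsum G (\<lambda>y. add_pow G (Poly_Mapping.lookup (frag_of x) y) (g y)) (Poly_Mapping.keys (frag_of x)) = g x"
proof -
  have "finsum G (\<lambda>y. add_pow G (Poly_Mapping.lookup (frag_of x) y) (g y)) {x} = add_pow G (1::int) (g x)"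
    using assms add_pow_int_1[OF assms]
    by (simp add: finsum_insert[of "{}" x, simplified])
  then show ?thesis using assms by (simp add: keys_frag_of)
qed

text \<open>One setting for all tensor products that occur: over \<open>K\<close>, over the
  coinvariants, and over \<open>A\<close> for the bimodules of the two corings.\<close>

locale balanced_setting = M: abelian_group M + N: abelian_group N
  for M :: "('m, 'x) ring_scheme" and ra :: "'m \<Rightarrow> 'r \<Rightarrow> 'm" and R :: "('r, 'y) ring_scheme"
    and la :: "'r \<Rightarrow> 'n \<Rightarrow> 'n" and N :: "('n, 'z) ring_scheme" +
  assumes ra_closed: "\<lbrakk>m \<in> carrier M; r \<in> carrier R\<rbrakk> \<Longrightarrow> ra m r \<in> carrier M"
    and la_closed: "\<lbrakk>r \<in> carrier R; n \<in> carrier N\<rbrakk> \<Longrightarrow> la r n \<in> carrier N"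
begin

abbreviation "FG \<equiv> free_Abelian_group (carrier M \<times> carrier N)"
abbreviation "TR \<equiv> tensor_relations M ra R la N"
abbreviation "TN \<equiv> balanced_tensor M ra R la N"
abbreviation "pure \<equiv> balanced_pure M ra R la N"

interpretation F: comm_group FG
  by (rule abelian_free_Abelian_group)

lemma tensor_relations_subgroup: "subgroup TR FG"
  unfolding tensor_relations_def
proof (rule F.generate_is_subgroup, safe)
qed (auto simp: ra_closed la_closed dest!: subsetD[OF keys_diff] split: if_splits)

lemma tensor_relations_normal: "normal TR FG"
  by (rule F.subgroup_imp_normal[OF tensor_relations_subgroup])

lemma tensor_abelian_group: "abelian_group TN"
proof -
  have "comm_group (FG Mod TR)" by (rule F.abelian_FactGroup[OF tensor_relations_subgroup])
  moreover have "add_monoid TN = FG Mod TR"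
    by (simp add: balanced_tensor_def Let_def FactGroup_def)
  ultimately have "comm_group (add_monoid TN)" by simp
  then show ?thesis
    by (intro abelian_group.intro abelian_monoid.intro abelian_group_axioms.intro)
       (simp_all add: comm_group.axioms)
qed

sublocale T: abelian_group TN by (rule tensor_abelian_group)

lemma carrier_tensor_eq: "carrier TN = rcosets\<^bsub>FG\<^esub> TR"
  by (simp add: balanced_tensor_def Let_def FactGroup_def)

lemma tensor_add_eq: "s \<oplus>\<^bsub>TN\<^esub> t = s <#>\<^bsub>FG\<^esub> t"
  by (simp add: balanced_tensor_def Let_def FactGroup_def)

lemma coset_add: "\<lbrakk>u \<in> carrier FG; v \<in> carrier FG\<rbrakk> \<Longrightarrow>
    (TR #>\<^bsub>FG\<^esub> u) \<oplus>\<^bsub>TN\<^esub> (TR #>\<^bsub>FG\<^esub> v) = TR #>\<^bsub>FG\<^esub> (u + v)"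
  unfolding tensor_add_eq
  using normal.rcos_sum[OF tensor_relations_normal] by simp

lemma coset_in_carrier: "u \<in> carrier FG \<Longrightarrow> TR #>\<^bsub>FG\<^esub> u \<in> carrier TN"
  unfolding carrier_tensor_eq by (rule F.rcosetsI) (use tensor_relations_subgroup subgroup.subset in auto)

lemma coset_eqI:
  assumes "u \<in> carrier FG" "v \<in> carrier FG" "u - v \<in> TR"
  shows "TR #>\<^bsub>FG\<^esub> u = TR #>\<^bsub>FG\<^esub> v"
proof -
  have "u = (u - v) \<otimes>\<^bsub>FG\<^esub> v" by simp
  then have "u \<in> TR #>\<^bsub>FG\<^esub> v" using assms(3) unfolding r_coset_def by blast
  then show ?thesis using F.repr_independence[OF _ assms(2) tensor_relations_subgroup] by simp
qed

lemma relation_in: "x \<in>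
     ({frag_of (m \<oplus>\<^bsub>M\<^esub> m', n) - frag_of (m, n) - frag_of (m', n) | m m' n.
        m \<in> carrier M \<and> m' \<in> carrier M \<and> n \<in> carrier N} \<union>
     {frag_of (m, n \<oplus>\<^bsub>N\<^esub> n') - frag_of (m, n) - frag_of (m, n') | m n n'.
        m \<in> carrier M \<and> n \<in> carrier N \<and> n' \<in> carrier N} \<union>
     {frag_of (ra m r, n) - frag_of (m, la r n) | m r n.
        m \<in> carrier M \<and> r \<in> carrier R \<and> n \<in> carrier N}) \<Longrightarrow> x \<in> TR"
  unfolding tensor_relations_def by (rule generate.incl)

lemma frag_add_carrier: "\<lbrakk>x \<in> carrier M \<times> carrier N; y \<in> carrier M \<times> carrier N\<rbrakk>
    \<Longrightarrow> frag_of x + frag_of y \<in> carrier FG"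
  by (auto dest!: subsetD[OF keys_add] split: if_splits)

lemma pure_balanced: "balanced_map M ra R la N TN pure"
proof (rule balanced_mapI)
  fix m n assume mn: "m \<in> carrier M" "n \<in> carrier N"
  show "pure m n \<in> carrier TN"
    unfolding balanced_pure_def using mn by (intro coset_in_carrier) simp
next
  fix m m' n assume mn: "m \<in> carrier M" "m' \<in> carrier M" "n \<in> carrier N"
  have "frag_of (m \<oplus>\<^bsub>M\<^esub> m', n) - (frag_of (m, n) + frag_of (m', n)) \<in> TR"
    using mn by (intro relation_in UnI1) (auto simp: diff_diff_eq)
  then show "pure (m \<oplus>\<^bsub>M\<^esub> m') n = pure m n \<oplus>\<^bsub>TN\<^esub> pure m' n"
    unfolding balanced_pure_def using mn
    by (simp add: coset_add coset_eqI frag_add_carrier del: carrier_free_Abelian_group_iff)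
next
  fix m n n' assume mn: "m \<in> carrier M" "n \<in> carrier N" "n' \<in> carrier N"
  have "frag_of (m, n \<oplus>\<^bsub>N\<^esub> n') - (frag_of (m, n) + frag_of (m, n')) \<in> TR"
    using mn by (intro relation_in UnI1[OF UnI2]) (auto simp: diff_diff_eq)
  then show "pure m (n \<oplus>\<^bsub>N\<^esub> n') = pure m n \<oplus>\<^bsub>TN\<^esub> pure m n'"
    unfolding balanced_pure_def using mn
    by (simp add: coset_add coset_eqI frag_add_carrier del: carrier_free_Abelian_group_iff)
next
  fix m r n assume mn: "m \<in> carrier M" "r \<in> carrier R" "n \<in> carrier N"
  have "frag_of (ra m r, n) - frag_of (m, la r n) \<in> TR"
    using mn by (intro relation_in UnI2) auto
  then show "pure (ra m r) n = pure m (la r n)"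
    unfolding balanced_pure_def using mn ra_closed la_closed
    by (intro coset_eqI) auto
qed

lemmas pure_closed = balanced_map_closed[OF pure_balanced]
lemmas pure_add_left = balanced_map_add_left[OF pure_balanced]
lemmas pure_add_right = balanced_map_add_right[OF pure_balanced]
lemmas pure_act = balanced_map_act[OF pure_balanced]

lemma pure_zero_left: "n \<in> carrier N \<Longrightarrow> pure \<zero>\<^bsub>M\<^esub> n = \<zero>\<^bsub>TN\<^esub>"
  using pure_add_left[of "\<zero>\<^bsub>M\<^esub>" "\<zero>\<^bsub>M\<^esub>" n] pure_closed[of "\<zero>\<^bsub>M\<^esub>" n]
  by (metis M.zero_closed M.l_zero T.add.l_cancel_one')

lemma pure_minus_left: "\<lbrakk>m \<in> carrier M; n \<in> carrier N\<rbrakk> \<Longrightarrow> pure (\<ominus>\<^bsub>M\<^esub> m) n = \<ominus>\<^bsub>TN\<^esub> pure m n"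
  using pure_add_left[of "\<ominus>\<^bsub>M\<^esub> m" m n] pure_closed pure_zero_left
  by (simp add: M.l_neg T.minus_equality)

text \<open>A negated pure tensor is again pure, by negating its left factor, so the induction has
  no case for inverses.\<close>

lemma tensor_induct [consumes 1, case_names zero pure add]:
  assumes t: "t \<in> carrier TN"
    and z: "Q \<zero>\<^bsub>TN\<^esub>" and p: "\<And>m n. \<lbrakk>m \<in> carrier M; n \<in> carrier N\<rbrakk> \<Longrightarrow> Q (pure m n)"
    and a: "\<And>s t. \<lbrakk>s \<in> carrier TN; t \<in> carrier TN; Q s; Q t\<rbrakk> \<Longrightarrow> Q (s \<oplus>\<^bsub>TN\<^esub> t)"
  shows "Q t"
proof -
  obtain u where u: "u \<in> carrier FG" "t = TR #>\<^bsub>FG\<^esub> u"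
    using t unfolding carrier_tensor_eq RCOSETS_def by auto
  have uc: "Poly_Mapping.keys u \<subseteq> carrier M \<times> carrier N" using u(1) by simp
  \<comment> \<open>The induction on the free abelian group proceeds by differences, hence the claim
    has to cover \<open>- u\<close> along with \<open>u\<close>.\<close>
  then have "Q (TR #>\<^bsub>FG\<^esub> u) \<and> Q (TR #>\<^bsub>FG\<^esub> (- u))"
  proof (induction u rule: free_Abelian_group_induct[consumes 1, case_names zero diff one])
    case zero
    have "TR #>\<^bsub>FG\<^esub> 0 = \<zero>\<^bsub>TN\<^esub>"
      using F.coset_mult_one[of TR] subgroup.subset[OF tensor_relations_subgroup]
      by (simp add: balanced_tensor_def Let_def FactGroup_def)
    then show ?case using z by simp
  next
    case (diff x y)
    have "TR #>\<^bsub>FG\<^esub> (x - y) = (TR #>\<^bsub>FG\<^esub> x) \<oplus>\<^bsub>TN\<^esub> (TR #>\<^bsub>FG\<^esub> (- y))"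
      "TR #>\<^bsub>FG\<^esub> (y - x) = (TR #>\<^bsub>FG\<^esub> y) \<oplus>\<^bsub>TN\<^esub> (TR #>\<^bsub>FG\<^esub> (- x))"
      using diff by (simp_all add: coset_add keys_minus)
    then show ?case using diff by (auto intro!: a coset_in_carrier simp: keys_minus)
  next
    case (one x)
    obtain m n where x: "x = (m, n)" "m \<in> carrier M" "n \<in> carrier N" using one by auto
    have c: "TR #>\<^bsub>FG\<^esub> frag_of x \<in> carrier TN" "TR #>\<^bsub>FG\<^esub> (- frag_of x) \<in> carrier TN"
      using one by (auto intro!: coset_in_carrier simp: keys_minus)
    have "TR #>\<^bsub>FG\<^esub> 0 = \<zero>\<^bsub>TN\<^esub>"
      using F.coset_mult_one[of TR] subgroup.subset[OF tensor_relations_subgroup]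
      by (simp add: balanced_tensor_def Let_def FactGroup_def)
    then have "(TR #>\<^bsub>FG\<^esub> (- frag_of x)) \<oplus>\<^bsub>TN\<^esub> (TR #>\<^bsub>FG\<^esub> frag_of x) = \<zero>\<^bsub>TN\<^esub>"
      using one by (simp add: coset_add keys_minus)
    then have "TR #>\<^bsub>FG\<^esub> (- frag_of x) = \<ominus>\<^bsub>TN\<^esub> (TR #>\<^bsub>FG\<^esub> frag_of x)"
      using c by (simp add: T.minus_equality)
    also have "\<dots> = pure (\<ominus>\<^bsub>M\<^esub> m) n"
      using pure_minus_left x by (simp add: balanced_pure_def)
    finally show ?case using x p[of m n] p[of "\<ominus>\<^bsub>M\<^esub> m" n] by (simp add: balanced_pure_def)
  qed
  then show ?thesis using u by simp
qed

section \<open>Universal property of the balanced tensor product\<close>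

context
  fixes P :: "('p, 'w) ring_scheme" and f
  assumes P: "abelian_group P" and f: "balanced_map M ra R la N P f"
begin

interpretation P: abelian_group P by (rule P)

abbreviation "lift_rep \<equiv> (\<lambda>u. finsum P (\<lambda>x. add_pow P (Poly_Mapping.lookup u x) (case x of (m, n) \<Rightarrow> f m n)) (Poly_Mapping.keys u))"

interpretation h: group_hom FG "add_monoid P" lift_rep
  using balanced_map_closed[OF f] by (intro P.finsum_frag_hom) auto

lemma lift_rep_of: "\<lbrakk>m \<in> carrier M; n \<in> carrier N\<rbrakk> \<Longrightarrow> lift_rep (frag_of (m, n)) = f m n"
  using balanced_map_closed[OF f] by (subst P.finsum_frag_of) auto

lemma lift_rep_diff: "\<lbrakk>u \<in> carrier FG; v \<in> carrier FG\<rbrakk> \<Longrightarrow> lift_rep (u - v) = lift_rep u \<ominus>\<^bsub>P\<^esub> lift_rep v"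
  using h.hom_mult[of u "- v"] h.hom_inv[of v]
  by (simp add: keys_minus a_inv_def a_minus_def)

lemma frag_diff_carrier: "\<lbrakk>u \<in> carrier FG; v \<in> carrier FG\<rbrakk> \<Longrightarrow> u - v \<in> carrier FG"
  by (auto dest!: subsetD[OF keys_diff])

text \<open>The kernel of \<open>lift_rep\<close> is a subgroup, so it suffices that it contains the
  three kinds of generators. These vanish by biadditivity and balancedness of
  \<open>f\<close>.\<close>

lemma lift_rep_relations: "u \<in> TR \<Longrightarrow> lift_rep u = \<zero>\<^bsub>P\<^esub>"
proof -
  let ?K = "kernel FG (add_monoid P) lift_rep"
  have K: "subgroup ?K FG" by (rule h.subgroup_kernel)
  have c: "m \<in> carrier M \<Longrightarrow> n \<in> carrier N \<Longrightarrow> frag_of (m, n) \<in> carrier FG" for m n by simp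
  note fc = balanced_map_closed[OF f]
  have "TR \<subseteq> ?K"
    unfolding tensor_relations_def
  proof (rule F.generate_subgroup_incl[OF _ K], safe)
    fix m m' n assume a: "m \<in> carrier M" "m' \<in> carrier M" "n \<in> carrier N"
    then have "lift_rep (frag_of (m \<oplus>\<^bsub>M\<^esub> m', n) - frag_of (m, n) - frag_of (m', n)) = \<zero>\<^bsub>P\<^esub>"
      by (simp only: lift_rep_diff frag_diff_carrier c M.a_closed lift_rep_of balanced_map_add_left[OF f])
         (use a fc[of m n] fc[of m' n] in \<open>simp add: a_minus_def P.a_ac P.minus_add P.r_neg P.r_neg1 P.r_neg2\<close>)
    then show "frag_of (m \<oplus>\<^bsub>M\<^esub> m', n) - frag_of (m, n) - frag_of (m', n) \<in> ?K"
      unfolding kernel_def using a frag_diff_carrier c by (simp del: carrier_free_Abelian_group_iff)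
  next
    fix m n n' assume a: "m \<in> carrier M" "n \<in> carrier N" "n' \<in> carrier N"
    then have "lift_rep (frag_of (m, n \<oplus>\<^bsub>N\<^esub> n') - frag_of (m, n) - frag_of (m, n')) = \<zero>\<^bsub>P\<^esub>"
      by (simp only: lift_rep_diff frag_diff_carrier c N.a_closed lift_rep_of balanced_map_add_right[OF f])
         (use a fc[of m n] fc[of m n'] in \<open>simp add: a_minus_def P.a_ac P.minus_add P.r_neg P.r_neg1 P.r_neg2\<close>)
    then show "frag_of (m, n \<oplus>\<^bsub>N\<^esub> n') - frag_of (m, n) - frag_of (m, n') \<in> ?K"
      unfolding kernel_def using a frag_diff_carrier c by (simp del: carrier_free_Abelian_group_iff)
  next
    fix m r n assume a: "m \<in> carrier M" "r \<in> carrier R" "n \<in> carrier N"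
    then have "lift_rep (frag_of (ra m r, n) - frag_of (m, la r n)) = \<zero>\<^bsub>P\<^esub>"
      by (simp only: lift_rep_diff frag_diff_carrier c ra_closed la_closed lift_rep_of balanced_map_act[OF f])
         (use a fc la_closed in \<open>simp add: a_minus_def P.r_neg\<close>)
    then show "frag_of (ra m r, n) - frag_of (m, la r n) \<in> ?K"
      unfolding kernel_def using a frag_diff_carrier c ra_closed la_closed
      by (simp del: carrier_free_Abelian_group_iff)
  qed
  then show "u \<in> TR \<Longrightarrow> lift_rep u = \<zero>\<^bsub>P\<^esub>" unfolding kernel_def by auto
qed

text \<open>Whatever representative \<open>SOME\<close> returns, it differs from \<open>u\<close> by
  an element of \<open>TR\<close>, on which \<open>lift_rep\<close> is zero.\<close>

lemma lift_coset:
  assumes u: "u \<in> carrier FG"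
  shows "tensor_lift P f (TR #>\<^bsub>FG\<^esub> u) = lift_rep u"
proof -
  have "u \<in> TR #>\<^bsub>FG\<^esub> u" by (rule F.rcos_self[OF u tensor_relations_subgroup])
  then have "(SOME v. v \<in> TR #>\<^bsub>FG\<^esub> u) \<in> TR #>\<^bsub>FG\<^esub> u" by (rule someI)
  then obtain x where x: "x \<in> TR" "(SOME v. v \<in> TR #>\<^bsub>FG\<^esub> u) = x + u" unfolding r_coset_def by auto
  have xF: "x \<in> carrier FG" using x(1) subgroup.subset[OF tensor_relations_subgroup] by blast
  have "tensor_lift P f (TR #>\<^bsub>FG\<^esub> u) = lift_rep (x + u)"
    unfolding tensor_lift_def Let_def x(2) by (simp add: case_prod_unfold)
  also have "\<dots> = lift_rep u" using h.hom_mult[OF xF u] lift_rep_relations[OF x(1)] h.hom_closed[OF u]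
    by (simp del: carrier_free_Abelian_group_iff add: xF)
  finally show ?thesis .
qed

lemma lift_closed: "t \<in> carrier TN \<Longrightarrow> tensor_lift P f t \<in> carrier P"
  using lift_coset h.hom_closed unfolding carrier_tensor_eq RCOSETS_def by auto

lemma lift_add: "\<lbrakk>s \<in> carrier TN; t \<in> carrier TN\<rbrakk> \<Longrightarrow>
    tensor_lift P f (s \<oplus>\<^bsub>TN\<^esub> t) = tensor_lift P f s \<oplus>\<^bsub>P\<^esub> tensor_lift P f t"
proof -
  assume "s \<in> carrier TN" "t \<in> carrier TN"
  then obtain u v where uv: "u \<in> carrier FG" "s = TR #>\<^bsub>FG\<^esub> u" "v \<in> carrier FG" "t = TR #>\<^bsub>FG\<^esub> v"
    unfolding carrier_tensor_eq RCOSETS_def by auto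
  have "u + v \<in> carrier FG" using F.m_closed[OF uv(1,3)] by simp
  then show ?thesis using uv h.hom_mult[OF uv(1,3)]
    by (simp add: coset_add lift_coset del: carrier_free_Abelian_group_iff)
qed

lemma lift_pure: "\<lbrakk>m \<in> carrier M; n \<in> carrier N\<rbrakk> \<Longrightarrow> tensor_lift P f (pure m n) = f m n"
  unfolding balanced_pure_def using lift_coset[of "frag_of (m, n)"] lift_rep_of[of m n] by simp

lemma lift_zero: "tensor_lift P f \<zero>\<^bsub>TN\<^esub> = \<zero>\<^bsub>P\<^esub>"
  using lift_add[of "\<zero>\<^bsub>TN\<^esub>" "\<zero>\<^bsub>TN\<^esub>"] lift_closed[of "\<zero>\<^bsub>TN\<^esub>"]
  by (metis T.zero_closed T.l_zero P.add.l_cancel_one')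

end

lemma additive_eqI:
  assumes "abelian_group P"
    and g: "\<And>t. t \<in> carrier TN \<Longrightarrow> g t \<in> carrier P" "\<And>s t. \<lbrakk>s \<in> carrier TN; t \<in> carrier TN\<rbrakk> \<Longrightarrow> g (s \<oplus>\<^bsub>TN\<^esub> t) = g s \<oplus>\<^bsub>P\<^esub> g t"
    and h: "\<And>t. t \<in> carrier TN \<Longrightarrow> h t \<in> carrier P" "\<And>s t. \<lbrakk>s \<in> carrier TN; t \<in> carrier TN\<rbrakk> \<Longrightarrow> h (s \<oplus>\<^bsub>TN\<^esub> t) = h s \<oplus>\<^bsub>P\<^esub> h t"
    and eq: "\<And>m n. \<lbrakk>m \<in> carrier M; n \<in> carrier N\<rbrakk> \<Longrightarrow> g (pure m n) = h (pure m n)"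
    and t: "t \<in> carrier TN"
  shows "g t = h t"
proof -
  interpret P: abelian_group P by fact
  have "g \<zero>\<^bsub>TN\<^esub> = \<zero>\<^bsub>P\<^esub>" "h \<zero>\<^bsub>TN\<^esub> = \<zero>\<^bsub>P\<^esub>"
    using g(1)[of "\<zero>\<^bsub>TN\<^esub>"] g(2)[of "\<zero>\<^bsub>TN\<^esub>" "\<zero>\<^bsub>TN\<^esub>"] h(1)[of "\<zero>\<^bsub>TN\<^esub>"] h(2)[of "\<zero>\<^bsub>TN\<^esub>" "\<zero>\<^bsub>TN\<^esub>"]
    by (metis T.zero_closed T.l_zero P.add.l_cancel_one')+
  with t show ?thesis
    by (induction t rule: tensor_induct) (auto simp: eq g(2) h(2))
qed

end

section \<open>Tensor products of modules over a commutative ring\<close>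

lemma foldSetD_cong:
  "(X, y) \<in> foldSetD D f e \<Longrightarrow> (\<And>x z. x \<in> X \<Longrightarrow> f x z = g x z) \<Longrightarrow> (X, y) \<in> foldSetD D g e"
proof (induction rule: foldSetD.induct)
  case (insertI x A y)
  then have "f x y = g x y" "(A, y) \<in> foldSetD D g e" by auto
  then show ?case using insertI by (auto intro: foldSetD.insertI)
qed (auto intro: foldSetD.intros)

text \<open>\<open>foldSetD\<close> evaluates the function on members of the set only, which gives
  the congruence also for values outside the carrier. Integrands can then be rewritten before they
  are known to be balanced.\<close>

lemma finsum_cong_unrestricted:
  assumes "\<And>x. x \<in> X \<Longrightarrow> f x = g x"
  shows "finsum G f X = finsum G g X"
proof -
  have "(X, y) \<in> foldSetD D (mult (add_monoid G) \<circ> f) e \<longleftrightarrow> (X, y) \<in> foldSetD D (mult (add_monoid G) \<circ> g) e" for y D e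
    using assms foldSetD_cong[of X y D "mult (add_monoid G) \<circ> f" e "mult (add_monoid G) \<circ> g"]
      foldSetD_cong[of X y D "mult (add_monoid G) \<circ> g" e "mult (add_monoid G) \<circ> f"]
    by auto
  then show ?thesis unfolding finsum_def finprod_def foldD_def by simp
qed

text \<open>The chosen representative is supported on \<open>carrier M \<times> carrier N\<close>,
  whatever \<open>f\<close> and \<open>g\<close> do elsewhere.\<close>

lemma (in balanced_setting) lift_cong:
  assumes t: "t \<in> carrier TN"
    and eq: "\<And>m n. \<lbrakk>m \<in> carrier M; n \<in> carrier N\<rbrakk> \<Longrightarrow> f m n = g m n"
  shows "tensor_lift P f t = tensor_lift P g t"
proof -
  obtain u where u: "u \<in> carrier FG" "t = TR #>\<^bsub>FG\<^esub> u"
    using t unfolding carrier_tensor_eq RCOSETS_def by auto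
  interpret F: comm_group FG by (rule abelian_free_Abelian_group)
  have "u \<in> t" using F.rcos_self[OF u(1) tensor_relations_subgroup] u(2) by simp
  then have *: "(SOME v. v \<in> t) \<in> t" by (rule someI)
  have "t \<subseteq> carrier FG"
    using F.r_coset_subset_G[OF subgroup.subset[OF tensor_relations_subgroup] u(1)] u(2) by simp
  then have "(SOME v. v \<in> t) \<in> carrier FG" using * by (rule subsetD)
  then have k: "Poly_Mapping.keys (SOME v. v \<in> t) \<subseteq> carrier M \<times> carrier N"
    by (simp only: carrier_free_Abelian_group_iff)
  show ?thesis unfolding tensor_lift_def Let_def
  proof (rule finsum_cong_unrestricted)
    fix x assume "x \<in> Poly_Mapping.keys (SOME v. v \<in> t)"
    then obtain m n where "x = (m, n)" "m \<in> carrier M" "n \<in> carrier N" using k by blast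
    then show "(case x of (m, n) \<Rightarrow> add_pow P (Poly_Mapping.lookup (SOME v. v \<in> t) (m, n)) (f m n)) =
      (case x of (m, n) \<Rightarrow> add_pow P (Poly_Mapping.lookup (SOME v. v \<in> t) (m, n)) (g m n))"
      by (simp only: split eq)
  qed
qed

text \<open>\<open>ktensor\<close> and \<open>balanced_tensor\<close> are records of different types
  over the same group; this moves lifts from one to the other.\<close>

lemma tensor_lift_same_group:
  assumes "carrier P = carrier Q" "ring.add P = ring.add Q" "\<zero>\<^bsub>P\<^esub> = \<zero>\<^bsub>Q\<^esub>"
  shows "tensor_lift P f t = tensor_lift Q f t"
  unfolding tensor_lift_def finsum_def finprod_def add_pow_def int_pow_def m_inv_def nat_pow_def Let_def
  by (simp add: assms cong: if_cong)

lemma abelian_group_same_group: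
  assumes "carrier P = carrier Q" "ring.add P = ring.add Q" "\<zero>\<^bsub>P\<^esub> = \<zero>\<^bsub>Q\<^esub>" "abelian_group P"
  shows "abelian_group Q"
proof -
  interpret P: abelian_group P by fact
  show ?thesis
  proof (rule abelian_groupI; (unfold assms(1-3)[symmetric])?)
    fix x assume "x \<in> carrier P"
    then show "\<exists>y\<in>carrier P. y \<oplus>\<^bsub>P\<^esub> x = \<zero>\<^bsub>P\<^esub>"
      by (intro bexI[of _ "\<ominus>\<^bsub>P\<^esub> x"]) (simp_all add: P.l_neg)
  qed (simp_all add: P.a_assoc, simp add: P.a_comm)
qed

section \<open>Linear, bilinear and trilinear maps\<close>

definition bilin ::
  "('r, 'x) ring_scheme \<Rightarrow> ('r, 'm, 'y) module_scheme \<Rightarrow> ('r, 'n, 'z) module_scheme \<Rightarrow>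
   ('r, 'p, 'w) module_scheme \<Rightarrow> ('m \<Rightarrow> 'n \<Rightarrow> 'p) \<Rightarrow> bool"
  where "bilin K M N P f \<longleftrightarrow>
    (\<forall>n\<in>carrier N. linear_map K M P (\<lambda>m. f m n)) \<and> (\<forall>m\<in>carrier M. linear_map K N P (f m))"

definition trilin ::
  "('r, 'x) ring_scheme \<Rightarrow> ('r, 'l, 'v) module_scheme \<Rightarrow> ('r, 'm, 'y) module_scheme \<Rightarrow> ('r, 'n, 'z) module_scheme \<Rightarrow>
   ('r, 'p, 'w) module_scheme \<Rightarrow> ('l \<Rightarrow> 'm \<Rightarrow> 'n \<Rightarrow> 'p) \<Rightarrow> bool"
  where "trilin K L M N P f \<longleftrightarrow>
    (\<forall>m\<in>carrier M. \<forall>n\<in>carrier N. linear_map K L P (\<lambda>l. f l m n)) \<and>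
    (\<forall>l\<in>carrier L. bilin K M N P (f l))"

lemma linear_mapI:
  assumes "\<And>x. x \<in> carrier M \<Longrightarrow> f x \<in> carrier N"
    and "\<And>x y. \<lbrakk>x \<in> carrier M; y \<in> carrier M\<rbrakk> \<Longrightarrow> f (x \<oplus>\<^bsub>M\<^esub> y) = f x \<oplus>\<^bsub>N\<^esub> f y"
    and "\<And>r x. \<lbrakk>r \<in> carrier R; x \<in> carrier M\<rbrakk> \<Longrightarrow> f (r \<odot>\<^bsub>M\<^esub> x) = r \<odot>\<^bsub>N\<^esub> f x"
  shows "linear_map R M N f"
  using assms unfolding linear_map_def by auto

lemma linear_map_closed: "\<lbrakk>linear_map R M N f; x \<in> carrier M\<rbrakk> \<Longrightarrow> f x \<in> carrier N"
  and linear_map_add: "\<lbrakk>linear_map R M N f; x \<in> carrier M; y \<in> carrier M\<rbrakk> \<Longrightarrow> f (x \<oplus>\<^bsub>M\<^esub> y) = f x \<oplus>\<^bsub>N\<^esub> f y"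
  and linear_map_smult: "\<lbrakk>linear_map R M N f; r \<in> carrier R; x \<in> carrier M\<rbrakk> \<Longrightarrow> f (r \<odot>\<^bsub>M\<^esub> x) = r \<odot>\<^bsub>N\<^esub> f x"
  unfolding linear_map_def by auto

lemma linear_map_comp: "\<lbrakk>linear_map R N P g; linear_map R M N f\<rbrakk> \<Longrightarrow> linear_map R M P (\<lambda>x. g (f x))"
  unfolding linear_map_def by (auto simp: Pi_iff)

lemma linear_map_cong:
  assumes "module R M" "\<And>x. x \<in> carrier M \<Longrightarrow> f x = g x"
  shows "linear_map R M N f \<longleftrightarrow> linear_map R M N g"
  unfolding linear_map_def
  using assms module.smult_closed[OF assms(1)] abelian_monoid.a_closed[of M]
    abelian_group.axioms(1)[of M] module.axioms(2)[OF assms(1)]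
  by (auto simp: Pi_iff)

lemma bilinI:
  assumes "\<And>n. n \<in> carrier N \<Longrightarrow> linear_map K M P (\<lambda>m. f m n)"
    and "\<And>m. m \<in> carrier M \<Longrightarrow> linear_map K N P (f m)"
  shows "bilin K M N P f"
  using assms unfolding bilin_def by auto

lemma bilin_left: "\<lbrakk>bilin K M N P f; linear_map K X M g; n \<in> carrier N\<rbrakk> \<Longrightarrow> linear_map K X P (\<lambda>x. f (g x) n)"
  unfolding bilin_def by (auto intro: linear_map_comp[of K M P])

lemma bilin_right: "\<lbrakk>bilin K M N P f; linear_map K X N g; m \<in> carrier M\<rbrakk> \<Longrightarrow> linear_map K X P (\<lambda>x. f m (g x))"
  unfolding bilin_def by (auto intro: linear_map_comp[of K N P])

lemma bilin_closed: "\<lbrakk>bilin K M N P f; m \<in> carrier M; n \<in> carrier N\<rbrakk> \<Longrightarrow> f m n \<in> carrier P"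
  unfolding bilin_def by (auto intro: linear_map_closed)

lemma trilinI:
  assumes "\<And>m n. \<lbrakk>m \<in> carrier M; n \<in> carrier N\<rbrakk> \<Longrightarrow> linear_map K L P (\<lambda>l. f l m n)"
    and "\<And>l n. \<lbrakk>l \<in> carrier L; n \<in> carrier N\<rbrakk> \<Longrightarrow> linear_map K M P (\<lambda>m. f l m n)"
    and "\<And>l m. \<lbrakk>l \<in> carrier L; m \<in> carrier M\<rbrakk> \<Longrightarrow> linear_map K N P (\<lambda>n. f l m n)"
  shows "trilin K L M N P f"
  using assms unfolding trilin_def bilin_def by auto

lemma trilin_1: "\<lbrakk>trilin K L M N P f; linear_map K X L g; m \<in> carrier M; n \<in> carrier N\<rbrakk>
    \<Longrightarrow> linear_map K X P (\<lambda>x. f (g x) m n)"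
  unfolding trilin_def by (auto intro: linear_map_comp[of K L P])

lemma trilin_2: "\<lbrakk>trilin K L M N P f; linear_map K X M g; l \<in> carrier L; n \<in> carrier N\<rbrakk>
    \<Longrightarrow> linear_map K X P (\<lambda>x. f l (g x) n)"
  unfolding trilin_def by (auto intro: bilin_left[of K M N P])

lemma trilin_3: "\<lbrakk>trilin K L M N P f; linear_map K X N g; l \<in> carrier L; m \<in> carrier M\<rbrakk>
    \<Longrightarrow> linear_map K X P (\<lambda>x. f l m (g x))"
  unfolding trilin_def by (auto intro: bilin_right[of K M N P])

lemma trilin_closed: "\<lbrakk>trilin K L M N P f; l \<in> carrier L; m \<in> carrier M; n \<in> carrier N\<rbrakk> \<Longrightarrow> f l m n \<in> carrier P"
  unfolding trilin_def by (auto intro: bilin_closed)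

lemma linear_map_id: "linear_map K M M (\<lambda>x. x)"
  unfolding linear_map_def by auto

lemma bilin_balanced:
  assumes "bilin K M N P f"
  shows "balanced_map M (\<lambda>m c. c \<odot>\<^bsub>M\<^esub> m) K (smult N) N P f"
proof (rule balanced_mapI)
  fix m m' n assume "m \<in> carrier M" "m' \<in> carrier M" "n \<in> carrier N"
  then show "f (m \<oplus>\<^bsub>M\<^esub> m') n = f m n \<oplus>\<^bsub>P\<^esub> f m' n"
    using linear_map_add[of K M P "\<lambda>m. f m n" m m'] assms unfolding bilin_def by auto
next
  fix m n n' assume "m \<in> carrier M" "n \<in> carrier N" "n' \<in> carrier N"
  then show "f m (n \<oplus>\<^bsub>N\<^esub> n') = f m n \<oplus>\<^bsub>P\<^esub> f m n'"
    using linear_map_add[of K N P "f m" n n'] assms unfolding bilin_def by auto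
next
  fix m r n assume "m \<in> carrier M" "r \<in> carrier K" "n \<in> carrier N"
  then show "f (r \<odot>\<^bsub>M\<^esub> m) n = f m (r \<odot>\<^bsub>N\<^esub> n)"
    using linear_map_smult[of K N P "f m" r n] linear_map_smult[of K M P "\<lambda>m. f m n" r m] assms
    unfolding bilin_def by auto
qed (use bilin_closed[OF assms] in auto)

section \<open>The tensor product of two modules as a module\<close>

lemma balanced_setting_module:
  assumes "module K M" "module K N"
  shows "balanced_setting M (\<lambda>m c. c \<odot>\<^bsub>M\<^esub> m) K (smult N) N"
  unfolding balanced_setting_def balanced_setting_axioms_def
  using assms by (auto simp: module.smult_closed intro: module.axioms)

lemma ktensor_carrier: "carrier (ktensor K M N) = carrier (balanced_tensor M (\<lambda>m c. c \<odot>\<^bsub>M\<^esub> m) K (smult N) N)"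
  and ktensor_add: "ring.add (ktensor K M N) = ring.add (balanced_tensor M (\<lambda>m c. c \<odot>\<^bsub>M\<^esub> m) K (smult N) N)"
  and ktensor_zero: "\<zero>\<^bsub>ktensor K M N\<^esub> = \<zero>\<^bsub>balanced_tensor M (\<lambda>m c. c \<odot>\<^bsub>M\<^esub> m) K (smult N) N\<^esub>"
  unfolding ktensor_def Let_def by simp_all

lemma ktensor_smult:
  "c \<odot>\<^bsub>ktensor K M N\<^esub> t = tensor_lift (ktensor K M N) (\<lambda>m n. kpure K M N (c \<odot>\<^bsub>M\<^esub> m) n) t"
  by (subst tensor_lift_same_group[OF ktensor_carrier ktensor_add ktensor_zero])
     (simp add: ktensor_def Let_def)

locale two_modules = M: module K M + N: module K N
  for K :: "('k, 'x) ring_scheme" and M :: "('k, 'm, 'y) module_scheme" and N :: "('k, 'n, 'z) module_scheme"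
begin

interpretation B: balanced_setting M "\<lambda>m c. c \<odot>\<^bsub>M\<^esub> m" K "smult N" N
  by (rule balanced_setting_module) unfold_locales

abbreviation "MN \<equiv> ktensor K M N"

lemma ktensor_abelian_group: "abelian_group MN"
  by (rule abelian_group_same_group[OF _ _ _ B.tensor_abelian_group])
     (simp_all add: ktensor_carrier ktensor_add ktensor_zero)

lemmas kt = ktensor_carrier ktensor_add ktensor_zero

lemma kpure_balanced: "balanced_map M (\<lambda>m c. c \<odot>\<^bsub>M\<^esub> m) K (smult N) N MN (kpure K M N)"
  using B.pure_balanced unfolding balanced_map_def kpure_def kt .

lemma kpure_closed: "\<lbrakk>m \<in> carrier M; n \<in> carrier N\<rbrakk> \<Longrightarrow> kpure K M N m n \<in> carrier MN"
  by (rule balanced_map_closed[OF kpure_balanced])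

lemma ktensor_induct [consumes 1, case_names zero pure add]:
  assumes "t \<in> carrier MN"
    and "Q \<zero>\<^bsub>MN\<^esub>" and "\<And>m n. \<lbrakk>m \<in> carrier M; n \<in> carrier N\<rbrakk> \<Longrightarrow> Q (kpure K M N m n)"
    and "\<And>s t. \<lbrakk>s \<in> carrier MN; t \<in> carrier MN; Q s; Q t\<rbrakk> \<Longrightarrow> Q (s \<oplus>\<^bsub>MN\<^esub> t)"
  shows "Q t"
  using assms unfolding kt kpure_def by (rule B.tensor_induct)

lemma klift_cong:
  assumes "t \<in> carrier MN"
    and "\<And>m n. \<lbrakk>m \<in> carrier M; n \<in> carrier N\<rbrakk> \<Longrightarrow> f m n = g m n"
  shows "tensor_lift P f t = tensor_lift P g t"
  using assms unfolding kt by (rule B.lift_cong)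

context
  fixes P :: "('p, 'w) ring_scheme" and f
  assumes P: "abelian_group P" and f: "balanced_map M (\<lambda>m c. c \<odot>\<^bsub>M\<^esub> m) K (smult N) N P f"
begin

lemma blift_closed: "t \<in> carrier MN \<Longrightarrow> tensor_lift P f t \<in> carrier P"
  unfolding kt using B.lift_closed[OF P f] .

lemma blift_add: "\<lbrakk>s \<in> carrier MN; t \<in> carrier MN\<rbrakk> \<Longrightarrow>
    tensor_lift P f (s \<oplus>\<^bsub>MN\<^esub> t) = tensor_lift P f s \<oplus>\<^bsub>P\<^esub> tensor_lift P f t"
  unfolding kt using B.lift_add[OF P f] .

lemma blift_pure: "\<lbrakk>m \<in> carrier M; n \<in> carrier N\<rbrakk> \<Longrightarrow> tensor_lift P f (kpure K M N m n) = f m n"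
  unfolding kpure_def using B.lift_pure[OF P f] .

lemma blift_zero: "tensor_lift P f \<zero>\<^bsub>MN\<^esub> = \<zero>\<^bsub>P\<^esub>"
  unfolding kt using B.lift_zero[OF P f] .

end

lemma kadditive_eqI:
  assumes "abelian_group P"
    and g: "\<And>t. t \<in> carrier MN \<Longrightarrow> g t \<in> carrier P" "\<And>s t. \<lbrakk>s \<in> carrier MN; t \<in> carrier MN\<rbrakk> \<Longrightarrow> g (s \<oplus>\<^bsub>MN\<^esub> t) = g s \<oplus>\<^bsub>P\<^esub> g t"
    and h: "\<And>t. t \<in> carrier MN \<Longrightarrow> h t \<in> carrier P" "\<And>s t. \<lbrakk>s \<in> carrier MN; t \<in> carrier MN\<rbrakk> \<Longrightarrow> h (s \<oplus>\<^bsub>MN\<^esub> t) = h s \<oplus>\<^bsub>P\<^esub> h t"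
    and eq: "\<And>m n. \<lbrakk>m \<in> carrier M; n \<in> carrier N\<rbrakk> \<Longrightarrow> g (kpure K M N m n) = h (kpure K M N m n)"
    and t: "t \<in> carrier MN"
  shows "g t = h t"
  using assms unfolding kt kpure_def by (rule B.additive_eqI)

text \<open>Additive maps pass through Sweedler sums. The codomain is an abelian group, so the rule
  serves the projections onto \<open>A \<otimes>\<^sub>B A\<close> and
  \<open>\<EE> \<otimes>\<^sub>A \<EE>\<close>.\<close>

lemma additive_lift:
  assumes P: "abelian_group P" and Q: "abelian_group Q"
    and f: "balanced_map M (\<lambda>m c. c \<odot>\<^bsub>M\<^esub> m) K (smult N) N P f"
    and g: "\<And>x. x \<in> carrier P \<Longrightarrow> g x \<in> carrier Q"
      "\<And>x y. \<lbrakk>x \<in> carrier P; y \<in> carrier P\<rbrakk> \<Longrightarrow> g (x \<oplus>\<^bsub>P\<^esub> y) = g x \<oplus>\<^bsub>Q\<^esub> g y"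
    and t: "t \<in> carrier MN"
  shows "g (tensor_lift P f t) = tensor_lift Q (\<lambda>m n. g (f m n)) t"
proof -
  have gf: "balanced_map M (\<lambda>m c. c \<odot>\<^bsub>M\<^esub> m) K (smult N) N Q (\<lambda>m n. g (f m n))"
    using f g unfolding balanced_map_def by simp
  show ?thesis
    by (rule kadditive_eqI[OF Q _ _ _ _ _ t])
       (simp_all add: g blift_closed[OF P f] blift_add[OF P f] blift_pure[OF P f]
          blift_closed[OF Q gf] blift_add[OF Q gf] blift_pure[OF Q gf])
qed

lemma kpure_smult_balanced:
  assumes c: "c \<in> carrier K"
  shows "balanced_map M (\<lambda>m c. c \<odot>\<^bsub>M\<^esub> m) K (smult N) N MN (\<lambda>m n. kpure K M N (c \<odot>\<^bsub>M\<^esub> m) n)"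
proof (rule balanced_mapI)
  fix m r n assume a: "m \<in> carrier M" "r \<in> carrier K" "n \<in> carrier N"
  have "c \<odot>\<^bsub>M\<^esub> (r \<odot>\<^bsub>M\<^esub> m) = r \<odot>\<^bsub>M\<^esub> (c \<odot>\<^bsub>M\<^esub> m)"
    using a c by (metis M.m_comm M.smult_assoc1)
  then show "kpure K M N (c \<odot>\<^bsub>M\<^esub> (r \<odot>\<^bsub>M\<^esub> m)) n = kpure K M N (c \<odot>\<^bsub>M\<^esub> m) (r \<odot>\<^bsub>N\<^esub> n)"
    using a c balanced_map_act[OF kpure_balanced, of "c \<odot>\<^bsub>M\<^esub> m" r n] by simp
qed (use c in \<open>simp_all add: kpure_closed M.smult_r_distr balanced_map_add_left[OF kpure_balanced]
      balanced_map_add_right[OF kpure_balanced]\<close>)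

lemma ktensor_module: "module K MN"
proof -
  interpret T: abelian_group MN by (rule ktensor_abelian_group)
  note b = kpure_smult_balanced
  note l = blift_closed[OF ktensor_abelian_group b] blift_add[OF ktensor_abelian_group b]
    blift_pure[OF ktensor_abelian_group b] blift_zero[OF ktensor_abelian_group b]
  show ?thesis
  proof (rule moduleI)
    fix a x assume "a \<in> carrier K" "x \<in> carrier MN"
    then show "a \<odot>\<^bsub>MN\<^esub> x \<in> carrier MN" by (simp add: ktensor_smult l)
  next
    fix a x y assume "a \<in> carrier K" "x \<in> carrier MN" "y \<in> carrier MN"
    then show "a \<odot>\<^bsub>MN\<^esub> (x \<oplus>\<^bsub>MN\<^esub> y) = a \<odot>\<^bsub>MN\<^esub> x \<oplus>\<^bsub>MN\<^esub> a \<odot>\<^bsub>MN\<^esub> y" by (simp add: ktensor_smult l)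
  next
    fix a b x assume ab: "a \<in> carrier K" "b \<in> carrier K" "x \<in> carrier MN"
    from ab(3) show "(a \<oplus>\<^bsub>K\<^esub> b) \<odot>\<^bsub>MN\<^esub> x = a \<odot>\<^bsub>MN\<^esub> x \<oplus>\<^bsub>MN\<^esub> b \<odot>\<^bsub>MN\<^esub> x"
      using ab(1,2)
      by (induction rule: ktensor_induct)
         (simp_all add: ktensor_smult l M.smult_l_distr balanced_map_add_left[OF kpure_balanced] T.a_ac)
    from ab(3) show "(a \<otimes>\<^bsub>K\<^esub> b) \<odot>\<^bsub>MN\<^esub> x = a \<odot>\<^bsub>MN\<^esub> (b \<odot>\<^bsub>MN\<^esub> x)"
      using ab(1,2)
      by (induction rule: ktensor_induct) (simp_all add: ktensor_smult l M.smult_assoc1)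
  next
    fix x assume x: "x \<in> carrier MN"
    show "\<one>\<^bsub>K\<^esub> \<odot>\<^bsub>MN\<^esub> x = x"
      using x by (induction rule: ktensor_induct) (simp_all add: ktensor_smult l)
  qed (rule M.R.is_cring T.abelian_group_axioms)+
qed

lemma smult_kpure: "\<lbrakk>c \<in> carrier K; m \<in> carrier M; n \<in> carrier N\<rbrakk> \<Longrightarrow>
    c \<odot>\<^bsub>MN\<^esub> kpure K M N m n = kpure K M N (c \<odot>\<^bsub>M\<^esub> m) n"
  by (simp add: ktensor_smult blift_pure[OF ktensor_abelian_group kpure_smult_balanced])

lemma kpure_bilin: "bilin K M N MN (kpure K M N)"
  unfolding bilin_def
  by (auto intro!: linear_mapI simp: kpure_closed smult_kpure balanced_map_add_left[OF kpure_balanced]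
      balanced_map_add_right[OF kpure_balanced] balanced_map_act[OF kpure_balanced])

context
  fixes P :: "('k, 'p, 'w) module_scheme" and f
  assumes P: "module K P" and f: "bilin K M N P f"
begin

interpretation P: module K P by (rule P)

lemma klift_closed: "t \<in> carrier MN \<Longrightarrow> tensor_lift P f t \<in> carrier P"
  by (rule blift_closed[OF P.abelian_group_axioms bilin_balanced[OF f]])

lemma klift_pure: "\<lbrakk>m \<in> carrier M; n \<in> carrier N\<rbrakk> \<Longrightarrow> tensor_lift P f (kpure K M N m n) = f m n"
  by (rule blift_pure[OF P.abelian_group_axioms bilin_balanced[OF f]])

lemma klift_linear: "linear_map K MN P (tensor_lift P f)"
proof (rule linear_mapI)
  note l = blift_closed[OF P.abelian_group_axioms bilin_balanced[OF f]]
    blift_add[OF P.abelian_group_axioms bilin_balanced[OF f]]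
  interpret T: module K MN by (rule ktensor_module)
  show "x \<in> carrier MN \<Longrightarrow> tensor_lift P f x \<in> carrier P" for x by (rule l)
  show "x \<in> carrier MN \<Longrightarrow> y \<in> carrier MN \<Longrightarrow>
    tensor_lift P f (x \<oplus>\<^bsub>MN\<^esub> y) = tensor_lift P f x \<oplus>\<^bsub>P\<^esub> tensor_lift P f y" for x y by (rule l)
  fix r x assume rx: "r \<in> carrier K" "x \<in> carrier MN"
  show "tensor_lift P f (r \<odot>\<^bsub>MN\<^esub> x) = r \<odot>\<^bsub>P\<^esub> tensor_lift P f x"
  proof (rule kadditive_eqI[where g = "\<lambda>x. tensor_lift P f (r \<odot>\<^bsub>MN\<^esub> x)" and h = "\<lambda>x. r \<odot>\<^bsub>P\<^esub> tensor_lift P f x",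
      OF P.abelian_group_axioms _ _ _ _ _ rx(2)])
    fix m n assume mn: "m \<in> carrier M" "n \<in> carrier N"
    then have "linear_map K M P (\<lambda>m. f m n)" using f unfolding bilin_def by auto
    from linear_map_smult[OF this rx(1) mn(1)]
    show "tensor_lift P f (r \<odot>\<^bsub>MN\<^esub> kpure K M N m n) = r \<odot>\<^bsub>P\<^esub> tensor_lift P f (kpure K M N m n)"
      using mn rx by (simp add: smult_kpure klift_pure)
  next
    fix s t assume "s \<in> carrier MN" "t \<in> carrier MN"
    then show "tensor_lift P f (r \<odot>\<^bsub>MN\<^esub> (s \<oplus>\<^bsub>MN\<^esub> t)) =
        tensor_lift P f (r \<odot>\<^bsub>MN\<^esub> s) \<oplus>\<^bsub>P\<^esub> tensor_lift P f (r \<odot>\<^bsub>MN\<^esub> t)"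
      using rx by (simp only: T.smult_r_distr l T.smult_closed)
    show "s \<in> carrier MN \<Longrightarrow> t \<in> carrier MN \<Longrightarrow> r \<odot>\<^bsub>P\<^esub> tensor_lift P f (s \<oplus>\<^bsub>MN\<^esub> t) =
        r \<odot>\<^bsub>P\<^esub> tensor_lift P f s \<oplus>\<^bsub>P\<^esub> r \<odot>\<^bsub>P\<^esub> tensor_lift P f t"
      using rx by (simp only: P.smult_r_distr l)
  qed (rule l T.smult_closed P.smult_closed rx | assumption)+
qed

end

lemma klinear_eqI:
  assumes "module K P" "linear_map K MN P g" "linear_map K MN P h"
    and "\<And>m n. \<lbrakk>m \<in> carrier M; n \<in> carrier N\<rbrakk> \<Longrightarrow> g (kpure K M N m n) = h (kpure K M N m n)"
    and "t \<in> carrier MN"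
  shows "g t = h t"
  by (rule kadditive_eqI[where g = g and h = h and P = P])
     (use assms module.axioms(2) in \<open>auto simp: linear_map_def\<close>)

lemma linear_lift:
  assumes "module K P" "module K Q" "bilin K M N P f" "linear_map K P Q g" "t \<in> carrier MN"
  shows "g (tensor_lift P f t) = tensor_lift Q (\<lambda>m n. g (f m n)) t"
  by (rule additive_lift[OF _ _ bilin_balanced[OF assms(3)] _ _ assms(5)])
     (use assms module.axioms in \<open>auto simp: linear_map_def\<close>)

text \<open>Induction on the fixed tensor reduces the lift to the values \<open>f x m n\<close>,
  which are linear in \<open>x\<close> by assumption. It complements \<open>lin_lift2\<close>, where
  the parameter sits in the tensor.\<close>

lemma lin_lift1:
  assumes t: "t \<in> carrier MN" and P: "module K P"
    and f: "\<And>x. x \<in> carrier X \<Longrightarrow> bilin K M N P (f x)"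
    and X: "\<And>m n. \<lbrakk>m \<in> carrier M; n \<in> carrier N\<rbrakk> \<Longrightarrow> linear_map K X P (\<lambda>x. f x m n)"
    and mX: "module K X"
  shows "linear_map K X P (\<lambda>x. tensor_lift P (f x) t)"
proof -
  interpret P: module K P by (rule P)
  note cong = linear_map_cong[OF mX, THEN iffD2]
  note l = klift_linear[OF P f]
  from t show ?thesis
  proof (induction rule: ktensor_induct)
    case zero
    show ?case
    proof (rule cong)
      show "linear_map K X P (\<lambda>x. \<zero>\<^bsub>P\<^esub>)" by (rule linear_mapI) (simp_all add: P.smult_r_null)
    qed (rule blift_zero[OF P.abelian_group_axioms bilin_balanced[OF f]])
  next
    case (pure m n)
    show ?case by (rule cong[OF _ X[OF pure]]) (rule klift_pure[OF P f pure])
  next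
    case (add s t)
    show ?case
    proof (rule cong)
      show "linear_map K X P (\<lambda>x. tensor_lift P (f x) s \<oplus>\<^bsub>P\<^esub> tensor_lift P (f x) t)"
        by (rule linear_mapI)
           (simp_all add: linear_map_closed[OF add(3)] linear_map_closed[OF add(4)] linear_map_add[OF add(3)]
             linear_map_add[OF add(4)] linear_map_smult[OF add(3)] linear_map_smult[OF add(4)] P.smult_r_distr P.a_ac)
    qed (rule linear_map_add[OF l add(1,2)])
  qed
qed

lemma lin_lift2:
  assumes "linear_map K X MN d" "module K P" "bilin K M N P g"
  shows "linear_map K X P (\<lambda>x. tensor_lift P g (d x))"
  by (rule linear_map_comp[OF klift_linear[OF assms(2,3)] assms(1)])

end

lemmas module_ktensor = two_modules.ktensor_module[OF two_modules.intro]

section \<open>Sweedler calculus\<close>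

text \<open>
  \<open>sw P (\<Delta> h) (\<lambda>x y. f x y)\<close> stands for \<open>\<Sum> f h\<^sub>1 h\<^sub>2\<close>.  The rules \<open>mlin\<close> decide linearity in a variable and
  membership in a carrier by resolution along the structure of such expressions; in a proof they are
  extended by the rules for the multilinear maps at hand.
\<close>

named_theorems mlin

abbreviation sw :: "('p, 'x) ring_scheme \<Rightarrow> ('m, 'n) tensor \<Rightarrow> ('m \<Rightarrow> 'n \<Rightarrow> 'p) \<Rightarrow> 'p"
  where "sw P t f \<equiv> tensor_lift P f t"

lemma sw_linear_in_function [mlin]:
  assumes "t \<in> carrier (ktensor K M N)" "module K M" "module K N" "module K P" "module K X"
    "\<And>x. x \<in> carrier X \<Longrightarrow> bilin K M N P (f x)"
    "\<And>m n. \<lbrakk>m \<in> carrier M; n \<in> carrier N\<rbrakk> \<Longrightarrow> linear_map K X P (\<lambda>x. f x m n)"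
  shows "linear_map K X P (\<lambda>x. sw P t (f x))"
  using assms by (intro two_modules.lin_lift1[OF two_modules.intro])

lemma sw_linear_in_tensor [mlin]:
  assumes "linear_map K X (ktensor K M N) d" "module K M" "module K N" "module K P" "bilin K M N P g"
  shows "linear_map K X P (\<lambda>x. sw P (d x) g)"
  using assms by (intro two_modules.lin_lift2[OF two_modules.intro])

lemma sw_closed [mlin]:
  assumes "t \<in> carrier (ktensor K M N)" "module K M" "module K N" "module K P" "bilin K M N P g"
  shows "sw P t g \<in> carrier P"
  using assms by (intro two_modules.klift_closed[OF two_modules.intro])

lemma kpure_left [mlin]:
  "\<lbrakk>module K M; module K N; linear_map K X M f; n \<in> carrier N\<rbrakk> \<Longrightarrow>
   linear_map K X (ktensor K M N) (\<lambda>x. kpure K M N (f x) n)"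
  by (rule bilin_left[OF two_modules.kpure_bilin[OF two_modules.intro]])

lemma kpure_right [mlin]:
  "\<lbrakk>module K M; module K N; linear_map K X N f; m \<in> carrier M\<rbrakk> \<Longrightarrow>
   linear_map K X (ktensor K M N) (\<lambda>x. kpure K M N m (f x))"
  by (rule bilin_right[OF two_modules.kpure_bilin[OF two_modules.intro]])

lemmas kpure_in [mlin] = two_modules.kpure_closed[OF two_modules.intro]
lemmas sw_kpure = two_modules.klift_pure[OF two_modules.intro]
lemmas sw_cong = two_modules.klift_cong[OF two_modules.intro]
lemmas linear_sw = two_modules.linear_lift[OF two_modules.intro]
lemmas tensor_eqI = two_modules.klinear_eqI[OF two_modules.intro]

declare linear_map_id [mlin] bilinI [mlin] trilinI [mlin] module_ktensor [mlin]

lemma smult_lin [mlin]: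
  assumes "module K P" "c \<in> carrier K" "linear_map K X P f"
  shows "linear_map K X P (\<lambda>x. c \<odot>\<^bsub>P\<^esub> f x)"
proof -
  interpret P: module K P by fact
  show ?thesis
  proof (rule linear_mapI)
    fix r x assume "r \<in> carrier K" "x \<in> carrier X"
    then show "c \<odot>\<^bsub>P\<^esub> f (r \<odot>\<^bsub>X\<^esub> x) = r \<odot>\<^bsub>P\<^esub> (c \<odot>\<^bsub>P\<^esub> f x)"
      using assms linear_map_closed[OF assms(3)] linear_map_smult[OF assms(3)] P.smult_assoc1 P.m_comm
      by metis
  qed (use assms in \<open>simp_all add: linear_map_closed[OF assms(3)] linear_map_add[OF assms(3)] P.smult_r_distr\<close>)
qed

lemma smult_lin_left [mlin]:
  assumes "module K P" "linear_map K X (regular_module K) e" "p \<in> carrier P"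
  shows "linear_map K X P (\<lambda>x. e x \<odot>\<^bsub>P\<^esub> p)"
proof -
  interpret P: module K P by fact
  have "x \<in> carrier X \<Longrightarrow> e x \<in> carrier K" for x
    using linear_map_closed[OF assms(2)] by (simp add: regular_module_def)
  then show ?thesis
    using assms(3) linear_map_add[OF assms(2)] linear_map_smult[OF assms(2)]
    by (intro linear_mapI) (simp_all add: regular_module_def P.smult_l_distr P.smult_assoc1)
qed

lemma module_smult_in [mlin]: "\<lbrakk>module K P; c \<in> carrier K; x \<in> carrier P\<rbrakk> \<Longrightarrow> c \<odot>\<^bsub>P\<^esub> x \<in> carrier P"
  by (rule module.smult_closed)

lemma sw_pure_id:
  assumes "module K M" "module K N" "t \<in> carrier (ktensor K M N)"
  shows "sw (ktensor K M N) t (kpure K M N) = t"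
  by (rule tensor_eqI[OF assms(1,2) _ _ _ _ assms(3), where P = "ktensor K M N"
        and g = "\<lambda>t. sw (ktensor K M N) t (kpure K M N)" and h = "\<lambda>t. t"])
     (assumption | rule assms mlin sw_kpure)+

text \<open>A Fubini rule. Both sides are linear in \<open>t\<close>, so a pure \<open>t\<close>
  suffices, and there each side is a single sum over \<open>s\<close>.\<close>

lemma sw_swap:
  assumes t: "t \<in> carrier (ktensor K M N)" and s: "s \<in> carrier (ktensor K U V)"
    and m: "module K M" "module K N" "module K U" "module K V" "module K P"
    and 1: "\<And>u v n. \<lbrakk>u \<in> carrier U; v \<in> carrier V; n \<in> carrier N\<rbrakk> \<Longrightarrow> linear_map K M P (\<lambda>m. f m n u v)"
    and 2: "\<And>u v m. \<lbrakk>u \<in> carrier U; v \<in> carrier V; m \<in> carrier M\<rbrakk> \<Longrightarrow> linear_map K N P (\<lambda>n. f m n u v)"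
    and 3: "\<And>m n v. \<lbrakk>m \<in> carrier M; n \<in> carrier N; v \<in> carrier V\<rbrakk> \<Longrightarrow> linear_map K U P (\<lambda>u. f m n u v)"
    and 4: "\<And>m n u. \<lbrakk>m \<in> carrier M; n \<in> carrier N; u \<in> carrier U\<rbrakk> \<Longrightarrow> linear_map K V P (\<lambda>v. f m n u v)"
  shows "sw P t (\<lambda>m n. sw P s (\<lambda>u v. f m n u v)) = sw P s (\<lambda>u v. sw P t (\<lambda>m n. f m n u v))"
proof (rule tensor_eqI[OF m(1,2,5) _ _ _ t, where g = "\<lambda>t. sw P t (\<lambda>m n. sw P s (\<lambda>u v. f m n u v))"
      and h = "\<lambda>t. sw P s (\<lambda>u v. sw P t (\<lambda>m n. f m n u v))"])
  fix x y assume xy: "x \<in> carrier M" "y \<in> carrier N"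
  have "sw P (kpure K M N x y) (\<lambda>m n. sw P s (f m n)) = sw P s (f x y)"
    by (rule sw_kpure) (assumption | rule s m xy mlin 1 2 3 4)+
  also have "\<dots> = sw P s (\<lambda>u v. sw P (kpure K M N x y) (\<lambda>m n. f m n u v))"
    by (intro sw_cong[OF m(3,4) s] sw_kpure[symmetric] m xy) (rule mlin 1 2 | assumption)+
  finally show "sw P (kpure K M N x y) (\<lambda>m n. sw P s (f m n)) = \<dots>" .
qed (assumption | rule s m mlin 1 2 3 4)+

lemma sw_ktensor_map:
  assumes m: "module K M" "module K N" "module K M'" "module K N'" "module K P"
    and l: "linear_map K M M' \<phi>" "linear_map K N N' \<psi>" and g: "bilin K M' N' P g"
    and t: "t \<in> carrier (ktensor K M N)"
  shows "sw P (ktensor_map K M' N' \<phi> \<psi> t) g = sw P t (\<lambda>m n. g (\<phi> m) (\<psi> n))"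
proof -
  note [mlin] = linear_map_comp[OF l(1)] linear_map_comp[OF l(2)]
  have "sw P (ktensor_map K M' N' \<phi> \<psi> t) g = sw P t (\<lambda>m n. sw P (kpure K M' N' (\<phi> m) (\<psi> n)) g)"
    unfolding ktensor_map_def
    by (rule linear_sw[OF m(1,2) _ m(5) _ _ t, where g = "\<lambda>s. sw P s g"])
       (assumption | rule m g l mlin linear_map_closed[OF l(1)] linear_map_closed[OF l(2)])+
  also have "\<dots> = sw P t (\<lambda>m n. g (\<phi> m) (\<psi> n))"
    by (intro sw_cong[OF m(1,2) t] sw_kpure m g linear_map_closed[OF l(1)] linear_map_closed[OF l(2)])
  finally show ?thesis .
qed

lemma ktensor_map_in:
  assumes m: "module K M" "module K N" "module K M'" "module K N'"
    and l: "linear_map K M M' \<phi>" "linear_map K N N' \<psi>" and t: "t \<in> carrier (ktensor K M N)"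
  shows "ktensor_map K M' N' \<phi> \<psi> t \<in> carrier (ktensor K M' N')"
  unfolding ktensor_map_def
  by (assumption | rule m t l mlin linear_map_closed[OF l(1)] linear_map_closed[OF l(2)])+

text \<open>On nested sums the associator merely regroups the integrand. This lets coassociativity,
  which is stated with \<open>ktensor_assoc\<close>, act on arbitrary trilinear maps.\<close>

lemma sw_assoc:
  assumes m: "module K L" "module K M" "module K N" "module K P"
    and f: "trilin K L M N P f" and s: "s \<in> carrier (ktensor K (ktensor K L M) N)"
  shows "sw P (ktensor_assoc K L M N s) (\<lambda>l t. sw P t (f l)) = sw P s (\<lambda>u n. sw P u (\<lambda>l m. f l m n))"
proof -
  note r = mlin trilin_1[OF f] trilin_2[OF f] trilin_3[OF f] trilin_closed[OF f]
  let ?Q = "ktensor K L (ktensor K M N)"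
  have "sw P (ktensor_assoc K L M N s) (\<lambda>l t. sw P t (f l)) =
    sw P s (\<lambda>u n. sw P (sw ?Q u (\<lambda>l m. kpure K L (ktensor K M N) l (kpure K M N m n))) (\<lambda>l t. sw P t (f l)))"
    unfolding ktensor_assoc_def Let_def
    by (rule linear_sw[OF _ m(3) _ m(4) _ _ s, where g = "\<lambda>s. sw P s (\<lambda>l t. sw P t (f l))"])
       (assumption | rule m r)+
  also have "\<dots> = sw P s (\<lambda>u n. sw P u (\<lambda>l m. f l m n))"
  proof (rule sw_cong[OF _ m(3) s])
    fix u n assume un: "u \<in> carrier (ktensor K L M)" "n \<in> carrier N"
    have "sw P (sw ?Q u (\<lambda>l m. kpure K L (ktensor K M N) l (kpure K M N m n))) (\<lambda>l t. sw P t (f l)) =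
      sw P u (\<lambda>l m. sw P (kpure K L (ktensor K M N) l (kpure K M N m n)) (\<lambda>l t. sw P t (f l)))"
      by (rule linear_sw[OF m(1,2) _ m(4) _ _ un(1), where g = "\<lambda>s. sw P s (\<lambda>l t. sw P t (f l))"])
         (assumption | rule m un r)+
    also have "\<dots> = sw P u (\<lambda>l m. f l m n)"
    proof (rule sw_cong[OF m(1,2) un(1)])
      fix x y assume xy: "x \<in> carrier L" "y \<in> carrier M"
      have "sw P (kpure K L (ktensor K M N) x (kpure K M N y n)) (\<lambda>l t. sw P t (f l)) = sw P (kpure K M N y n) (f x)"
        by (rule sw_kpure) (assumption | rule m un xy r)+
      also have "\<dots> = f x y n"
        by (rule sw_kpure) (assumption | rule m un xy r)+
      finally show "sw P (kpure K L (ktensor K M N) x (kpure K M N y n)) (\<lambda>l t. sw P t (f l)) = f x y n" .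
    qed
    finally show "sw P (sw ?Q u (\<lambda>l m. kpure K L (ktensor K M N) l (kpure K M N m n))) (\<lambda>l t. sw P t (f l)) =
      sw P u (\<lambda>l m. f l m n)" .
  qed (intro module_ktensor m)
  finally show ?thesis .
qed

section \<open>The base ring as a module; products in algebras and in their tensor products\<close>

lemma regular_module_module:
  assumes "cring K" shows "module K (regular_module K)"
proof -
  interpret cring K by fact
  have "abelian_group (regular_module K)"
    by (rule abelian_group_same_group[of K]) (simp_all add: regular_module_def abelian_group_axioms)
  then show ?thesis
    by (intro moduleI) (simp_all add: regular_module_def is_cring l_distr r_distr m_assoc)
qed

context assoc_algebra
begin

lemma mult_lin_left: "\<lbrakk>a \<in> carrier A; linear_map K X A f\<rbrakk> \<Longrightarrow> linear_map K X A (\<lambda>x. a \<otimes>\<^bsub>A\<^esub> f x)"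
  by (intro linear_mapI) (simp_all add: linear_map_closed linear_map_add linear_map_smult A.r_distr smult_mult_right)

lemma mult_lin_right: "\<lbrakk>a \<in> carrier A; linear_map K X A f\<rbrakk> \<Longrightarrow> linear_map K X A (\<lambda>x. f x \<otimes>\<^bsub>A\<^esub> a)"
  by (intro linear_mapI) (simp_all add: linear_map_closed linear_map_add linear_map_smult A.l_distr smult_mult_left)

lemma mult_in: "\<lbrakk>a \<in> carrier A; b \<in> carrier A\<rbrakk> \<Longrightarrow> a \<otimes>\<^bsub>A\<^esub> b \<in> carrier A"
  by (rule A.m_closed)

lemma module_axioms': "module K A" ..

end

lemma sw_mult:
  assumes M: "assoc_algebra K M" and N: "assoc_algebra K N" and P: "module K P" and f: "bilin K M N P f"
    and s: "s \<in> carrier (ktensor K M N)" and t: "t \<in> carrier (ktensor K M N)"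
  shows "sw P (s \<otimes>\<^bsub>ktensor K M N\<^esub> t) f =
    sw P s (\<lambda>m n. sw P t (\<lambda>m' n'. f (m \<otimes>\<^bsub>M\<^esub> m') (n \<otimes>\<^bsub>N\<^esub> n')))"
proof -
  note m = assoc_algebra.module_axioms'[OF M] assoc_algebra.module_axioms'[OF N] P
  let ?T = "ktensor K M N"
  note r = mlin assoc_algebra.mult_lin_left[OF M] assoc_algebra.mult_lin_left[OF N]
    assoc_algebra.mult_lin_right[OF M] assoc_algebra.mult_lin_right[OF N]
    assoc_algebra.mult_in[OF M] assoc_algebra.mult_in[OF N] bilin_left[OF f] bilin_right[OF f]
  \<comment> \<open>The product in the record is a lift into \<open>balanced_tensor\<close>; the
    group is the same, so it may be read in \<open>?T\<close>.\<close>
  have e: "s \<otimes>\<^bsub>?T\<^esub> t = sw ?T s (\<lambda>m n. sw ?T t (\<lambda>m' n'. kpure K M N (m \<otimes>\<^bsub>M\<^esub> m') (n \<otimes>\<^bsub>N\<^esub> n')))"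
    unfolding tensor_lift_same_group[OF ktensor_carrier ktensor_add ktensor_zero, of K M N]
    by (simp add: ktensor_def Let_def)
  have "sw P (s \<otimes>\<^bsub>?T\<^esub> t) f = sw P s (\<lambda>m n. sw P (sw ?T t (\<lambda>m' n'. kpure K M N (m \<otimes>\<^bsub>M\<^esub> m') (n \<otimes>\<^bsub>N\<^esub> n'))) f)"
    unfolding e
    by (rule linear_sw[OF m(1,2) _ m(3) _ _ s, where g = "\<lambda>s. sw P s f"])
       (assumption | rule m f t r)+
  also have "\<dots> = sw P s (\<lambda>m n. sw P t (\<lambda>m' n'. sw P (kpure K M N (m \<otimes>\<^bsub>M\<^esub> m') (n \<otimes>\<^bsub>N\<^esub> n')) f))"
    by (rule sw_cong[OF m(1,2) s], rule linear_sw[OF m(1,2) _ m(3) _ _ t, where g = "\<lambda>s. sw P s f"])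
       (assumption | rule m f t r)+
  also have "\<dots> = sw P s (\<lambda>m n. sw P t (\<lambda>m' n'. f (m \<otimes>\<^bsub>M\<^esub> m') (n \<otimes>\<^bsub>N\<^esub> n')))"
    by (rule sw_cong[OF m(1,2) s], rule sw_cong[OF m(1,2) t], rule sw_kpure[OF m f])
       ((assumption | rule r)+)
  finally show ?thesis .
qed

section \<open>Weak Hopf algebras and comodule algebras in Sweedler notation\<close>

locale weak_comodule_setup =
  fixes K :: "('k, 'x) ring_scheme" and H :: "('k, 'h, 'y) module_scheme"
    and \<Delta> :: "'h \<Rightarrow> ('h, 'h) tensor" and \<epsilon> :: "'h \<Rightarrow> 'k" and S :: "'h \<Rightarrow> 'h"
    and A :: "('k, 'a, 'z) module_scheme" and \<rho> :: "'a \<Rightarrow> ('a, 'h) tensor"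
  assumes W: "weak_hopf_algebra K H \<Delta> \<epsilon> S" and C: "right_comodule_algebra K H \<Delta> \<epsilon> A \<rho>"
begin

abbreviation "KK \<equiv> regular_module K"
abbreviation "HH \<equiv> ktensor K H H"
abbreviation "AH \<equiv> ktensor K A H"
abbreviation "AA \<equiv> ktensor K A A"
abbreviation multA (infixl \<open>\<cdot>\<close> 70) where "x \<cdot> y \<equiv> x \<otimes>\<^bsub>A\<^esub> y"
abbreviation multH (infixl \<open>\<bullet>\<close> 70) where "x \<bullet> y \<equiv> x \<otimes>\<^bsub>H\<^esub> y"
abbreviation oneA (\<open>1A\<close>) where "1A \<equiv> \<one>\<^bsub>A\<^esub>"
abbreviation oneH (\<open>1H\<close>) where "1H \<equiv> \<one>\<^bsub>H\<^esub>"
abbreviation scaleA (infixr \<open>*A\<close> 75) where "c *A x \<equiv> c \<odot>\<^bsub>A\<^esub> x"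
abbreviation scaleH (infixr \<open>*H\<close> 75) where "c *H x \<equiv> c \<odot>\<^bsub>H\<^esub> x"
abbreviation "PL \<equiv> Pi_L H \<Delta> \<epsilon>"

lemma weak_bialgebra: "weak_bialgebra K H \<Delta> \<epsilon>" by (rule weak_hopf_algebra.axioms(1)[OF W])
lemma algebra_H: "assoc_algebra K H" by (rule weak_bialgebra.axioms(1)[OF weak_bialgebra])
lemma coalgebra_H: "coassoc_coalgebra K H \<Delta> \<epsilon>" by (rule weak_bialgebra.axioms(2)[OF weak_bialgebra])
lemma algebra_A: "assoc_algebra K A" by (rule right_comodule_algebra.axioms(2)[OF C])

lemma modH [mlin]: "module K H" by (rule assoc_algebra.module_axioms'[OF algebra_H])
lemma modA [mlin]: "module K A" by (rule assoc_algebra.module_axioms'[OF algebra_A])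
lemma cring_K: "cring K" by (rule module.axioms(1)[OF modA])
lemma modK [mlin]: "module K KK" by (rule regular_module_module[OF cring_K])
lemma ring_A: "ring A" by (rule assoc_algebra.axioms(2)[OF algebra_A])
lemma ring_H: "ring H" by (rule assoc_algebra.axioms(2)[OF algebra_H])

sublocale RA: ring A by (rule ring_A)
sublocale RH: ring H by (rule ring_H)

lemmas [mlin] = assoc_algebra.mult_lin_left[OF algebra_A] assoc_algebra.mult_lin_right[OF algebra_A]
  assoc_algebra.mult_lin_left[OF algebra_H] assoc_algebra.mult_lin_right[OF algebra_H]
  RA.m_closed RH.m_closed RA.one_closed RH.one_closed

lemma lin_Delta: "linear_map K H HH \<Delta>" by (rule coassoc_coalgebra.comult_linear[OF coalgebra_H])
lemma lin_eps: "linear_map K H KK \<epsilon>" by (rule coassoc_coalgebra.counit_linear[OF coalgebra_H])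
lemma lin_rho: "linear_map K A AH \<rho>" by (rule right_comodule_algebra.coaction_linear[OF C])
lemma lin_S: "linear_map K H H S" by (rule weak_hopf_algebra.antipode_linear[OF W])

lemmas [mlin] = linear_map_comp[OF lin_Delta] linear_map_comp[OF lin_eps] linear_map_comp[OF lin_rho]
  linear_map_comp[OF lin_S] linear_map_closed[OF lin_Delta] linear_map_closed[OF lin_rho] linear_map_closed[OF lin_S]

lemma carrier_KK: "carrier KK = carrier K" by (simp add: regular_module_def)

lemma eps_in [mlin]: "h \<in> carrier H \<Longrightarrow> \<epsilon> h \<in> carrier K"
  using linear_map_closed[OF lin_eps] by (simp add: carrier_KK)

lemma Delta_cong: "\<lbrakk>h \<in> carrier H; \<And>x y. \<lbrakk>x \<in> carrier H; y \<in> carrier H\<rbrakk> \<Longrightarrow> f x y = g x y\<rbrakk>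
    \<Longrightarrow> sw P (\<Delta> h) f = sw P (\<Delta> h) g"
  by (rule sw_cong) (assumption | rule mlin)+

lemma rho_cong: "\<lbrakk>a \<in> carrier A; \<And>x y. \<lbrakk>x \<in> carrier A; y \<in> carrier H\<rbrakk> \<Longrightarrow> f x y = g x y\<rbrakk>
    \<Longrightarrow> sw P (\<rho> a) f = sw P (\<rho> a) g"
  by (rule sw_cong) (assumption | rule mlin)+

lemmas sw_congs = Delta_cong rho_cong

lemma lin_Pi: "linear_map K H H PL"
  unfolding Pi_L_def by (assumption | rule mlin)+

lemmas [mlin] = linear_map_comp[OF lin_Pi] linear_map_closed[OF lin_Pi]

text \<open>The trilinear \<open>f\<close> factors through the threefold tensor product. Applied to
  both sides of the coassociativity axiom it leaves nested sums without associators.\<close>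

lemma Delta_coassoc:
  assumes P[mlin]: "module K P" and f: "trilin K H H H P f" and h[mlin]: "h \<in> carrier H"
  shows "sw P (\<Delta> h) (\<lambda>x y. sw P (\<Delta> x) (\<lambda>u v. f u v y)) = sw P (\<Delta> h) (\<lambda>x y. sw P (\<Delta> y) (\<lambda>u v. f x u v))"
proof -
  note [mlin] = trilin_1[OF f] trilin_2[OF f] trilin_3[OF f] trilin_closed[OF f]
  have "sw P (\<Delta> h) (\<lambda>x y. sw P (\<Delta> x) (\<lambda>u v. f u v y)) =
    sw P (ktensor_map K HH H \<Delta> id (\<Delta> h)) (\<lambda>t y. sw P t (\<lambda>u v. f u v y))"
    by (subst sw_ktensor_map[where M = H and N = H], simp_all add: id_def) (assumption | rule mlin)+
  also have "\<dots> = sw P (ktensor_assoc K H H H (ktensor_map K HH H \<Delta> id (\<Delta> h))) (\<lambda>x t. sw P t (f x))"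
    by (rule sw_assoc[symmetric]) (assumption | rule f mlin ktensor_map_in[where M = H and N = H, unfolded id_def] | simp add: id_def)+
  also have "\<dots> = sw P (ktensor_map K H HH id \<Delta> (\<Delta> h)) (\<lambda>x t. sw P t (f x))"
    using coassoc_coalgebra.coassoc[OF coalgebra_H h] by simp
  also have "\<dots> = sw P (\<Delta> h) (\<lambda>x y. sw P (\<Delta> y) (\<lambda>u v. f x u v))"
    by (subst sw_ktensor_map[where M = H and N = H], simp_all add: id_def) (assumption | rule mlin)+
  finally show ?thesis .
qed

lemma rho_coassoc:
  assumes P[mlin]: "module K P" and f: "trilin K A H H P f" and h[mlin]: "a \<in> carrier A"
  shows "sw P (\<rho> a) (\<lambda>x y. sw P (\<rho> x) (\<lambda>u v. f u v y)) = sw P (\<rho> a) (\<lambda>x y. sw P (\<Delta> y) (\<lambda>u v. f x u v))"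
proof -
  note [mlin] = trilin_1[OF f] trilin_2[OF f] trilin_3[OF f] trilin_closed[OF f]
  have "sw P (\<rho> a) (\<lambda>x y. sw P (\<rho> x) (\<lambda>u v. f u v y)) =
    sw P (ktensor_map K AH H \<rho> id (\<rho> a)) (\<lambda>t y. sw P t (\<lambda>u v. f u v y))"
    by (subst sw_ktensor_map[where M = A and N = H], simp_all add: id_def) (assumption | rule mlin)+
  also have "\<dots> = sw P (ktensor_assoc K A H H (ktensor_map K AH H \<rho> id (\<rho> a))) (\<lambda>x t. sw P t (f x))"
    by (rule sw_assoc[symmetric]) (assumption | rule f mlin ktensor_map_in[where M = A and N = H, unfolded id_def] | simp add: id_def)+
  also have "\<dots> = sw P (ktensor_map K A HH id \<Delta> (\<rho> a)) (\<lambda>x t. sw P t (f x))"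
    using right_comodule_algebra.coaction_coassoc[OF C h] by simp
  also have "\<dots> = sw P (\<rho> a) (\<lambda>x y. sw P (\<Delta> y) (\<lambda>u v. f x u v))"
    by (subst sw_ktensor_map[where M = A and N = H], simp_all add: id_def) (assumption | rule mlin)+
  finally show ?thesis .
qed

lemma Delta_mult:
  assumes P[mlin]: "module K P" and f[mlin]: "bilin K H H P f" and h[mlin]: "a \<in> carrier H" "b \<in> carrier H"
  shows "sw P (\<Delta> (a \<bullet> b)) f = sw P (\<Delta> a) (\<lambda>x y. sw P (\<Delta> b) (\<lambda>u v. f (x \<bullet> u) (y \<bullet> v)))"
  unfolding weak_bialgebra.comult_mult[OF weak_bialgebra h]
  by (rule sw_mult[OF algebra_H algebra_H]) (assumption | rule mlin)+

lemma rho_mult: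
  assumes P[mlin]: "module K P" and f[mlin]: "bilin K A H P f" and h[mlin]: "a \<in> carrier A" "b \<in> carrier A"
  shows "sw P (\<rho> (a \<cdot> b)) f = sw P (\<rho> a) (\<lambda>x y. sw P (\<rho> b) (\<lambda>u v. f (x \<cdot> u) (y \<bullet> v)))"
  unfolding right_comodule_algebra.coaction_mult[OF C h]
  by (rule sw_mult[OF algebra_A algebra_H]) (assumption | rule mlin)+

text \<open>The substitute for unitality of the coproduct: \<open>\<Delta> 1\<close> can differ from
  \<open>1 \<otimes> 1\<close>, but as a right factor of \<open>\<Delta> a\<close> it is absorbed
  because \<open>a 1 = a\<close>.\<close>

lemma Delta_one_right:
  assumes P[mlin]: "module K P" and f[mlin]: "bilin K H H P f" and h[mlin]: "a \<in> carrier H"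
  shows "sw P (\<Delta> a) (\<lambda>x y. sw P (\<Delta> 1H) (\<lambda>u v. f (x \<bullet> u) (y \<bullet> v))) = sw P (\<Delta> a) f"
  using Delta_mult[OF P f h RH.one_closed] h by simp

lemma rho_one_right:
  assumes P[mlin]: "module K P" and f[mlin]: "bilin K A H P f" and h[mlin]: "a \<in> carrier A"
  shows "sw P (\<rho> a) (\<lambda>x y. sw P (\<rho> 1A) (\<lambda>u v. f (x \<cdot> u) (y \<bullet> v))) = sw P (\<rho> a) f"
  using rho_mult[OF P f h RA.one_closed] h by simp

lemma rho_one_left:
  assumes P[mlin]: "module K P" and f[mlin]: "bilin K A H P f" and h[mlin]: "a \<in> carrier A"
  shows "sw P (\<rho> 1A) (\<lambda>x y. sw P (\<rho> a) (\<lambda>u v. f (x \<cdot> u) (y \<bullet> v))) = sw P (\<rho> a) f"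
  using rho_mult[OF P f RA.one_closed h] h by simp

text \<open>Read from left to right it frees a second copy of \<open>\<Delta> 1\<close>, which
  neighbouring factors can absorb; read from right to left it exposes a middle leg, which a counit
  can remove.\<close>

lemma Delta_one:
  assumes P[mlin]: "module K P" and f: "trilin K H H H P f"
  shows "sw P (\<Delta> 1H) (\<lambda>x y. sw P (\<Delta> x) (\<lambda>u v. f u v y)) =
    sw P (\<Delta> 1H) (\<lambda>x y. sw P (\<Delta> 1H) (\<lambda>u v. f x (y \<bullet> u) v))"
proof -
  note [mlin] = trilin_1[OF f] trilin_2[OF f] trilin_3[OF f] trilin_closed[OF f]
  let ?Q = "ktensor K H HH"
  have "sw P (\<Delta> 1H) (\<lambda>x y. sw P (\<Delta> x) (\<lambda>u v. f u v y)) =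
    sw P (ktensor_map K HH H \<Delta> id (\<Delta> 1H)) (\<lambda>t y. sw P t (\<lambda>u v. f u v y))"
    by (subst sw_ktensor_map[where M = H and N = H], simp_all add: id_def) (assumption | rule mlin)+
  also have "\<dots> = sw P (ktensor_assoc K H H H (ktensor_map K HH H \<Delta> id (\<Delta> 1H))) (\<lambda>x t. sw P t (f x))"
    by (rule sw_assoc[symmetric]) (assumption | rule f mlin ktensor_map_in[where M = H and N = H, unfolded id_def] | simp add: id_def)+
  also have "\<dots> = sw P (sw ?Q (\<Delta> 1H) (\<lambda>x y. sw ?Q (\<Delta> 1H) (\<lambda>u v. kpure K H HH x (kpure K H H (y \<bullet> u) v))))
      (\<lambda>x t. sw P t (f x))"
    using weak_bialgebra.comult_one1[OF weak_bialgebra] by simp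
  also have "\<dots> = sw P (\<Delta> 1H) (\<lambda>x y. sw P (sw ?Q (\<Delta> 1H) (\<lambda>u v. kpure K H HH x (kpure K H H (y \<bullet> u) v))) (\<lambda>x t. sw P t (f x)))"
    by (rule linear_sw[where g = "\<lambda>s. sw P s (\<lambda>x t. sw P t (f x))" and M = H and N = H]) (assumption | rule mlin)+
  also have "\<dots> = sw P (\<Delta> 1H) (\<lambda>x y. sw P (\<Delta> 1H) (\<lambda>u v. sw P (kpure K H HH x (kpure K H H (y \<bullet> u) v)) (\<lambda>x t. sw P t (f x))))"
    by (assumption | rule linear_sw[where g = "\<lambda>s. sw P s (\<lambda>x t. sw P t (f x))" and M = H and N = H] sw_congs mlin)+
  also have "\<dots> = sw P (\<Delta> 1H) (\<lambda>x y. sw P (\<Delta> 1H) (\<lambda>u v. sw P (kpure K H H (y \<bullet> u) v) (f x)))"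
    by (assumption | rule sw_kpure sw_congs mlin)+
  also have "\<dots> = sw P (\<Delta> 1H) (\<lambda>x y. sw P (\<Delta> 1H) (\<lambda>u v. f x (y \<bullet> u) v))"
    by (assumption | rule sw_kpure sw_congs mlin)+
  finally show ?thesis .
qed

text \<open>The defining compatibility of a comodule algebra. It turns the \<open>PL\<close>
  produced by the antipode axiom into a left factor \<open>\<rho> 1\<close>, which a coaction to its
  left then absorbs.\<close>

lemma Pi_L_coaction:
  assumes P[mlin]: "module K P" and f[mlin]: "bilin K A H P f" and h[mlin]: "a \<in> carrier A"
  shows "sw P (\<rho> a) (\<lambda>x h. f x (PL h)) = sw P (\<rho> 1A) (\<lambda>x h. f (x \<cdot> a) h)"
proof -
  note [mlin] = bilin_left[OF f] bilin_right[OF f] bilin_closed[OF f]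
  have "sw P (\<rho> a) (\<lambda>x h. f x (PL h)) = sw P (ktensor_map K A H id PL (\<rho> a)) f"
    by (subst sw_ktensor_map[where M = A and N = H], simp_all add: id_def) (assumption | rule mlin)+
  also have "\<dots> = sw P (sw AH (\<rho> 1A) (\<lambda>x h. kpure K A H (x \<cdot> a) h)) f"
    using right_comodule_algebra.coaction_one[OF C h] by simp
  also have "\<dots> = sw P (\<rho> 1A) (\<lambda>x h. sw P (kpure K A H (x \<cdot> a) h) f)"
    by (rule linear_sw[where g = "\<lambda>s. sw P s f" and M = A and N = H]) (assumption | rule mlin)+
  also have "\<dots> = sw P (\<rho> 1A) (\<lambda>x h. f (x \<cdot> a) h)"
    by (assumption | rule sw_kpure sw_congs mlin)+
  finally show ?thesis .
qed

lemma Delta_counit_left: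
  assumes [mlin]: "module K P" and f: "linear_map K H P f" and h[mlin]: "h \<in> carrier H"
  shows "sw P (\<Delta> h) (\<lambda>x y. \<epsilon> x \<odot>\<^bsub>P\<^esub> f y) = f h"
proof -
  note [mlin] = linear_map_comp[OF f] linear_map_closed[OF f] f
  have "f (sw H (\<Delta> h) (\<lambda>x y. \<epsilon> x *H y)) = sw P (\<Delta> h) (\<lambda>x y. f (\<epsilon> x *H y))"
    by (rule linear_sw[where M = H and N = H]) (assumption | rule mlin)+
  also have "\<dots> = sw P (\<Delta> h) (\<lambda>x y. \<epsilon> x \<odot>\<^bsub>P\<^esub> f y)"
    by (assumption | rule linear_map_smult[OF f] sw_congs mlin)+
  finally show ?thesis using coassoc_coalgebra.counit_left[OF coalgebra_H h] by simp
qed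

lemma Delta_counit_right:
  assumes [mlin]: "module K P" and f: "linear_map K H P f" and h[mlin]: "h \<in> carrier H"
  shows "sw P (\<Delta> h) (\<lambda>x y. \<epsilon> y \<odot>\<^bsub>P\<^esub> f x) = f h"
proof -
  note [mlin] = linear_map_comp[OF f] linear_map_closed[OF f] f
  have "f (sw H (\<Delta> h) (\<lambda>x y. \<epsilon> y *H x)) = sw P (\<Delta> h) (\<lambda>x y. f (\<epsilon> y *H x))"
    by (rule linear_sw[where M = H and N = H]) (assumption | rule mlin)+
  also have "\<dots> = sw P (\<Delta> h) (\<lambda>x y. \<epsilon> y \<odot>\<^bsub>P\<^esub> f x)"
    by (assumption | rule linear_map_smult[OF f] sw_congs mlin)+
  finally show ?thesis using coassoc_coalgebra.counit_right[OF coalgebra_H h] by simp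
qed

lemma rho_counit:
  assumes [mlin]: "module K P" and f: "linear_map K A P f" and h[mlin]: "a \<in> carrier A"
  shows "sw P (\<rho> a) (\<lambda>x h. \<epsilon> h \<odot>\<^bsub>P\<^esub> f x) = f a"
proof -
  note [mlin] = linear_map_comp[OF f] linear_map_closed[OF f] f
  have "f (sw A (\<rho> a) (\<lambda>x h. \<epsilon> h *A x)) = sw P (\<rho> a) (\<lambda>x h. f (\<epsilon> h *A x))"
    by (rule linear_sw[where M = A and N = H]) (assumption | rule mlin)+
  also have "\<dots> = sw P (\<rho> a) (\<lambda>x h. \<epsilon> h \<odot>\<^bsub>P\<^esub> f x)"
    by (assumption | rule linear_map_smult[OF f] sw_congs mlin)+
  finally show ?thesis using right_comodule_algebra.coaction_counit[OF C h] by simp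
qed

lemma antipode:
  assumes [mlin]: "module K P" and f: "linear_map K H P f" and h[mlin]: "h \<in> carrier H"
  shows "sw P (\<Delta> h) (\<lambda>x y. f (x \<bullet> S y)) = f (PL h)"
proof -
  note [mlin] = linear_map_comp[OF f] linear_map_closed[OF f] f
  have "f (sw H (\<Delta> h) (\<lambda>x y. x \<bullet> S y)) = sw P (\<Delta> h) (\<lambda>x y. f (x \<bullet> S y))"
    by (rule linear_sw[where M = H and N = H]) (assumption | rule mlin)+
  then show ?thesis using weak_hopf_algebra.antipode_right[OF W h] by simp
qed

end

section \<open>The integral of a coseparable weak Hopf algebra\<close>

text \<open>\<open>\<tau>\<^sub>0\<close> lifts \<open>h \<mapsto> p_R (1 \<otimes> h)\<close> along the canonical map; it exists as \<open>H\<close> is projective.\<close>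

locale cosep_setup = weak_comodule_setup K H \<Delta> \<epsilon> S A \<rho>
  for K :: "('k, 'x) ring_scheme" and H :: "('k, 'h, 'y) module_scheme"
    and \<Delta> :: "'h \<Rightarrow> ('h, 'h) tensor" and \<epsilon> :: "'h \<Rightarrow> 'k" and S :: "'h \<Rightarrow> 'h"
    and A :: "('k, 'a, 'z) module_scheme" and \<rho> :: "'a \<Rightarrow> ('a, 'h) tensor" +
  fixes r :: "('h, 'h) tensor \<Rightarrow> 'h" and \<tau>\<^sub>0 :: "'h \<Rightarrow> ('a, 'a) tensor"
  assumes lin_r: "linear_map K (ktensor K H H) H r"
    and r_left: "\<lbrakk>x \<in> carrier H; y \<in> carrier H\<rbrakk> \<Longrightarrow> \<Delta> (r (kpure K H H x y)) =
       tensor_lift (ktensor K H H) (\<lambda>x1 x2. kpure K H H x1 (r (kpure K H H x2 y))) (\<Delta> x)"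
    and r_right: "\<lbrakk>x \<in> carrier H; y \<in> carrier H\<rbrakk> \<Longrightarrow> \<Delta> (r (kpure K H H x y)) =
       tensor_lift (ktensor K H H) (\<lambda>y1 y2. kpure K H H (r (kpure K H H x y1)) y2) (\<Delta> y)"
    and r_Delta: "x \<in> carrier H \<Longrightarrow> r (\<Delta> x) = x"
    and lin_tau0: "linear_map K H (ktensor K A A) \<tau>\<^sub>0"
    and tau0_can: "h \<in> carrier H \<Longrightarrow>
      sw (ktensor K A H) (\<tau>\<^sub>0 h) (\<lambda>x y. sw (ktensor K A H) (\<rho> y) (\<lambda>u g. kpure K A H (x \<otimes>\<^bsub>A\<^esub> u) g)) =
      sw (ktensor K A H) (\<rho> \<one>\<^bsub>A\<^esub>) (\<lambda>x g. kpure K A H x (h \<otimes>\<^bsub>H\<^esub> g))"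
begin

section \<open>The bicomodule retraction and its form
  \<open>\<delta> = \<epsilon> \<circ> rr\<close>\<close>

definition rr where "rr x y = r (kpure K H H x y)"

lemma bilin_rr: "bilin K H H H rr"
  unfolding rr_def by (rule bilinI; rule linear_map_comp[OF lin_r]) (assumption | rule mlin)+

lemmas [mlin] = bilin_left[OF bilin_rr] bilin_right[OF bilin_rr] bilin_closed[OF bilin_rr]
  linear_map_comp[OF lin_tau0] linear_map_closed[OF lin_tau0]

lemma Delta_rr_left:
  assumes [mlin]: "module K P" and f: "bilin K H H P f" and [mlin]: "x \<in> carrier H" "y \<in> carrier H"
  shows "sw P (\<Delta> (rr x y)) f = sw P (\<Delta> x) (\<lambda>u v. f u (rr v y))"
proof -
  note [mlin] = f bilin_left[OF f] bilin_right[OF f] bilin_closed[OF f]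
  have "\<Delta> (rr x y) = sw HH (\<Delta> x) (\<lambda>u v. kpure K H H u (rr v y))"
    unfolding rr_def by (rule r_left) (assumption | rule mlin)+
  then have "sw P (\<Delta> (rr x y)) f = sw P (sw HH (\<Delta> x) (\<lambda>u v. kpure K H H u (rr v y))) f" by simp
  also have "\<dots> = sw P (\<Delta> x) (\<lambda>u v. sw P (kpure K H H u (rr v y)) f)"
    by (rule linear_sw[where g = "\<lambda>s. sw P s f" and M = H and N = H]) (assumption | rule mlin)+
  also have "\<dots> = sw P (\<Delta> x) (\<lambda>u v. f u (rr v y))"
    by (assumption | rule sw_kpure sw_congs mlin)+
  finally show ?thesis .
qed

lemma Delta_rr_right:
  assumes [mlin]: "module K P" and f: "bilin K H H P f" and [mlin]: "x \<in> carrier H" "y \<in> carrier H"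
  shows "sw P (\<Delta> (rr x y)) f = sw P (\<Delta> y) (\<lambda>u v. f (rr x u) v)"
proof -
  note [mlin] = f bilin_left[OF f] bilin_right[OF f] bilin_closed[OF f]
  have "\<Delta> (rr x y) = sw HH (\<Delta> y) (\<lambda>u v. kpure K H H (rr x u) v)"
    unfolding rr_def by (rule r_right) (assumption | rule mlin)+
  then have "sw P (\<Delta> (rr x y)) f = sw P (sw HH (\<Delta> y) (\<lambda>u v. kpure K H H (rr x u) v)) f" by simp
  also have "\<dots> = sw P (\<Delta> y) (\<lambda>u v. sw P (kpure K H H (rr x u) v) f)"
    by (rule linear_sw[where g = "\<lambda>s. sw P s f" and M = H and N = H]) (assumption | rule mlin)+
  also have "\<dots> = sw P (\<Delta> y) (\<lambda>u v. f (rr x u) v)"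
    by (assumption | rule sw_kpure sw_congs mlin)+
  finally show ?thesis .
qed

lemma rr_Delta:
  assumes [mlin]: "x \<in> carrier H"
  shows "sw H (\<Delta> x) rr = x"
proof -
  have "r (sw HH (\<Delta> x) (kpure K H H)) = sw H (\<Delta> x) (\<lambda>u v. r (kpure K H H u v))"
    by (rule linear_sw[where M = H and N = H, OF _ _ _ _ _ lin_r]) (rule mlin two_modules.kpure_bilin[OF two_modules.intro])+
  moreover have "sw HH (\<Delta> x) (kpure K H H) = \<Delta> x" by (rule sw_pure_id) (assumption | rule mlin)+
  ultimately show ?thesis using r_Delta[of x] assms by (simp add: rr_def[abs_def])
qed

text \<open>Left colinearity of \<open>rr\<close> followed by the counit. Together with
  \<open>rr_expand_right\<close> this is \<open>\<Sum> x\<^sub>1 \<delta> (x\<^sub>2 \<otimes> y) =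
  rr x y = \<Sum> \<delta> (x \<otimes> y\<^sub>1) y\<^sub>2\<close>, the description of
  coseparability by a form.\<close>

lemma rr_expand_left:
  assumes [mlin]: "module K P" and f: "linear_map K H P f" and [mlin]: "x \<in> carrier H" "y \<in> carrier H"
  shows "sw P (\<Delta> x) (\<lambda>u v. \<epsilon> (rr v y) \<odot>\<^bsub>P\<^esub> f u) = f (rr x y)"
proof -
  note [mlin] = linear_map_comp[OF f] linear_map_closed[OF f] f
  have "sw P (\<Delta> (rr x y)) (\<lambda>u v. \<epsilon> v \<odot>\<^bsub>P\<^esub> f u) = sw P (\<Delta> x) (\<lambda>u v. \<epsilon> (rr v y) \<odot>\<^bsub>P\<^esub> f u)"
    by (rule Delta_rr_left) (assumption | rule mlin)+
  moreover have "sw P (\<Delta> (rr x y)) (\<lambda>u v. \<epsilon> v \<odot>\<^bsub>P\<^esub> f u) = f (rr x y)"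
    by (rule Delta_counit_right) (assumption | rule mlin)+
  ultimately show ?thesis by simp
qed

lemma rr_expand_right:
  assumes [mlin]: "module K P" and f: "linear_map K H P f" and [mlin]: "x \<in> carrier H" "y \<in> carrier H"
  shows "sw P (\<Delta> y) (\<lambda>u v. \<epsilon> (rr x u) \<odot>\<^bsub>P\<^esub> f v) = f (rr x y)"
proof -
  note [mlin] = linear_map_comp[OF f] linear_map_closed[OF f] f
  have "sw P (\<Delta> (rr x y)) (\<lambda>u v. \<epsilon> u \<odot>\<^bsub>P\<^esub> f v) = sw P (\<Delta> y) (\<lambda>u v. \<epsilon> (rr x u) \<odot>\<^bsub>P\<^esub> f v)"
    by (rule Delta_rr_right) (assumption | rule mlin)+
  moreover have "sw P (\<Delta> (rr x y)) (\<lambda>u v. \<epsilon> u \<odot>\<^bsub>P\<^esub> f v) = f (rr x y)"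
    by (rule Delta_counit_left) (assumption | rule mlin)+
  ultimately show ?thesis by simp
qed

text \<open>
  \<open>\<epsilon> \<circ> \<psi>\<close> is the integral of the proof idea, \<open>h \<mapsto> \<Sum> \<delta> (h 1\<^sub>1 \<otimes> 1\<^sub>2)\<close> with \<open>\<delta> = \<epsilon> \<circ> r\<close>.  The extra factor \<open>\<Delta> 1\<close>
  makes it agree with \<open>\<epsilon>\<close> on the image of \<open>\<Pi>\<^sup>L\<close>.
\<close>

definition \<psi> where "\<psi> h = sw H (\<Delta> 1H) (\<lambda>x y. rr (h \<bullet> x) y)"

lemma lin_psi: "linear_map K H H \<psi>" unfolding \<psi>_def by (assumption | rule mlin)+

lemmas [mlin] = linear_map_comp[OF lin_psi] linear_map_closed[OF lin_psi]

text \<open>Left colinearity of \<open>rr\<close> takes one leg off \<open>h 1\<^sub>1\<close>.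
  \<open>Delta_one\<close> splits the resulting three legs of the unit into two copies of
  \<open>\<Delta> 1\<close>: one completes \<open>\<psi>\<close>, the other is absorbed by
  \<open>\<Delta> h\<close>. Thus \<open>\<psi>\<close> is left colinear.\<close>

lemma sw_Delta_psi:
  assumes [mlin]: "module K P" and f: "bilin K H H P f" and [mlin]: "h \<in> carrier H"
  shows "sw P (\<Delta> (\<psi> h)) f = sw P (\<Delta> h) (\<lambda>u v. f u (\<psi> v))"
proof -
  note [mlin] = f bilin_left[OF f] bilin_right[OF f] bilin_closed[OF f]
  have "sw P (\<Delta> (\<psi> h)) f = sw P (\<Delta> 1H) (\<lambda>x y. sw P (\<Delta> (rr (h \<bullet> x) y)) f)"
    unfolding \<psi>_def by (rule linear_sw[where g = "\<lambda>s. sw P (\<Delta> s) f" and M = H and N = H]) (assumption | rule mlin)+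
  also have "\<dots> = sw P (\<Delta> 1H) (\<lambda>x y. sw P (\<Delta> (h \<bullet> x)) (\<lambda>u v. f u (rr v y)))"
    by (assumption | rule Delta_rr_left sw_congs mlin)+
  also have "\<dots> = sw P (\<Delta> 1H) (\<lambda>x y. sw P (\<Delta> h) (\<lambda>u v. sw P (\<Delta> x) (\<lambda>u' v'. f (u \<bullet> u') (rr (v \<bullet> v') y))))"
    by (assumption | rule Delta_mult sw_congs mlin)+
  also have "\<dots> = sw P (\<Delta> h) (\<lambda>u v. sw P (\<Delta> 1H) (\<lambda>x y. sw P (\<Delta> x) (\<lambda>u' v'. f (u \<bullet> u') (rr (v \<bullet> v') y))))"
    by (rule sw_swap) (assumption | rule mlin)+
  also have "\<dots> = sw P (\<Delta> h) (\<lambda>u v. sw P (\<Delta> 1H) (\<lambda>x y. sw P (\<Delta> 1H) (\<lambda>u' v'. f (u \<bullet> x) (rr (v \<bullet> (y \<bullet> u')) v'))))"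
    by (assumption | rule Delta_one sw_congs mlin)+
  also have "\<dots> = sw P (\<Delta> h) (\<lambda>u v. sw P (\<Delta> 1H) (\<lambda>x y. f (u \<bullet> x) (\<psi> (v \<bullet> y))))"
  proof (rule Delta_cong, (assumption | rule mlin)+, rule Delta_cong, (assumption | rule mlin)+)
    fix u v x y assume [mlin]: "u \<in> carrier H" "v \<in> carrier H" "x \<in> carrier H" "y \<in> carrier H"
    have "f (u \<bullet> x) (\<psi> (v \<bullet> y)) = sw P (\<Delta> 1H) (\<lambda>u' v'. f (u \<bullet> x) (rr (v \<bullet> y \<bullet> u') v'))"
      unfolding \<psi>_def by (rule linear_sw[where M = H and N = H]) (assumption | rule mlin)+
    also have "\<dots> = sw P (\<Delta> 1H) (\<lambda>u' v'. f (u \<bullet> x) (rr (v \<bullet> (y \<bullet> u')) v'))"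
      by (assumption | rule sw_congs mlin | subst RH.m_assoc | rule refl)+
    finally show "sw P (\<Delta> 1H) (\<lambda>u' v'. f (u \<bullet> x) (rr (v \<bullet> (y \<bullet> u')) v')) = f (u \<bullet> x) (\<psi> (v \<bullet> y))" by simp
  qed
  also have "\<dots> = sw P (\<Delta> h) (\<lambda>u v. f u (\<psi> v))"
    by (rule Delta_one_right) (assumption | rule mlin)+
  finally show ?thesis .
qed

text \<open>The counterpart of \<open>\<Pi>\<^sup>L\<close> with \<open>\<Sum> a\<^sub>0 \<otimes> \<kappa> a\<^sub>1 = \<Sum> a 1\<^sub>0 \<otimes> 1\<^sub>1\<close>; no inverse of the antipode enters.\<close>

definition \<kappa> where "\<kappa> h = sw H (\<Delta> 1H) (\<lambda>x y. \<epsilon> (h \<bullet> x) *H y)"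

lemma lin_kappa: "linear_map K H H \<kappa>" unfolding \<kappa>_def by (assumption | rule mlin)+

lemmas [mlin] = linear_map_comp[OF lin_kappa] linear_map_closed[OF lin_kappa]

lemma linear_kappa:
  assumes [mlin]: "module K P" and f: "linear_map K H P f" and [mlin]: "h \<in> carrier H"
  shows "f (\<kappa> h) = sw P (\<Delta> 1H) (\<lambda>x y. \<epsilon> (h \<bullet> x) \<odot>\<^bsub>P\<^esub> f y)"
proof -
  note [mlin] = linear_map_comp[OF f] linear_map_closed[OF f] f
  have "f (\<kappa> h) = sw P (\<Delta> 1H) (\<lambda>x y. f (\<epsilon> (h \<bullet> x) *H y))"
    unfolding \<kappa>_def by (rule linear_sw[where M = H and N = H]) (assumption | rule mlin)+
  also have "\<dots> = sw P (\<Delta> 1H) (\<lambda>x y. \<epsilon> (h \<bullet> x) \<odot>\<^bsub>P\<^esub> f y)"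
    by (assumption | rule linear_map_smult[OF f] sw_congs mlin)+
  finally show ?thesis .
qed

text \<open>In \<open>\<kappa> 1\<^sub>2\<close> the counit is applied to a product of a second leg
  with the first leg of another \<open>\<Delta> 1\<close>. By \<open>Delta_one\<close> this product
  is the middle leg of the threefold coproduct of 1, and the counit removes it.\<close>

lemma sw_Delta_one_kappa:
  assumes [mlin]: "module K P" and f: "bilin K H H P f"
  shows "sw P (\<Delta> 1H) (\<lambda>x y. f x (\<kappa> y)) = sw P (\<Delta> 1H) f"
proof -
  note [mlin] = f bilin_left[OF f] bilin_right[OF f] bilin_closed[OF f]
  have "sw P (\<Delta> 1H) (\<lambda>x y. f x (\<kappa> y)) = sw P (\<Delta> 1H) (\<lambda>x y. sw P (\<Delta> 1H) (\<lambda>u v. \<epsilon> (y \<bullet> u) \<odot>\<^bsub>P\<^esub> f x v))"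
    by (assumption | rule linear_kappa sw_congs mlin)+
  also have "\<dots> = sw P (\<Delta> 1H) (\<lambda>x y. sw P (\<Delta> x) (\<lambda>u v. \<epsilon> v \<odot>\<^bsub>P\<^esub> f u y))"
    by (rule Delta_one[symmetric, where f = "\<lambda>u v y. \<epsilon> v \<odot>\<^bsub>P\<^esub> f u y"]) (assumption | rule mlin)+
  also have "\<dots> = sw P (\<Delta> 1H) f"
    by (assumption | rule Delta_counit_right sw_congs mlin)+
  finally show ?thesis .
qed

text \<open>\<open>\<psi>\<close> takes values in the span of the second legs of \<open>\<Delta> 1\<close>, which \<open>\<kappa>\<close> fixes.\<close>

lemma kappa_psi:
  assumes [mlin]: "h \<in> carrier H"
  shows "\<kappa> (\<psi> h) = \<psi> h"
proof -
  \<comment> \<open>\<open>?F x\<close> is the form \<open>\<delta>\<close> applied to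
    \<open>\<Sum> h x\<^sub>1 \<otimes> x\<^sub>2\<close>. With it \<open>\<psi> h\<close> becomes
    \<open>\<Sum> ?F (1\<^sub>1) 1\<^sub>2\<close>, visibly a combination of second legs.\<close>
  let ?F = "\<lambda>x. sw KK (\<Delta> x) (\<lambda>u v. \<epsilon> (rr (h \<bullet> u) v))"
  have F: "x \<in> carrier H \<Longrightarrow> ?F x \<in> carrier K" for x
    unfolding carrier_KK[symmetric] by (assumption | rule mlin bilinI linear_map_closed[OF lin_eps])+
  note [mlin] = F
  have *: "f (\<psi> h) = sw H (\<Delta> 1H) (\<lambda>x y. ?F x *H f y)" if f: "linear_map K H H f" for f
  proof -
    note [mlin] = linear_map_comp[OF f] linear_map_closed[OF f] f
    have "f (\<psi> h) = sw H (\<Delta> 1H) (\<lambda>x y. f (rr (h \<bullet> x) y))"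
      unfolding \<psi>_def by (rule linear_sw[where M = H and N = H]) (assumption | rule mlin)+
    also have "\<dots> = sw H (\<Delta> 1H) (\<lambda>x y. sw H (\<Delta> y) (\<lambda>u v. \<epsilon> (rr (h \<bullet> x) u) *H f v))"
      by (assumption | rule rr_expand_right[symmetric] sw_congs mlin)+
    also have "\<dots> = sw H (\<Delta> 1H) (\<lambda>x y. sw H (\<Delta> x) (\<lambda>u v. \<epsilon> (rr (h \<bullet> u) v) *H f y))"
      by (rule Delta_coassoc[symmetric, where f = "\<lambda>x u v. \<epsilon> (rr (h \<bullet> x) u) *H f v"]) (assumption | rule mlin)+
    also have "\<dots> = sw H (\<Delta> 1H) (\<lambda>x y. ?F x *H f y)"
      by (assumption | rule linear_sw[symmetric, where M = H and N = H and P = KK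
            and g = "\<lambda>c. c *H _"] sw_congs mlin)+
    finally show ?thesis .
  qed
  have "\<kappa> (\<psi> h) = sw H (\<Delta> 1H) (\<lambda>x y. ?F x *H \<kappa> y)"
    by (rule *[OF lin_kappa])
  also have "\<dots> = sw H (\<Delta> 1H) (\<lambda>x y. ?F x *H y)"
    by (rule sw_Delta_one_kappa) (assumption | rule mlin)+
  also have "\<dots> = \<psi> h"
    by (rule *[OF linear_map_id, symmetric])
  finally show ?thesis .
qed

text \<open>\<open>PL h\<close> is a combination of second legs of \<open>\<Delta> 1\<close>. By
  coassociativity the coproduct of such a leg is part of the threefold coproduct of 1, from which
  \<open>Delta_one\<close> splits off a free copy of \<open>\<Delta> 1\<close>.\<close>

lemma sw_Delta_Pi:
  assumes [mlin]: "module K P" and f: "bilin K H H P f" and [mlin]: "h \<in> carrier H"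
  shows "sw P (\<Delta> (PL h)) f = sw P (\<Delta> 1H) (\<lambda>x y. f (PL h \<bullet> x) y)"
proof -
  note [mlin] = f bilin_left[OF f] bilin_right[OF f] bilin_closed[OF f]
  have *: "g (PL h) = sw P (\<Delta> 1H) (\<lambda>x y. \<epsilon> (x \<bullet> h) \<odot>\<^bsub>P\<^esub> g y)" if g: "linear_map K H P g" for g
  proof -
    note [mlin] = linear_map_comp[OF g] linear_map_closed[OF g] g
    have "g (PL h) = sw P (\<Delta> 1H) (\<lambda>x y. g (\<epsilon> (x \<bullet> h) *H y))"
      unfolding Pi_L_def by (rule linear_sw[where M = H and N = H]) (assumption | rule mlin)+
    also have "\<dots> = sw P (\<Delta> 1H) (\<lambda>x y. \<epsilon> (x \<bullet> h) \<odot>\<^bsub>P\<^esub> g y)"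
      by (assumption | rule linear_map_smult[OF g] sw_congs mlin)+
    finally show ?thesis .
  qed
  have "sw P (\<Delta> (PL h)) f = sw P (\<Delta> 1H) (\<lambda>x y. \<epsilon> (x \<bullet> h) \<odot>\<^bsub>P\<^esub> sw P (\<Delta> y) f)"
    by (rule *) (assumption | rule mlin)+
  also have "\<dots> = sw P (\<Delta> 1H) (\<lambda>x y. sw P (\<Delta> y) (\<lambda>u v. \<epsilon> (x \<bullet> h) \<odot>\<^bsub>P\<^esub> f u v))"
    by (assumption | rule linear_sw[where M = H and N = H] sw_congs mlin)+
  also have "\<dots> = sw P (\<Delta> 1H) (\<lambda>x y. sw P (\<Delta> x) (\<lambda>u v. \<epsilon> (u \<bullet> h) \<odot>\<^bsub>P\<^esub> f v y))"
    by (rule Delta_coassoc[symmetric, where f = "\<lambda>x u v. \<epsilon> (x \<bullet> h) \<odot>\<^bsub>P\<^esub> f u v"]) (assumption | rule mlin)+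
  also have "\<dots> = sw P (\<Delta> 1H) (\<lambda>x y. sw P (\<Delta> 1H) (\<lambda>u v. \<epsilon> (x \<bullet> h) \<odot>\<^bsub>P\<^esub> f (y \<bullet> u) v))"
    by (rule Delta_one[where f = "\<lambda>u v y. \<epsilon> (u \<bullet> h) \<odot>\<^bsub>P\<^esub> f v y"]) (assumption | rule mlin)+
  also have "\<dots> = sw P (\<Delta> 1H) (\<lambda>u v. sw P (\<Delta> 1H) (\<lambda>x y. \<epsilon> (x \<bullet> h) \<odot>\<^bsub>P\<^esub> f (y \<bullet> u) v))"
    by (rule sw_swap) (assumption | rule mlin)+
  also have "\<dots> = sw P (\<Delta> 1H) (\<lambda>u v. f (PL h \<bullet> u) v)"
    by (rule Delta_cong, (assumption | rule mlin)+, rule *[symmetric]) (assumption | rule mlin)+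
  finally show ?thesis .
qed

text \<open>The factor \<open>\<Delta> 1\<close> inside \<open>\<psi>\<close> is exactly what turns
  \<open>PL h\<close> into \<open>\<Delta> (PL h)\<close>, so the retraction property applies. This
  is the normalisation of the integral.\<close>

lemma psi_Pi: assumes [mlin]: "h \<in> carrier H" shows "\<psi> (PL h) = PL h"
proof -
  have "\<psi> (PL h) = sw H (\<Delta> (PL h)) rr"
    unfolding \<psi>_def by (rule sw_Delta_Pi[symmetric]) (assumption | rule mlin)+
  then show ?thesis using rr_Delta[of "PL h"] by (simp add: linear_map_closed[OF lin_Pi] assms)
qed

text \<open>By the comodule algebra axiom at 1 the second leg of \<open>\<rho> 1\<close> may be
  replaced by its image under \<open>PL\<close>, whose coproduct \<open>sw_Delta_Pi\<close>
  computes.\<close>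

lemma sw_rho_one_Delta:
  assumes [mlin]: "module K P" and f: "trilin K A H H P f"
  shows "sw P (\<rho> 1A) (\<lambda>x h. sw P (\<Delta> h) (\<lambda>u v. f x u v)) = sw P (\<rho> 1A) (\<lambda>x h. sw P (\<Delta> 1H) (\<lambda>u v. f x (h \<bullet> u) v))"
proof -
  note [mlin] = trilin_1[OF f] trilin_2[OF f] trilin_3[OF f] trilin_closed[OF f]
  have *: "sw P (\<rho> 1A) (\<lambda>x h. g x (PL h)) = sw P (\<rho> 1A) g" if g: "bilin K A H P g" for g
  proof -
    note [mlin] = g bilin_left[OF g] bilin_right[OF g] bilin_closed[OF g]
    have "sw P (\<rho> 1A) (\<lambda>x h. g x (PL h)) = sw P (\<rho> 1A) (\<lambda>x h. g (x \<cdot> 1A) h)"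
      by (rule Pi_L_coaction) (assumption | rule mlin)+
    also have "\<dots> = sw P (\<rho> 1A) g" by (assumption | rule sw_congs mlin | subst RA.r_one | rule refl)+
    finally show ?thesis .
  qed
  have "sw P (\<rho> 1A) (\<lambda>x h. sw P (\<Delta> h) (\<lambda>u v. f x u v)) = sw P (\<rho> 1A) (\<lambda>x h. sw P (\<Delta> (PL h)) (\<lambda>u v. f x u v))"
    by (rule *[symmetric]) (assumption | rule mlin)+
  also have "\<dots> = sw P (\<rho> 1A) (\<lambda>x h. sw P (\<Delta> 1H) (\<lambda>u v. f x (PL h \<bullet> u) v))"
    by (assumption | rule sw_Delta_Pi sw_congs mlin)+
  also have "\<dots> = sw P (\<rho> 1A) (\<lambda>x h. sw P (\<Delta> 1H) (\<lambda>u v. f x (h \<bullet> u) v))"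
    by (rule *) (assumption | rule mlin)+
  finally show ?thesis .
qed

text \<open>A factor \<open>\<rho> 1\<close> is inserted into \<open>\<rho> a\<close>; by
  \<open>sw_rho_one_Delta\<close> its second leg swallows the \<open>\<Delta> 1\<close> of
  \<open>\<kappa>\<close>. Coassociativity then recombines the legs into
  \<open>\<rho> (a 1\<^sub>0)\<close>, and the counit finishes.\<close>

lemma sw_rho_kappa:
  assumes [mlin]: "module K P" and f: "bilin K A H P f" and [mlin]: "a \<in> carrier A"
  shows "sw P (\<rho> a) (\<lambda>x h. f x (\<kappa> h)) = sw P (\<rho> 1A) (\<lambda>x h. f (a \<cdot> x) h)"
proof -
  note [mlin] = f bilin_left[OF f] bilin_right[OF f] bilin_closed[OF f]
  have "sw P (\<rho> a) (\<lambda>x h. f x (\<kappa> h)) = sw P (\<rho> a) (\<lambda>x h. sw P (\<Delta> 1H) (\<lambda>u v. \<epsilon> (h \<bullet> u) \<odot>\<^bsub>P\<^esub> f x v))"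
    by (assumption | rule linear_kappa sw_congs mlin)+
  also have "\<dots> = sw P (\<rho> a) (\<lambda>x h. sw P (\<rho> 1A) (\<lambda>x' h'. sw P (\<Delta> 1H) (\<lambda>u v. \<epsilon> (h \<bullet> h' \<bullet> u) \<odot>\<^bsub>P\<^esub> f (x \<cdot> x') v)))"
    by (rule rho_one_right[symmetric, where f = "\<lambda>x h. sw P (\<Delta> 1H) (\<lambda>u v. \<epsilon> (h \<bullet> u) \<odot>\<^bsub>P\<^esub> f x v)"]) (assumption | rule mlin)+
  also have "\<dots> = sw P (\<rho> a) (\<lambda>x h. sw P (\<rho> 1A) (\<lambda>x' h'. sw P (\<Delta> 1H) (\<lambda>u v. \<epsilon> (h \<bullet> (h' \<bullet> u)) \<odot>\<^bsub>P\<^esub> f (x \<cdot> x') v)))"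
    by (assumption | rule sw_congs mlin | subst RH.m_assoc | rule refl)+
  also have "\<dots> = sw P (\<rho> a) (\<lambda>x h. sw P (\<rho> 1A) (\<lambda>x' h'. sw P (\<Delta> h') (\<lambda>u v. \<epsilon> (h \<bullet> u) \<odot>\<^bsub>P\<^esub> f (x \<cdot> x') v)))"
    by (assumption | rule sw_rho_one_Delta[symmetric, where f = "\<lambda>x' u v. \<epsilon> (_ \<bullet> u) \<odot>\<^bsub>P\<^esub> f (_ \<cdot> x') v"] sw_congs mlin)+
  also have "\<dots> = sw P (\<rho> a) (\<lambda>x h. sw P (\<rho> 1A) (\<lambda>x' h'. sw P (\<rho> x') (\<lambda>u v. \<epsilon> (h \<bullet> v) \<odot>\<^bsub>P\<^esub> f (x \<cdot> u) h')))"
    by (assumption | rule rho_coassoc[symmetric, where f = "\<lambda>x' u v. \<epsilon> (_ \<bullet> u) \<odot>\<^bsub>P\<^esub> f (_ \<cdot> x') v"] sw_congs mlin)+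
  also have "\<dots> = sw P (\<rho> 1A) (\<lambda>x' h'. sw P (\<rho> a) (\<lambda>x h. sw P (\<rho> x') (\<lambda>u v. \<epsilon> (h \<bullet> v) \<odot>\<^bsub>P\<^esub> f (x \<cdot> u) h')))"
    by (rule sw_swap) (assumption | rule mlin)+
  also have "\<dots> = sw P (\<rho> 1A) (\<lambda>x' h'. sw P (\<rho> (a \<cdot> x')) (\<lambda>x h. \<epsilon> h \<odot>\<^bsub>P\<^esub> f x h'))"
    by (assumption | rule rho_mult[symmetric, where f = "\<lambda>x h. \<epsilon> h \<odot>\<^bsub>P\<^esub> f x _"] sw_congs mlin)+
  also have "\<dots> = sw P (\<rho> 1A) (\<lambda>x' h'. f (a \<cdot> x') h')"
    by (assumption | rule rho_counit sw_congs mlin)+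
  finally show ?thesis .
qed

section \<open>The trace\<close>

definition tr where "tr a = sw A (\<rho> a) (\<lambda>x h. \<epsilon> (\<psi> h) *A x)"

lemma lin_tr: "linear_map K A A tr" unfolding tr_def by (assumption | rule mlin)+

lemmas [mlin] = linear_map_comp[OF lin_tr] linear_map_closed[OF lin_tr]

lemma linear_tr:
  assumes [mlin]: "module K P" and f: "linear_map K A P f" and [mlin]: "a \<in> carrier A"
  shows "f (tr a) = sw P (\<rho> a) (\<lambda>x h. \<epsilon> (\<psi> h) \<odot>\<^bsub>P\<^esub> f x)"
proof -
  note [mlin] = linear_map_comp[OF f] linear_map_closed[OF f] f
  have "f (tr a) = sw P (\<rho> a) (\<lambda>x h. f (\<epsilon> (\<psi> h) *A x))"
    unfolding tr_def by (rule linear_sw[where M = A and N = H]) (assumption | rule mlin)+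
  also have "\<dots> = sw P (\<rho> a) (\<lambda>x h. \<epsilon> (\<psi> h) \<odot>\<^bsub>P\<^esub> f x)"
    by (assumption | rule linear_map_smult[OF f] sw_congs mlin)+
  finally show ?thesis .
qed

text \<open>Coassociativity of \<open>\<rho>\<close> puts a coproduct on the second leg, where left
  colinearity of \<open>\<psi>\<close> and the counit apply.\<close>

lemma sw_rho_tr:
  assumes [mlin]: "module K P" and f: "bilin K A H P f" and [mlin]: "a \<in> carrier A"
  shows "sw P (\<rho> (tr a)) f = sw P (\<rho> a) (\<lambda>x h. f x (\<psi> h))"
proof -
  note [mlin] = f bilin_left[OF f] bilin_right[OF f] bilin_closed[OF f]
  have "sw P (\<rho> (tr a)) f = sw P (\<rho> a) (\<lambda>x h. \<epsilon> (\<psi> h) \<odot>\<^bsub>P\<^esub> sw P (\<rho> x) f)"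
    by (rule linear_tr) (assumption | rule mlin)+
  also have "\<dots> = sw P (\<rho> a) (\<lambda>x h. sw P (\<rho> x) (\<lambda>u v. \<epsilon> (\<psi> h) \<odot>\<^bsub>P\<^esub> f u v))"
    by (assumption | rule linear_sw[where M = A and N = H] sw_congs mlin)+
  also have "\<dots> = sw P (\<rho> a) (\<lambda>x h. sw P (\<Delta> h) (\<lambda>u v. \<epsilon> (\<psi> v) \<odot>\<^bsub>P\<^esub> f x u))"
    by (rule rho_coassoc[where f = "\<lambda>x u v. \<epsilon> (\<psi> v) \<odot>\<^bsub>P\<^esub> f x u"]) (assumption | rule mlin)+
  also have "\<dots> = sw P (\<rho> a) (\<lambda>x h. sw P (\<Delta> (\<psi> h)) (\<lambda>u v. \<epsilon> v \<odot>\<^bsub>P\<^esub> f x u))"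
    by (assumption | rule sw_Delta_psi[symmetric, where f = "\<lambda>u v. \<epsilon> v \<odot>\<^bsub>P\<^esub> f _ u"] sw_congs mlin)+
  also have "\<dots> = sw P (\<rho> a) (\<lambda>x h. f x (\<psi> h))"
    by (assumption | rule Delta_counit_right sw_congs mlin)+
  finally show ?thesis .
qed

text \<open>\<open>\<kappa>\<close> fixes the values of \<open>\<psi>\<close>, so it can be inserted
  after \<open>\<psi>\<close> at no cost, and on \<open>\<rho> (tr a)\<close> it is evaluated by
  \<open>sw_rho_kappa\<close>. The outcome is the coinvariance condition for \<open>tr a\<close>,
  tested at 1.\<close>

lemma sw_rho_tr_one:
  assumes [mlin]: "module K P" and f: "bilin K A H P f" and [mlin]: "a \<in> carrier A"
  shows "sw P (\<rho> (tr a)) f = sw P (\<rho> 1A) (\<lambda>x h. f (tr a \<cdot> x) h)"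
proof -
  note [mlin] = f bilin_left[OF f] bilin_right[OF f] bilin_closed[OF f]
  have "sw P (\<rho> (tr a)) f = sw P (\<rho> a) (\<lambda>x h. f x (\<psi> h))"
    by (rule sw_rho_tr) (assumption | rule mlin)+
  also have "\<dots> = sw P (\<rho> a) (\<lambda>x h. f x (\<kappa> (\<psi> h)))"
    by (assumption | rule sw_congs mlin | subst kappa_psi | rule refl)+
  also have "\<dots> = sw P (\<rho> (tr a)) (\<lambda>x h. f x (\<kappa> h))"
    by (rule sw_rho_tr[symmetric, where f = "\<lambda>x h. f x (\<kappa> h)"]) (assumption | rule mlin)+
  also have "\<dots> = sw P (\<rho> 1A) (\<lambda>x h. f (tr a \<cdot> x) h)"
    by (rule sw_rho_kappa) (assumption | rule mlin)+
  finally show ?thesis .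
qed

end

section \<open>Coinvariants and the equivariant section\<close>

context weak_comodule_setup
begin

abbreviation "B \<equiv> coinvariants K H A \<rho>"
abbreviation "Bm \<equiv> A\<lparr>carrier := B\<rparr>"
abbreviation "BA \<equiv> ktensor K Bm A"

lemma coinv_iff: "b \<in> B \<longleftrightarrow> b \<in> carrier A \<and>
    (\<forall>a\<in>carrier A. \<rho> (b \<cdot> a) = sw AH (\<rho> a) (\<lambda>x h. kpure K A H (b \<cdot> x) h))"
  unfolding coinvariants_def by simp

lemma coinv_in: "b \<in> B \<Longrightarrow> b \<in> carrier A"
  using coinv_iff by blast

lemma sw_rho_coinv:
  assumes b: "b \<in> B" and [mlin]: "module K P" and f: "bilin K A H P f" and [mlin]: "a \<in> carrier A"
  shows "sw P (\<rho> (b \<cdot> a)) f = sw P (\<rho> a) (\<lambda>x h. f (b \<cdot> x) h)"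
proof -
  note [mlin] = f bilin_left[OF f] bilin_right[OF f] bilin_closed[OF f] coinv_in[OF b]
  have "\<rho> (b \<cdot> a) = sw AH (\<rho> a) (\<lambda>x h. kpure K A H (b \<cdot> x) h)"
    using b coinv_iff \<open>a \<in> carrier A\<close> by blast
  then have "sw P (\<rho> (b \<cdot> a)) f = sw P (sw AH (\<rho> a) (\<lambda>x h. kpure K A H (b \<cdot> x) h)) f" by simp
  also have "\<dots> = sw P (\<rho> a) (\<lambda>x h. sw P (kpure K A H (b \<cdot> x) h) f)"
    by (rule linear_sw[where g = "\<lambda>s. sw P s f" and M = A and N = H]) (assumption | rule mlin)+
  also have "\<dots> = sw P (\<rho> a) (\<lambda>x h. f (b \<cdot> x) h)"
    by (assumption | rule sw_kpure sw_congs mlin)+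
  finally show ?thesis .
qed

text \<open>For each \<open>a\<close> the coinvariance condition equates two maps that are linear in
  \<open>b\<close>; sums and scalar multiples of coinvariants are therefore coinvariant.\<close>

lemma coinv_defining_linear:
  assumes [mlin]: "a \<in> carrier A"
  shows "linear_map K A AH (\<lambda>b. \<rho> (b \<cdot> a))"
    and "linear_map K A AH (\<lambda>b. sw AH (\<rho> a) (\<lambda>x h. kpure K A H (b \<cdot> x) h))"
  by (assumption | rule mlin)+

lemma coinv_add: assumes "b \<in> B" "c \<in> B" shows "b \<oplus>\<^bsub>A\<^esub> c \<in> B"
  using assms linear_map_add[OF coinv_defining_linear(1)] linear_map_add[OF coinv_defining_linear(2)]
  unfolding coinv_iff by simp

lemma coinv_smult: assumes "k \<in> carrier K" "b \<in> B" shows "k *A b \<in> B"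
  using assms linear_map_smult[OF coinv_defining_linear(1)] linear_map_smult[OF coinv_defining_linear(2)]
    module.smult_closed[OF modA]
  unfolding coinv_iff by simp

lemma coinv_one: "1A \<in> B"
  unfolding coinv_iff
proof (intro conjI ballI RA.one_closed)
  fix a assume a[mlin]: "a \<in> carrier A"
  have "sw AH (\<rho> a) (\<lambda>x h. kpure K A H (1A \<cdot> x) h) = sw AH (\<rho> a) (kpure K A H)"
    by (rule rho_cong[OF a]) simp
  also have "\<dots> = \<rho> a" by (rule sw_pure_id) (assumption | rule mlin)+
  finally show "\<rho> (1A \<cdot> a) = sw AH (\<rho> a) (\<lambda>x h. kpure K A H (1A \<cdot> x) h)" using a by simp
qed

lemma coinv_mult: assumes b: "b \<in> B" and c: "c \<in> B" shows "b \<cdot> c \<in> B"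
  unfolding coinv_iff
proof (intro conjI ballI)
  note [mlin] = coinv_in[OF b] coinv_in[OF c]
  show "b \<cdot> c \<in> carrier A" by (assumption | rule mlin)+
  fix a assume a[mlin]: "a \<in> carrier A"
  have "\<rho> (b \<cdot> c \<cdot> a) = \<rho> (b \<cdot> (c \<cdot> a))" by (subst RA.m_assoc) ((assumption | rule mlin)+, rule refl)
  also have "\<dots> = sw AH (\<rho> (c \<cdot> a)) (\<lambda>x h. kpure K A H (b \<cdot> x) h)"
    using b a RA.m_closed[OF coinv_in[OF c] a] unfolding coinv_iff by blast
  also have "\<dots> = sw AH (\<rho> a) (\<lambda>x h. kpure K A H (b \<cdot> (c \<cdot> x)) h)"
    by (rule sw_rho_coinv[OF c]) (assumption | rule mlin)+
  also have "\<dots> = sw AH (\<rho> a) (\<lambda>x h. kpure K A H (b \<cdot> c \<cdot> x) h)"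
    by (assumption | rule sw_congs mlin | subst RA.m_assoc | rule refl)+
  finally show "\<rho> (b \<cdot> c \<cdot> a) = sw AH (\<rho> a) (\<lambda>x h. kpure K A H (b \<cdot> c \<cdot> x) h)" .
qed

lemma coinv_zero: "\<zero>\<^bsub>A\<^esub> \<in> B"
proof -
  interpret m: module K A by (rule modA)
  show ?thesis using coinv_smult[OF m.R.zero_closed coinv_one] by simp
qed

lemma coinv_minus: assumes "b \<in> B" shows "\<ominus>\<^bsub>A\<^esub> b \<in> B"
proof -
  interpret m: module K A by (rule modA)
  have "(\<ominus>\<^bsub>K\<^esub> \<one>\<^bsub>K\<^esub>) *A b = \<ominus>\<^bsub>A\<^esub> b"
    using coinv_in[OF assms] by (simp add: m.smult_l_minus)
  then show ?thesis using coinv_smult[OF _ assms, of "\<ominus>\<^bsub>K\<^esub> \<one>\<^bsub>K\<^esub>"] by simp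
qed

lemma abelian_group_coinv: "abelian_group Bm"
proof (rule abelian_groupI)
  fix x assume "x \<in> carrier Bm"
  then show "\<exists>y\<in>carrier Bm. y \<oplus>\<^bsub>Bm\<^esub> x = \<zero>\<^bsub>Bm\<^esub>"
    using coinv_minus coinv_in by (intro bexI[of _ "\<ominus>\<^bsub>A\<^esub> x"]) (auto simp: RA.l_neg)
qed (use coinv_in in \<open>auto simp: coinv_add coinv_zero RA.a_assoc, auto intro: RA.a_comm\<close>)

lemma module_coinv [mlin]: "module K Bm"
proof -
  interpret m: module K A by (rule modA)
  show ?thesis
    by (rule moduleI[OF m.R.is_cring abelian_group_coinv])
       (use coinv_in in \<open>auto simp: coinv_smult m.smult_l_distr m.smult_r_distr m.smult_assoc1\<close>)
qed

text \<open>\<open>Bm\<close> is the record \<open>A\<close> with a smaller carrier, so passing to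
  the coinvariants in the domain or the codomain is a matter of membership.\<close>

lemma linear_map_restrict_coinv: "linear_map K A P f \<Longrightarrow> linear_map K Bm P f"
  using coinv_in unfolding linear_map_def by (auto simp: Pi_iff)

lemma linear_map_into_coinv:
  "\<lbrakk>linear_map K X A f; \<And>x. x \<in> carrier X \<Longrightarrow> f x \<in> B\<rbrakk> \<Longrightarrow> linear_map K X Bm f"
  unfolding linear_map_def by (auto simp: Pi_iff)

lemma bilin_coinv_mult: "bilin K Bm A A (monoid.mult A)"
proof (rule bilinI)
  fix n assume [mlin]: "n \<in> carrier A"
  show "linear_map K Bm A (\<lambda>m. m \<cdot> n)" by (rule linear_map_restrict_coinv) (assumption | rule mlin)+
next
  fix m assume "m \<in> carrier Bm"
  then have [mlin]: "m \<in> carrier A" using coinv_in by simp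
  show "linear_map K A A ((\<cdot>) m)" by (assumption | rule mlin)+
qed

lemma lin_coinv_mult:
  assumes b: "b \<in> B" and f: "linear_map K X Bm f"
  shows "linear_map K X Bm (\<lambda>x. b \<cdot> f x)"
proof -
  have "linear_map K Bm Bm (\<lambda>x. b \<cdot> x)"
    using linear_map_restrict_coinv[of A "\<lambda>x. b \<cdot> x"] assoc_algebra.mult_lin_left[OF algebra_A coinv_in[OF b] linear_map_id]
    by (intro linear_map_into_coinv) (auto intro: coinv_mult[OF b])
  then show ?thesis using f by (rule linear_map_comp)
qed

end

section \<open>The colinear lift, the section and its extension to
  \<open>A \<otimes> H\<close>\<close>

context cosep_setup
begin

text \<open>Coinvariance at 1 spreads to every \<open>c\<close>: in
  \<open>\<rho> (tr a) \<rho> c\<close> the first factor is \<open>tr a\<close> times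
  \<open>\<rho> 1\<close>, and \<open>\<rho> c\<close> absorbs \<open>\<rho> 1\<close>.\<close>

lemma tr_in: assumes a[mlin]: "a \<in> carrier A" shows "tr a \<in> B"
  unfolding coinv_iff
proof (intro conjI ballI)
  show "tr a \<in> carrier A" by (assumption | rule mlin)+
  fix c assume c[mlin]: "c \<in> carrier A"
  have "\<rho> (tr a \<cdot> c) = sw AH (\<rho> (tr a \<cdot> c)) (kpure K A H)"
    by (rule sw_pure_id[symmetric]) (assumption | rule mlin)+
  also have "\<dots> = sw AH (\<rho> (tr a)) (\<lambda>x y. sw AH (\<rho> c) (\<lambda>u v. kpure K A H (x \<cdot> u) (y \<bullet> v)))"
    by (rule rho_mult) (assumption | rule mlin)+
  also have "\<dots> = sw AH (\<rho> 1A) (\<lambda>x y. sw AH (\<rho> c) (\<lambda>u v. kpure K A H (tr a \<cdot> x \<cdot> u) (y \<bullet> v)))"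
    by (rule sw_rho_tr_one) (assumption | rule mlin)+
  also have "\<dots> = sw AH (\<rho> 1A) (\<lambda>x y. sw AH (\<rho> c) (\<lambda>u v. kpure K A H (tr a \<cdot> (x \<cdot> u)) (y \<bullet> v)))"
    by (assumption | rule sw_congs mlin | subst RA.m_assoc | rule refl)+
  also have "\<dots> = sw AH (\<rho> c) (\<lambda>x y. kpure K A H (tr a \<cdot> x) y)"
    by (rule rho_one_left[where f = "\<lambda>x y. kpure K A H (tr a \<cdot> x) y"]) (assumption | rule mlin)+
  finally show "\<rho> (tr a \<cdot> c) = sw AH (\<rho> c) (\<lambda>x y. kpure K A H (tr a \<cdot> x) y)" .
qed

lemma lin_tr_coinv [mlin]: "linear_map K X A f \<Longrightarrow> linear_map K X Bm (\<lambda>x. tr (f x))"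
  by (rule linear_map_into_coinv[OF linear_map_comp[OF lin_tr]]) (auto intro: tr_in linear_map_closed)

lemma tr_in_Bm [mlin]: "a \<in> carrier A \<Longrightarrow> tr a \<in> carrier Bm"
  using tr_in by simp

lemma tr_coinv_mult:
  assumes b: "b \<in> B" and [mlin]: "a \<in> carrier A"
  shows "tr (b \<cdot> a) = b \<cdot> tr a"
proof -
  note [mlin] = coinv_in[OF b]
  have "tr (b \<cdot> a) = sw A (\<rho> a) (\<lambda>x h. \<epsilon> (\<psi> h) *A (b \<cdot> x))"
    unfolding tr_def by (rule sw_rho_coinv[OF b]) (assumption | rule mlin)+
  also have "\<dots> = b \<cdot> tr a"
    by (rule linear_tr[symmetric]) (assumption | rule mlin)+
  finally show ?thesis .
qed

text \<open>The coseparability form \<open>\<epsilon> \<circ> rr\<close> averages \<open>\<tau>\<^sub>0\<close> to a right colinear map.\<close>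

definition \<tau> where
  "\<tau> h = sw AA (\<Delta> h) (\<lambda>p q. sw AA (\<tau>\<^sub>0 p) (\<lambda>x y. sw AA (\<rho> y) (\<lambda>u g. \<epsilon> (rr g q) \<odot>\<^bsub>AA\<^esub> kpure K A A x u)))"

lemma lin_tau: "linear_map K H AA \<tau>" unfolding \<tau>_def by (assumption | rule mlin)+

lemmas [mlin] = linear_map_comp[OF lin_tau] linear_map_closed[OF lin_tau]

lemma tau_cong: "\<lbrakk>h \<in> carrier H; \<And>x y. \<lbrakk>x \<in> carrier A; y \<in> carrier A\<rbrakk> \<Longrightarrow> f x y = g x y\<rbrakk>
    \<Longrightarrow> sw P (\<tau> h) f = sw P (\<tau> h) g"
  by (rule sw_cong) (assumption | rule mlin)+

lemma tau0_cong: "\<lbrakk>h \<in> carrier H; \<And>x y. \<lbrakk>x \<in> carrier A; y \<in> carrier A\<rbrakk> \<Longrightarrow> f x y = g x y\<rbrakk>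
    \<Longrightarrow> sw P (\<tau>\<^sub>0 h) f = sw P (\<tau>\<^sub>0 h) g"
  by (rule sw_cong) (assumption | rule mlin)+

lemmas sw_congs = Delta_cong rho_cong tau_cong tau0_cong

lemma sw_tau:
  assumes [mlin]: "module K P" and f: "bilin K A A P f" and [mlin]: "h \<in> carrier H"
  shows "sw P (\<tau> h) f =
    sw P (\<Delta> h) (\<lambda>p q. sw P (\<tau>\<^sub>0 p) (\<lambda>x y. sw P (\<rho> y) (\<lambda>u g. \<epsilon> (rr g q) \<odot>\<^bsub>P\<^esub> f x u)))"
proof -
  note [mlin] = f bilin_left[OF f] bilin_right[OF f] bilin_closed[OF f]
  let ?g = "\<lambda>s. sw P s f"
  have g: "linear_map K AA P ?g" by (assumption | rule mlin)+
  have "sw P (\<tau> h) f = sw P (\<Delta> h) (\<lambda>p q. ?g (sw AA (\<tau>\<^sub>0 p) (\<lambda>x y. sw AA (\<rho> y) (\<lambda>u g. \<epsilon> (rr g q) \<odot>\<^bsub>AA\<^esub> kpure K A A x u))))"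
    unfolding \<tau>_def by (rule linear_sw[where g = ?g and M = H and N = H]) (assumption | rule mlin)+
  also have "\<dots> = sw P (\<Delta> h) (\<lambda>p q. sw P (\<tau>\<^sub>0 p) (\<lambda>x y. ?g (sw AA (\<rho> y) (\<lambda>u g. \<epsilon> (rr g q) \<odot>\<^bsub>AA\<^esub> kpure K A A x u))))"
    by (assumption | rule linear_sw[where g = ?g and M = A and N = A] sw_congs mlin)+
  also have "\<dots> = sw P (\<Delta> h) (\<lambda>p q. sw P (\<tau>\<^sub>0 p) (\<lambda>x y. sw P (\<rho> y) (\<lambda>u g. ?g (\<epsilon> (rr g q) \<odot>\<^bsub>AA\<^esub> kpure K A A x u))))"
    by (assumption | rule linear_sw[where g = ?g and M = A and N = H] sw_congs mlin)+
  also have "\<dots> = sw P (\<Delta> h) (\<lambda>p q. sw P (\<tau>\<^sub>0 p) (\<lambda>x y. sw P (\<rho> y) (\<lambda>u g. \<epsilon> (rr g q) \<odot>\<^bsub>P\<^esub> f x u)))"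
    by (rule Delta_cong, (assumption | rule mlin)+, rule tau0_cong, (assumption | rule mlin)+, rule rho_cong, (assumption | rule mlin)+, subst linear_map_smult[OF g], (assumption | rule mlin)+,
        subst sw_kpure[where P = P], (assumption | rule mlin)+, rule refl)
  finally show ?thesis .
qed

text \<open>Coacting on the second leg of \<open>\<tau> h\<close> creates a further leg of
  \<open>y\<close> next to the form, and \<open>rr_expand_left\<close> merges the two into
  \<open>rr\<close>. Both the colinearity of \<open>\<tau>\<close> and its image under the canonical
  map are read off from the resulting expression.\<close>

lemma sw_tau_coaction:
  assumes [mlin]: "module K P" and f: "trilin K A A H P f" and [mlin]: "h \<in> carrier H"
  shows "sw P (\<tau> h) (\<lambda>x y. sw P (\<rho> y) (f x)) =
    sw P (\<Delta> h) (\<lambda>p q. sw P (\<tau>\<^sub>0 p) (\<lambda>x y. sw P (\<rho> y) (\<lambda>u g. f x u (rr g q))))"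
proof -
  note [mlin] = trilin_1[OF f] trilin_2[OF f] trilin_3[OF f] trilin_closed[OF f]
  have "sw P (\<tau> h) (\<lambda>x y. sw P (\<rho> y) (f x)) =
    sw P (\<Delta> h) (\<lambda>p q. sw P (\<tau>\<^sub>0 p) (\<lambda>x y. sw P (\<rho> y) (\<lambda>u g. \<epsilon> (rr g q) \<odot>\<^bsub>P\<^esub> sw P (\<rho> u) (f x))))"
    by (rule sw_tau) (assumption | rule mlin)+
  also have "\<dots> = sw P (\<Delta> h) (\<lambda>p q. sw P (\<tau>\<^sub>0 p) (\<lambda>x y. sw P (\<rho> y) (\<lambda>u g. sw P (\<rho> u) (\<lambda>u' g'. \<epsilon> (rr g q) \<odot>\<^bsub>P\<^esub> f x u' g'))))"
    by (assumption | rule linear_sw[where M = A and N = H] sw_congs mlin)+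
  also have "\<dots> = sw P (\<Delta> h) (\<lambda>p q. sw P (\<tau>\<^sub>0 p) (\<lambda>x y. sw P (\<rho> y) (\<lambda>u g. sw P (\<Delta> g) (\<lambda>g1 g2. \<epsilon> (rr g2 q) \<odot>\<^bsub>P\<^esub> f x u g1))))"
    by (assumption | rule rho_coassoc[where f = "\<lambda>u g1 g2. \<epsilon> (rr g2 _) \<odot>\<^bsub>P\<^esub> f _ u g1"] sw_congs mlin)+
  also have "\<dots> = sw P (\<Delta> h) (\<lambda>p q. sw P (\<tau>\<^sub>0 p) (\<lambda>x y. sw P (\<rho> y) (\<lambda>u g. f x u (rr g q))))"
    by (assumption | rule rr_expand_left sw_congs mlin)+
  finally show ?thesis .
qed

text \<open>The right-hand side reduces to the same expression as in \<open>sw_tau_coaction\<close>: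
  coassociativity splits the second leg of \<open>h\<close>, and \<open>rr_expand_right\<close>
  reassembles it.\<close>

lemma tau_colinear:
  assumes [mlin]: "module K P" and f: "trilin K A A H P f" and [mlin]: "h \<in> carrier H"
  shows "sw P (\<tau> h) (\<lambda>x y. sw P (\<rho> y) (f x)) = sw P (\<Delta> h) (\<lambda>p q. sw P (\<tau> p) (\<lambda>x y. f x y q))"
proof -
  note [mlin] = trilin_1[OF f] trilin_2[OF f] trilin_3[OF f] trilin_closed[OF f]
  have "sw P (\<Delta> h) (\<lambda>p q. sw P (\<tau> p) (\<lambda>x y. f x y q)) =
    sw P (\<Delta> h) (\<lambda>p q. sw P (\<Delta> p) (\<lambda>p1 p2. sw P (\<tau>\<^sub>0 p1) (\<lambda>x y. sw P (\<rho> y) (\<lambda>u g. \<epsilon> (rr g p2) \<odot>\<^bsub>P\<^esub> f x u q))))"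
    by (assumption | rule sw_tau sw_congs mlin)+
  also have "\<dots> = sw P (\<Delta> h) (\<lambda>p q. sw P (\<Delta> q) (\<lambda>q1 q2. sw P (\<tau>\<^sub>0 p) (\<lambda>x y. sw P (\<rho> y) (\<lambda>u g. \<epsilon> (rr g q1) \<odot>\<^bsub>P\<^esub> f x u q2))))"
    by (rule Delta_coassoc[where f = "\<lambda>p1 p2 q. sw P (\<tau>\<^sub>0 p1) (\<lambda>x y. sw P (\<rho> y) (\<lambda>u g. \<epsilon> (rr g p2) \<odot>\<^bsub>P\<^esub> f x u q))"]) (assumption | rule mlin)+
  also have "\<dots> = sw P (\<Delta> h) (\<lambda>p q. sw P (\<tau>\<^sub>0 p) (\<lambda>x y. sw P (\<Delta> q) (\<lambda>q1 q2. sw P (\<rho> y) (\<lambda>u g. \<epsilon> (rr g q1) \<odot>\<^bsub>P\<^esub> f x u q2))))"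
    by (assumption | rule sw_swap sw_congs mlin)+
  also have "\<dots> = sw P (\<Delta> h) (\<lambda>p q. sw P (\<tau>\<^sub>0 p) (\<lambda>x y. sw P (\<rho> y) (\<lambda>u g. sw P (\<Delta> q) (\<lambda>q1 q2. \<epsilon> (rr g q1) \<odot>\<^bsub>P\<^esub> f x u q2))))"
    by (assumption | rule sw_swap sw_congs mlin)+
  also have "\<dots> = sw P (\<Delta> h) (\<lambda>p q. sw P (\<tau>\<^sub>0 p) (\<lambda>x y. sw P (\<rho> y) (\<lambda>u g. f x u (rr g q))))"
    by (assumption | rule rr_expand_right sw_congs mlin)+
  finally show ?thesis using sw_tau_coaction[OF assms(1) f assms(3)] by simp
qed

lemma sw_tau0_can:
  assumes [mlin]: "module K P" and f: "bilin K A H P f" and [mlin]: "h \<in> carrier H"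
  shows "sw P (\<tau>\<^sub>0 h) (\<lambda>x y. sw P (\<rho> y) (\<lambda>u g. f (x \<cdot> u) g)) = sw P (\<rho> 1A) (\<lambda>x g. f x (h \<bullet> g))"
proof -
  note [mlin] = f bilin_left[OF f] bilin_right[OF f] bilin_closed[OF f]
  let ?g = "\<lambda>s. sw P s f"
  have "?g (sw AH (\<tau>\<^sub>0 h) (\<lambda>x y. sw AH (\<rho> y) (\<lambda>u g. kpure K A H (x \<cdot> u) g))) =
    sw P (\<tau>\<^sub>0 h) (\<lambda>x y. ?g (sw AH (\<rho> y) (\<lambda>u g. kpure K A H (x \<cdot> u) g)))"
    by (rule linear_sw[where g = ?g and M = A and N = A]) (assumption | rule mlin)+
  also have "\<dots> = sw P (\<tau>\<^sub>0 h) (\<lambda>x y. sw P (\<rho> y) (\<lambda>u g. ?g (kpure K A H (x \<cdot> u) g)))"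
    by (assumption | rule linear_sw[where g = ?g and M = A and N = H] sw_congs mlin)+
  also have "\<dots> = sw P (\<tau>\<^sub>0 h) (\<lambda>x y. sw P (\<rho> y) (\<lambda>u g. f (x \<cdot> u) g))"
    by (assumption | rule sw_kpure sw_congs mlin)+
  finally have 1: "?g (sw AH (\<tau>\<^sub>0 h) (\<lambda>x y. sw AH (\<rho> y) (\<lambda>u g. kpure K A H (x \<cdot> u) g))) = \<dots>" .
  have "?g (sw AH (\<rho> 1A) (\<lambda>x g. kpure K A H x (h \<bullet> g))) = sw P (\<rho> 1A) (\<lambda>x g. ?g (kpure K A H x (h \<bullet> g)))"
    by (rule linear_sw[where g = ?g and M = A and N = H]) (assumption | rule mlin)+
  also have "\<dots> = sw P (\<rho> 1A) (\<lambda>x g. f x (h \<bullet> g))"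
    by (assumption | rule sw_kpure sw_congs mlin)+
  finally show ?thesis using 1 tau0_can[OF \<open>h \<in> carrier H\<close>] by simp
qed

text \<open>By \<open>sw_tau_coaction\<close> and \<open>sw_tau0_can\<close>, the canonical map
  sends \<open>\<tau> h\<close> to \<open>\<Sum> 1\<^sub>0 \<otimes> rr (h\<^sub>1 1\<^sub>1)
  h\<^sub>2\<close>. Coassociativity lets \<open>\<rho> b\<^sub>0\<close> absorb the factor
  \<open>\<rho> 1\<close>; what is left is \<open>rr\<close> applied to a coproduct, which the
  retraction property collapses.\<close>

lemma sw_rho_tau_can:
  assumes [mlin]: "module K P" and f: "bilin K A H P f" and [mlin]: "b \<in> carrier A"
  shows "sw P (\<rho> b) (\<lambda>c h. sw P (\<tau> h) (\<lambda>x y. sw P (\<rho> y) (\<lambda>u g. f (c \<cdot> x \<cdot> u) g))) = sw P (\<rho> b) f"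
proof -
  note [mlin] = f bilin_left[OF f] bilin_right[OF f] bilin_closed[OF f]
  have "sw P (\<rho> b) (\<lambda>c h. sw P (\<tau> h) (\<lambda>x y. sw P (\<rho> y) (\<lambda>u g. f (c \<cdot> x \<cdot> u) g))) =
    sw P (\<rho> b) (\<lambda>c h. sw P (\<Delta> h) (\<lambda>p q. sw P (\<tau>\<^sub>0 p) (\<lambda>x y. sw P (\<rho> y) (\<lambda>u g. f (c \<cdot> x \<cdot> u) (rr g q)))))"
    by (rule rho_cong, (assumption | rule mlin)+, rule sw_tau_coaction[where f = "\<lambda>x u g. f (_ \<cdot> x \<cdot> u) g"]) (assumption | rule mlin)+
  also have "\<dots> = sw P (\<rho> b) (\<lambda>c h. sw P (\<Delta> h) (\<lambda>p q. sw P (\<tau>\<^sub>0 p) (\<lambda>x y. sw P (\<rho> y) (\<lambda>u g. f (c \<cdot> (x \<cdot> u)) (rr g q)))))"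
    by (assumption | rule sw_congs mlin | subst RA.m_assoc | rule refl)+
  also have "\<dots> = sw P (\<rho> b) (\<lambda>c h. sw P (\<Delta> h) (\<lambda>p q. sw P (\<rho> 1A) (\<lambda>x g. f (c \<cdot> x) (rr (p \<bullet> g) q))))"
    by (assumption | rule sw_tau0_can[where f = "\<lambda>x g. f (_ \<cdot> x) (rr g _)"] sw_congs mlin)+
  also have "\<dots> = sw P (\<rho> b) (\<lambda>c h. sw P (\<rho> c) (\<lambda>u v. sw P (\<rho> 1A) (\<lambda>x g. f (u \<cdot> x) (rr (v \<bullet> g) h))))"
    by (rule rho_coassoc[symmetric, where f = "\<lambda>c p q. sw P (\<rho> 1A) (\<lambda>x g. f (c \<cdot> x) (rr (p \<bullet> g) q))"]) (assumption | rule mlin)+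
  also have "\<dots> = sw P (\<rho> b) (\<lambda>c h. sw P (\<rho> c) (\<lambda>u v. f u (rr v h)))"
    by (assumption | rule rho_one_right[where f = "\<lambda>u v. f u (rr v _)"] sw_congs mlin)+
  also have "\<dots> = sw P (\<rho> b) (\<lambda>c h. sw P (\<Delta> h) (\<lambda>u v. f c (rr u v)))"
    by (rule rho_coassoc[where f = "\<lambda>c u v. f c (rr u v)"]) (assumption | rule mlin)+
  also have "\<dots> = sw P (\<rho> b) (\<lambda>c h. f c (sw H (\<Delta> h) rr))"
    by (rule rho_cong, (assumption | rule mlin)+, rule linear_sw[symmetric, where M = H and N = H and P = H]) (assumption | rule mlin bilin_rr)+
  also have "\<dots> = sw P (\<rho> b) f"
    by (assumption | rule sw_congs mlin | subst rr_Delta | rule refl)+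
  finally show ?thesis .
qed

text \<open>Recovers \<open>\<Sum> z\<^sub>0 y \<otimes> z\<^sub>1\<close> from the value \<open>\<Sum> z y\<^sub>0 \<otimes> y\<^sub>1\<close> of the canonical map.\<close>

lemma sw_rho_absorb:
  assumes [mlin]: "module K P" and f: "bilin K A H P f" and [mlin]: "z \<in> carrier A" "y \<in> carrier A"
  shows "sw P (\<rho> z) (\<lambda>z0 z1. f (z0 \<cdot> y) z1) =
    sw P (\<rho> y) (\<lambda>y0 y1. sw P (\<rho> (z \<cdot> y0)) (\<lambda>u g. f u (g \<bullet> S y1)))"
proof -
  note [mlin] = f bilin_left[OF f] bilin_right[OF f] bilin_closed[OF f]
  have "sw P (\<rho> y) (\<lambda>y0 y1. sw P (\<rho> (z \<cdot> y0)) (\<lambda>u g. f u (g \<bullet> S y1))) =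
    sw P (\<rho> y) (\<lambda>y0 y1. sw P (\<rho> z) (\<lambda>z0 z1. sw P (\<rho> y0) (\<lambda>u g. f (z0 \<cdot> u) (z1 \<bullet> g \<bullet> S y1))))"
    by (assumption | rule rho_mult[where f = "\<lambda>u g. f u (g \<bullet> S _)"] sw_congs mlin)+
  also have "\<dots> = sw P (\<rho> z) (\<lambda>z0 z1. sw P (\<rho> y) (\<lambda>y0 y1. sw P (\<rho> y0) (\<lambda>u g. f (z0 \<cdot> u) (z1 \<bullet> g \<bullet> S y1))))"
    by (rule sw_swap) (assumption | rule mlin)+
  also have "\<dots> = sw P (\<rho> z) (\<lambda>z0 z1. sw P (\<rho> y) (\<lambda>y0 y1. sw P (\<Delta> y1) (\<lambda>g k. f (z0 \<cdot> y0) (z1 \<bullet> g \<bullet> S k))))"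
    by (assumption | rule rho_coassoc[where f = "\<lambda>u g k. f (_ \<cdot> u) (_ \<bullet> g \<bullet> S k)"] sw_congs mlin)+
  also have "\<dots> = sw P (\<rho> z) (\<lambda>z0 z1. sw P (\<rho> y) (\<lambda>y0 y1. sw P (\<Delta> y1) (\<lambda>g k. f (z0 \<cdot> y0) (z1 \<bullet> (g \<bullet> S k)))))"
    by (assumption | rule sw_congs mlin | subst RH.m_assoc | rule refl)+
  also have "\<dots> = sw P (\<rho> z) (\<lambda>z0 z1. sw P (\<rho> y) (\<lambda>y0 y1. f (z0 \<cdot> y0) (z1 \<bullet> PL y1)))"
    by (assumption | rule antipode[where f = "\<lambda>k. f _ (_ \<bullet> k)"] sw_congs mlin)+
  \<comment> \<open>The comodule algebra axiom trades \<open>PL y1\<close> for a factor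
    \<open>\<rho> 1\<close> to the left of \<open>y\<close>, where \<open>\<rho> z\<close> can
    absorb it.\<close>
  also have "\<dots> = sw P (\<rho> z) (\<lambda>z0 z1. sw P (\<rho> 1A) (\<lambda>x h. f (z0 \<cdot> (x \<cdot> y)) (z1 \<bullet> h)))"
    by (assumption | rule Pi_L_coaction[where f = "\<lambda>u k. f (_ \<cdot> u) (_ \<bullet> k)"] sw_congs mlin)+
  also have "\<dots> = sw P (\<rho> z) (\<lambda>z0 z1. sw P (\<rho> 1A) (\<lambda>x h. f (z0 \<cdot> x \<cdot> y) (z1 \<bullet> h)))"
    by (assumption | rule sw_congs mlin | subst RA.m_assoc | rule refl)+
  also have "\<dots> = sw P (\<rho> z) (\<lambda>z0 z1. f (z0 \<cdot> y) z1)"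
    by (rule rho_one_right[where f = "\<lambda>u k. f (u \<cdot> y) k"]) (assumption | rule mlin)+
  finally show ?thesis by simp
qed

lemma sw_rho_tau_tr:
  assumes [mlin]: "b \<in> carrier A"
  shows "sw A (\<rho> b) (\<lambda>c h. sw A (\<tau> h) (\<lambda>x y. tr (c \<cdot> x) \<cdot> y)) = b"
proof -
  have *: "tr z \<cdot> y = sw A (\<rho> y) (\<lambda>y0 y1. sw A (\<rho> (z \<cdot> y0)) (\<lambda>u g. \<epsilon> (\<psi> (g \<bullet> S y1)) *A u))"
    if [mlin]: "z \<in> carrier A" "y \<in> carrier A" for z y
  proof -
    have "tr z \<cdot> y = sw A (\<rho> z) (\<lambda>z0 z1. \<epsilon> (\<psi> z1) *A (z0 \<cdot> y))"
      by (rule linear_tr) (assumption | rule mlin)+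
    also have "\<dots> = sw A (\<rho> y) (\<lambda>y0 y1. sw A (\<rho> (z \<cdot> y0)) (\<lambda>u g. \<epsilon> (\<psi> (g \<bullet> S y1)) *A u))"
      by (rule sw_rho_absorb[where f = "\<lambda>u g. \<epsilon> (\<psi> g) *A u"]) (assumption | rule mlin)+
    finally show ?thesis .
  qed
  have "sw A (\<rho> b) (\<lambda>c h. sw A (\<tau> h) (\<lambda>x y. tr (c \<cdot> x) \<cdot> y)) =
    sw A (\<rho> b) (\<lambda>c h. sw A (\<tau> h) (\<lambda>x y. sw A (\<rho> y) (\<lambda>y0 y1. sw A (\<rho> (c \<cdot> x \<cdot> y0)) (\<lambda>u g. \<epsilon> (\<psi> (g \<bullet> S y1)) *A u))))"
    by (rule rho_cong, (assumption | rule mlin)+, rule tau_cong, (assumption | rule mlin)+, rule *) (assumption | rule mlin)+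
  \<comment> \<open>After the rewriting by \<open>*\<close> the summand depends on
    \<open>c \<cdot> x\<close> and \<open>y\<close> through the canonical map alone, so
    \<open>sw_rho_tau_can\<close> eliminates \<open>\<tau>\<close>.\<close>
  also have "\<dots> = sw A (\<rho> b) (\<lambda>c h. sw A (\<rho> c) (\<lambda>u g. \<epsilon> (\<psi> (g \<bullet> S h)) *A u))"
    by (rule sw_rho_tau_can[where f = "\<lambda>z h. sw A (\<rho> z) (\<lambda>u g. \<epsilon> (\<psi> (g \<bullet> S h)) *A u)"]) (assumption | rule mlin)+
  also have "\<dots> = sw A (\<rho> b) (\<lambda>c h. sw A (\<Delta> h) (\<lambda>g k. \<epsilon> (\<psi> (g \<bullet> S k)) *A c))"
    by (rule rho_coassoc[where f = "\<lambda>u g h. \<epsilon> (\<psi> (g \<bullet> S h)) *A u"]) (assumption | rule mlin)+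
  also have "\<dots> = sw A (\<rho> b) (\<lambda>c h. \<epsilon> (\<psi> (PL h)) *A c)"
    by (assumption | rule antipode[where f = "\<lambda>k. \<epsilon> (\<psi> k) *A _"] sw_congs mlin)+
  also have "\<dots> = sw A (\<rho> b) (\<lambda>c h. \<epsilon> (PL h) *A c)"
    by (assumption | rule sw_congs mlin | subst psi_Pi | rule refl)+
  also have "\<dots> = sw A (\<rho> 1A) (\<lambda>x h. \<epsilon> h *A (x \<cdot> b))"
    by (rule Pi_L_coaction[where f = "\<lambda>x h. \<epsilon> h *A x"]) (assumption | rule mlin)+
  also have "\<dots> = 1A \<cdot> b"
    by (rule rho_counit) (assumption | rule mlin)+
  finally show ?thesis using \<open>b \<in> carrier A\<close> by simp
qed

definition sec where "sec a = sw BA (\<rho> a) (\<lambda>c h. sw BA (\<tau> h) (\<lambda>x y. kpure K Bm A (tr (c \<cdot> x)) y))"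

lemma lin_sec: "linear_map K A BA sec" unfolding sec_def by (assumption | rule mlin)+

lemmas [mlin] = linear_map_comp[OF lin_sec] linear_map_closed[OF lin_sec]

lemma sw_sec:
  assumes [mlin]: "module K P" and f: "bilin K Bm A P f" and [mlin]: "a \<in> carrier A"
  shows "sw P (sec a) f = sw P (\<rho> a) (\<lambda>c h. sw P (\<tau> h) (\<lambda>x y. f (tr (c \<cdot> x)) y))"
proof -
  note [mlin] = f bilin_left[OF f] bilin_right[OF f] bilin_closed[OF f]
  let ?g = "\<lambda>s. sw P s f"
  have "?g (sec a) = sw P (\<rho> a) (\<lambda>c h. ?g (sw BA (\<tau> h) (\<lambda>x y. kpure K Bm A (tr (c \<cdot> x)) y)))"
    unfolding sec_def by (rule linear_sw[where g = ?g and M = A and N = H]) (assumption | rule mlin)+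
  also have "\<dots> = sw P (\<rho> a) (\<lambda>c h. sw P (\<tau> h) (\<lambda>x y. ?g (kpure K Bm A (tr (c \<cdot> x)) y)))"
    by (assumption | rule linear_sw[where g = ?g and M = A and N = A] sw_congs mlin)+
  also have "\<dots> = sw P (\<rho> a) (\<lambda>c h. sw P (\<tau> h) (\<lambda>x y. f (tr (c \<cdot> x)) y))"
    by (assumption | rule sw_kpure sw_congs mlin)+
  finally show ?thesis .
qed

lemma sec_mult:
  assumes [mlin]: "a \<in> carrier A"
  shows "sw A (sec a) (monoid.mult A) = a"
proof -
  have "sw A (sec a) (monoid.mult A) = sw A (\<rho> a) (\<lambda>c h. sw A (\<tau> h) (\<lambda>x y. tr (c \<cdot> x) \<cdot> y))"
    by (rule sw_sec) (assumption | rule bilin_coinv_mult mlin)+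
  then show ?thesis using sw_rho_tau_tr assms by simp
qed

lemma sec_coinv_linear:
  assumes b: "b \<in> B" and [mlin]: "a \<in> carrier A"
  shows "sec (b \<cdot> a) = sw BA (sec a) (\<lambda>x y. kpure K Bm A (b \<cdot> x) y)"
proof -
  note [mlin] = coinv_in[OF b] lin_coinv_mult[OF b]
  have bB: "x \<in> carrier Bm \<Longrightarrow> b \<cdot> x \<in> carrier Bm" for x using coinv_mult[OF b] by simp
  note [mlin] = bB
  have "sec (b \<cdot> a) = sw BA (\<rho> a) (\<lambda>c h. sw BA (\<tau> h) (\<lambda>x y. kpure K Bm A (tr (b \<cdot> c \<cdot> x)) y))"
    unfolding sec_def by (rule sw_rho_coinv[OF b]) (assumption | rule mlin)+
  also have "\<dots> = sw BA (\<rho> a) (\<lambda>c h. sw BA (\<tau> h) (\<lambda>x y. kpure K Bm A (b \<cdot> tr (c \<cdot> x)) y))"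
    by (rule rho_cong, (assumption | rule mlin)+, rule tau_cong, (assumption | rule mlin)+, subst RA.m_assoc, (assumption | rule mlin)+, subst tr_coinv_mult[OF b]) ((assumption | rule mlin)+, rule refl)
  also have "\<dots> = sw BA (sec a) (\<lambda>x y. kpure K Bm A (b \<cdot> x) y)"
    by (rule sw_sec[symmetric]) (assumption | rule mlin)+
  finally show ?thesis .
qed

text \<open>\<open>\<tau>\<close> is colinear in its argument, and coassociativity of
  \<open>\<rho>\<close> turns the coproduct of \<open>h\<close> into a second coaction on
  \<open>c\<close>, which is the one inside \<open>sec c\<close>.\<close>

lemma sec_colinear:
  assumes [mlin]: "module K P" and f: "trilin K Bm A H P f" and [mlin]: "a \<in> carrier A"
  shows "sw P (\<rho> a) (\<lambda>c h. sw P (sec c) (\<lambda>x y. f x y h)) = sw P (sec a) (\<lambda>x y. sw P (\<rho> y) (f x))"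
proof -
  note [mlin] = trilin_1[OF f] trilin_2[OF f] trilin_3[OF f] trilin_closed[OF f]
  have "sw P (sec a) (\<lambda>x y. sw P (\<rho> y) (f x)) =
    sw P (\<rho> a) (\<lambda>c h. sw P (\<tau> h) (\<lambda>x y. sw P (\<rho> y) (f (tr (c \<cdot> x)))))"
    by (rule sw_sec) (assumption | rule mlin)+
  also have "\<dots> = sw P (\<rho> a) (\<lambda>c h. sw P (\<Delta> h) (\<lambda>p q. sw P (\<tau> p) (\<lambda>x y. f (tr (c \<cdot> x)) y q)))"
    by (assumption | rule tau_colinear[where f = "\<lambda>x. f (tr (_ \<cdot> x))"] sw_congs mlin)+
  also have "\<dots> = sw P (\<rho> a) (\<lambda>c h. sw P (\<rho> c) (\<lambda>c p. sw P (\<tau> p) (\<lambda>x y. f (tr (c \<cdot> x)) y h)))"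
    by (rule rho_coassoc[symmetric, where f = "\<lambda>c p q. sw P (\<tau> p) (\<lambda>x y. f (tr (c \<cdot> x)) y q)"]) (assumption | rule mlin)+
  also have "\<dots> = sw P (\<rho> a) (\<lambda>c h. sw P (sec c) (\<lambda>x y. f x y h))"
    by (assumption | rule sw_sec[symmetric] sw_congs mlin)+
  finally show ?thesis by simp
qed

lemma sec_equivariant:
  assumes a[mlin]: "a \<in> carrier A"
  shows "ktensor_assoc K Bm A H (ktensor_map K BA H sec id (\<rho> a)) = ktensor_map K Bm AH id \<rho> (sec a)"
proof -
  let ?Q = "ktensor K Bm AH"
  have "ktensor_assoc K Bm A H (ktensor_map K BA H sec id (\<rho> a)) =
    sw ?Q (ktensor_map K BA H sec (\<lambda>x. x) (\<rho> a)) (\<lambda>u n. sw ?Q u (\<lambda>l m. kpure K Bm AH l (kpure K A H m n)))"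
    unfolding ktensor_assoc_def Let_def id_def ..
  also have "\<dots> = sw ?Q (\<rho> a) (\<lambda>c h. sw ?Q (sec c) (\<lambda>l m. kpure K Bm AH l (kpure K A H m h)))"
    by (rule sw_ktensor_map[where M = A and N = H]) (assumption | rule mlin)+
  also have "\<dots> = sw ?Q (sec a) (\<lambda>l m. sw ?Q (\<rho> m) (\<lambda>u g. kpure K Bm AH l (kpure K A H u g)))"
    by (rule sec_colinear) (assumption | rule mlin)+
  also have "\<dots> = sw ?Q (sec a) (\<lambda>l m. kpure K Bm AH l (\<rho> m))"
  proof (rule sw_cong[OF module_coinv modA])
    show "sec a \<in> carrier BA" by (assumption | rule mlin)+
    fix l m assume [mlin]: "l \<in> carrier Bm" "m \<in> carrier A"
    have "kpure K Bm AH l (sw AH (\<rho> m) (kpure K A H)) = sw ?Q (\<rho> m) (\<lambda>u g. kpure K Bm AH l (kpure K A H u g))"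
      by (rule linear_sw[where M = A and N = H and P = AH]) (assumption | rule mlin)+
    moreover have "sw AH (\<rho> m) (kpure K A H) = \<rho> m" by (rule sw_pure_id) (assumption | rule mlin)+
    ultimately show "sw ?Q (\<rho> m) (\<lambda>u g. kpure K Bm AH l (kpure K A H u g)) = kpure K Bm AH l (\<rho> m)" by simp
  qed
  also have "\<dots> = ktensor_map K Bm AH id \<rho> (sec a)"
    unfolding ktensor_map_def id_def ..
  finally show ?thesis .
qed

text \<open>Takes values in \<open>A \<otimes>\<^sub>k A\<close>, where it is
  \<open>K\<close>-linear and open to the calculus. Its projection to
  \<open>A \<otimes>\<^sub>B A\<close> is the left inverse of the canonical map.\<close>

definition can_inv where
  "can_inv t = sw AA t (\<lambda>a h. sw AA (\<Delta> h) (\<lambda>p q. sw AA (\<tau> q) (\<lambda>x y. sw AA (\<rho> x) (\<lambda>u g.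
     \<epsilon> (\<psi> (p \<bullet> g)) \<odot>\<^bsub>AA\<^esub> kpure K A A (a \<cdot> u) y))))"

lemma lin_can_inv: "linear_map K AH AA can_inv" unfolding can_inv_def by (assumption | rule mlin)+

text \<open>Coassociativity trades the first leg of \<open>\<Delta> h\<close> for a coaction on
  \<open>c\<close>. Multiplicativity joins it with the coaction on \<open>x\<close> to
  \<open>\<rho> (c \<cdot> x)\<close>, from which the integral forms the trace.\<close>

lemma can_inv_can:
  assumes [mlin]: "a \<in> carrier A" "b \<in> carrier A"
  shows "can_inv (sw AH (\<rho> b) (\<lambda>x h. kpure K A H (a \<cdot> x) h)) =
    sw AA (\<rho> b) (\<lambda>c h. sw AA (\<tau> h) (\<lambda>x y. kpure K A A (a \<cdot> tr (c \<cdot> x)) y))"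
proof -
  have "can_inv (sw AH (\<rho> b) (\<lambda>x h. kpure K A H (a \<cdot> x) h)) = sw AA (\<rho> b) (\<lambda>c h. can_inv (kpure K A H (a \<cdot> c) h))"
    by (rule linear_sw[where M = A and N = H, OF _ _ _ _ _ lin_can_inv]) (assumption | rule mlin)+
  also have "\<dots> = sw AA (\<rho> b) (\<lambda>c h. sw AA (\<Delta> h) (\<lambda>p q. sw AA (\<tau> q) (\<lambda>x y. sw AA (\<rho> x) (\<lambda>u g.
     \<epsilon> (\<psi> (p \<bullet> g)) \<odot>\<^bsub>AA\<^esub> kpure K A A (a \<cdot> c \<cdot> u) y))))"
    unfolding can_inv_def by (assumption | rule sw_kpure sw_congs mlin)+
  also have "\<dots> = sw AA (\<rho> b) (\<lambda>c h. sw AA (\<rho> c) (\<lambda>v p. sw AA (\<tau> h) (\<lambda>x y. sw AA (\<rho> x) (\<lambda>u g.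
     \<epsilon> (\<psi> (p \<bullet> g)) \<odot>\<^bsub>AA\<^esub> kpure K A A (a \<cdot> v \<cdot> u) y))))"
    by (rule rho_coassoc[symmetric, where f = "\<lambda>c p q. sw AA (\<tau> q) (\<lambda>x y. sw AA (\<rho> x) (\<lambda>u g.
     \<epsilon> (\<psi> (p \<bullet> g)) \<odot>\<^bsub>AA\<^esub> kpure K A A (a \<cdot> c \<cdot> u) y))"]) (assumption | rule mlin)+
  also have "\<dots> = sw AA (\<rho> b) (\<lambda>c h. sw AA (\<tau> h) (\<lambda>x y. sw AA (\<rho> c) (\<lambda>v p. sw AA (\<rho> x) (\<lambda>u g.
     \<epsilon> (\<psi> (p \<bullet> g)) \<odot>\<^bsub>AA\<^esub> kpure K A A (a \<cdot> v \<cdot> u) y))))"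
    by (assumption | rule sw_swap sw_congs mlin)+
  also have "\<dots> = sw AA (\<rho> b) (\<lambda>c h. sw AA (\<tau> h) (\<lambda>x y. sw AA (\<rho> c) (\<lambda>v p. sw AA (\<rho> x) (\<lambda>u g.
     \<epsilon> (\<psi> (p \<bullet> g)) \<odot>\<^bsub>AA\<^esub> kpure K A A (a \<cdot> (v \<cdot> u)) y))))"
    by (assumption | rule sw_congs mlin | subst RA.m_assoc | rule refl)+
  also have "\<dots> = sw AA (\<rho> b) (\<lambda>c h. sw AA (\<tau> h) (\<lambda>x y. sw AA (\<rho> (c \<cdot> x)) (\<lambda>u g.
     \<epsilon> (\<psi> g) \<odot>\<^bsub>AA\<^esub> kpure K A A (a \<cdot> u) y)))"
    by (assumption | rule rho_mult[symmetric, where f = "\<lambda>u g. \<epsilon> (\<psi> g) \<odot>\<^bsub>AA\<^esub> kpure K A A (a \<cdot> u) _"] sw_congs mlin)+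
  also have "\<dots> = sw AA (\<rho> b) (\<lambda>c h. sw AA (\<tau> h) (\<lambda>x y. kpure K A A (a \<cdot> tr (c \<cdot> x)) y))"
    by (assumption | rule linear_tr[symmetric] sw_congs mlin)+
  finally show ?thesis .
qed

end

section \<open>Projective modules\<close>

definition free_basis :: "('r, 'x) ring_scheme \<Rightarrow> 'i \<Rightarrow> 'r \<Rightarrow> 'i \<Rightarrow> 'r"
  where "free_basis R v c = (\<lambda>j. if j = v then c else \<zero>\<^bsub>R\<^esub>)"

text \<open>The action is a parameter because two kinds of coefficients occur: scalars of
  \<open>K\<close> on a \<open>K\<close>-module, and coinvariants multiplying elements of
  \<open>A\<close> from the left.\<close>

definition support_sum :: "('p, 'w) ring_scheme \<Rightarrow> ('r, 'x) ring_scheme \<Rightarrow> ('i \<Rightarrow> 'r \<Rightarrow> 'p) \<Rightarrow> ('i \<Rightarrow> 'r) \<Rightarrow> 'p"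
  where "support_sum P R act u = finsum P (\<lambda>v. act v (u v)) {v. u v \<noteq> \<zero>\<^bsub>R\<^esub>}"

lemma free_module_carrier:
  "u \<in> carrier (free_module R V) \<longleftrightarrow> (\<forall>i. u i \<in> carrier R) \<and> finite {i. u i \<noteq> \<zero>\<^bsub>R\<^esub>} \<and> {i. u i \<noteq> \<zero>\<^bsub>R\<^esub>} \<subseteq> V"
  and free_module_add: "u \<oplus>\<^bsub>free_module R V\<^esub> w = (\<lambda>i. u i \<oplus>\<^bsub>R\<^esub> w i)"
  and free_module_smult: "c \<odot>\<^bsub>free_module R V\<^esub> u = (\<lambda>i. c \<otimes>\<^bsub>R\<^esub> u i)"
  unfolding free_module_def by simp_all

context
  fixes R :: "('r, 'x) ring_scheme"
  assumes R: "abelian_group R"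
begin

interpretation R: abelian_group R by (rule R)

lemma free_basis_in: "\<lbrakk>v \<in> V; c \<in> carrier R\<rbrakk> \<Longrightarrow> free_basis R v c \<in> carrier (free_module R V)"
  by (auto simp: free_module_carrier free_basis_def intro: finite_subset[of _ "{v}"])

lemma free_zero_in: "(\<lambda>i. \<zero>\<^bsub>R\<^esub>) \<in> carrier (free_module R V)"
  by (simp add: free_module_carrier)

lemma free_add_in: "\<lbrakk>u \<in> carrier (free_module R V); w \<in> carrier (free_module R V)\<rbrakk> \<Longrightarrow>
    (\<lambda>i. u i \<oplus>\<^bsub>R\<^esub> w i) \<in> carrier (free_module R V)"
proof -
  assume a: "u \<in> carrier (free_module R V)" "w \<in> carrier (free_module R V)"
  then have "{i. u i \<oplus>\<^bsub>R\<^esub> w i \<noteq> \<zero>\<^bsub>R\<^esub>} \<subseteq> {i. u i \<noteq> \<zero>\<^bsub>R\<^esub>} \<union> {i. w i \<noteq> \<zero>\<^bsub>R\<^esub>}"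
    by (auto simp: free_module_carrier)
  then show ?thesis using a unfolding free_module_carrier
    by (auto intro: finite_subset)
qed

lemma free_module_induct:
  assumes u: "u \<in> carrier (free_module R V)"
    and z: "Q (\<lambda>i. \<zero>\<^bsub>R\<^esub>)" and b: "\<And>v c. \<lbrakk>v \<in> V; c \<in> carrier R\<rbrakk> \<Longrightarrow> Q (free_basis R v c)"
    and a: "\<And>u w. \<lbrakk>u \<in> carrier (free_module R V); w \<in> carrier (free_module R V); Q u; Q w\<rbrakk> \<Longrightarrow>
      Q (\<lambda>i. u i \<oplus>\<^bsub>R\<^esub> w i)"
  shows "Q u"
proof -
  have "Q u" if "finite X" "u \<in> carrier (free_module R V)" "{i. u i \<noteq> \<zero>\<^bsub>R\<^esub>} \<subseteq> X" "X \<subseteq> V" for X u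
    using that
  proof (induction X arbitrary: u rule: finite_induct)
    case empty
    then have "u = (\<lambda>i. \<zero>\<^bsub>R\<^esub>)" by auto
    then show ?case using z by simp
  next
    case (insert v X)
    let ?w = "u(v := \<zero>\<^bsub>R\<^esub>)"
    have uc: "u i \<in> carrier R" for i using insert.prems by (simp add: free_module_carrier)
    have s: "{i. ?w i \<noteq> \<zero>\<^bsub>R\<^esub>} \<subseteq> {i. u i \<noteq> \<zero>\<^bsub>R\<^esub>}" by auto
    have w: "?w \<in> carrier (free_module R V)"
      using insert.prems s unfolding free_module_carrier by (auto intro: finite_subset)
    have "Q ?w" using insert.prems s by (intro insert.IH[OF w]) auto
    moreover have "Q (free_basis R v (u v))" using insert.prems uc by (intro b) auto
    ultimately have "Q (\<lambda>i. ?w i \<oplus>\<^bsub>R\<^esub> free_basis R v (u v) i)"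
      using insert.prems by (intro a[OF w free_basis_in[OF _ uc]]) auto
    moreover have "(\<lambda>i. ?w i \<oplus>\<^bsub>R\<^esub> free_basis R v (u v) i) = u"
      using uc by (auto simp: free_basis_def)
    ultimately show ?case by simp
  qed
  from this[of "{i. u i \<noteq> \<zero>\<^bsub>R\<^esub>}" u] show ?thesis using u by (auto simp: free_module_carrier)
qed

context
  fixes P :: "('p, 'w) ring_scheme" and V :: "'i set" and act :: "'i \<Rightarrow> 'r \<Rightarrow> 'p"
  assumes P: "abelian_group P"
    and act: "\<And>v c. \<lbrakk>v \<in> V; c \<in> carrier R\<rbrakk> \<Longrightarrow> act v c \<in> carrier P"
    and act_add: "\<And>v c d. \<lbrakk>v \<in> V; c \<in> carrier R; d \<in> carrier R\<rbrakk> \<Longrightarrow> act v (c \<oplus>\<^bsub>R\<^esub> d) = act v c \<oplus>\<^bsub>P\<^esub> act v d"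
begin

interpretation P: abelian_group P by (rule P)

lemma act_zero: "v \<in> V \<Longrightarrow> act v \<zero>\<^bsub>R\<^esub> = \<zero>\<^bsub>P\<^esub>"
  using act_add[of v "\<zero>\<^bsub>R\<^esub>" "\<zero>\<^bsub>R\<^esub>"] act[of v "\<zero>\<^bsub>R\<^esub>"]
  by (metis R.zero_closed R.l_zero P.add.l_cancel_one')

lemma support_sum_superset:
  assumes "u \<in> carrier (free_module R V)" "finite X" "{i. u i \<noteq> \<zero>\<^bsub>R\<^esub>} \<subseteq> X" "X \<subseteq> V"
  shows "support_sum P R act u = finsum P (\<lambda>v. act v (u v)) X"
  unfolding support_sum_def
proof (rule P.add.finprod_mono_neutral_cong_left)
  show "\<And>i. i \<in> X - {v. u v \<noteq> \<zero>\<^bsub>R\<^esub>} \<Longrightarrow> act i (u i) = \<zero>\<^bsub>P\<^esub>" using assms act_zero by auto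
  show "(\<lambda>v. act v (u v)) \<in> X \<rightarrow> carrier P" using assms act by (auto simp: free_module_carrier)
qed (use assms in auto)

lemma support_sum_closed: "u \<in> carrier (free_module R V) \<Longrightarrow> support_sum P R act u \<in> carrier P"
  unfolding support_sum_def by (intro P.finsum_closed) (auto simp: free_module_carrier intro!: act)

lemma support_sum_add:
  assumes u: "u \<in> carrier (free_module R V)" and w: "w \<in> carrier (free_module R V)"
  shows "support_sum P R act (\<lambda>i. u i \<oplus>\<^bsub>R\<^esub> w i) = support_sum P R act u \<oplus>\<^bsub>P\<^esub> support_sum P R act w"
proof -
  let ?X = "{i. u i \<noteq> \<zero>\<^bsub>R\<^esub>} \<union> {i. w i \<noteq> \<zero>\<^bsub>R\<^esub>}"
  have c: "u i \<in> carrier R" "w i \<in> carrier R" for i using u w by (auto simp: free_module_carrier)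
  have X: "finite ?X" "?X \<subseteq> V" using u w by (auto simp: free_module_carrier)
  have "support_sum P R act (\<lambda>i. u i \<oplus>\<^bsub>R\<^esub> w i) = finsum P (\<lambda>v. act v (u v \<oplus>\<^bsub>R\<^esub> w v)) ?X"
    using X by (intro support_sum_superset free_add_in u w) auto
  also have "\<dots> = finsum P (\<lambda>v. act v (u v) \<oplus>\<^bsub>P\<^esub> act v (w v)) ?X"
    by (rule finsum_cong_unrestricted) (use X c act_add in auto)
  also have "\<dots> = finsum P (\<lambda>v. act v (u v)) ?X \<oplus>\<^bsub>P\<^esub> finsum P (\<lambda>v. act v (w v)) ?X"
    using X c act by (intro P.finsum_addf) auto
  also have "finsum P (\<lambda>v. act v (u v)) ?X = support_sum P R act u"
    using X by (intro support_sum_superset[symmetric] u) auto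
  also have "finsum P (\<lambda>v. act v (w v)) ?X = support_sum P R act w"
    using X by (intro support_sum_superset[symmetric] w) auto
  finally show ?thesis .
qed

lemma support_sum_zero: "support_sum P R act (\<lambda>i. \<zero>\<^bsub>R\<^esub>) = \<zero>\<^bsub>P\<^esub>"
  unfolding support_sum_def by simp

lemma support_sum_basis:
  assumes "v \<in> V" "c \<in> carrier R"
  shows "support_sum P R act (free_basis R v c) = act v c"
proof -
  have "support_sum P R act (free_basis R v c) = finsum P (\<lambda>w. act w (free_basis R v c w)) {v}"
    using assms by (intro support_sum_superset free_basis_in) (auto simp: free_basis_def)
  also have "\<dots> = act v c"
    using assms act[of v c] P.finsum_insert[of "{}" v "\<lambda>w. act w (free_basis R v c w)"]
    by (simp add: free_basis_def)
  finally show ?thesis .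
qed

end

end

lemma linear_map_zero:
  assumes "abelian_group M" "abelian_group N" "linear_map R M N f"
  shows "f \<zero>\<^bsub>M\<^esub> = \<zero>\<^bsub>N\<^esub>"
proof -
  interpret M: abelian_group M by fact
  interpret N: abelian_group N by fact
  show ?thesis
    using linear_map_add[OF assms(3), of "\<zero>\<^bsub>M\<^esub>" "\<zero>\<^bsub>M\<^esub>"] linear_map_closed[OF assms(3), of "\<zero>\<^bsub>M\<^esub>"]
    by (metis M.zero_closed M.l_zero N.add.l_cancel_one')
qed

lemma linear_map_from_free_eqI:
  assumes P: "module K P" and f: "linear_map K (free_module K V) P f" and g: "linear_map K (free_module K V) P g"
    and eq: "\<And>v. v \<in> V \<Longrightarrow> f (free_basis K v \<one>\<^bsub>K\<^esub>) = g (free_basis K v \<one>\<^bsub>K\<^esub>)"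
    and u: "u \<in> carrier (free_module K V)"
  shows "f u = g u"
proof -
  interpret P: module K P by fact
  have K: "abelian_group K" by (rule P.R.abelian_group_axioms)
  \<comment> \<open>The zero function is written as 0 times itself, so that compatibility with
    scalars yields the value there.\<close>
  have z: "h (\<lambda>i. \<zero>\<^bsub>K\<^esub>) = \<zero>\<^bsub>P\<^esub>" if "linear_map K (free_module K V) P h" for h
  proof -
    have "(\<lambda>i. \<zero>\<^bsub>K\<^esub>) = \<zero>\<^bsub>K\<^esub> \<odot>\<^bsub>free_module K V\<^esub> (\<lambda>i. \<zero>\<^bsub>K\<^esub>)"
      by (simp add: free_module_smult)
    then show ?thesis
      using linear_map_smult[OF that P.R.zero_closed free_zero_in[OF K]] linear_map_closed[OF that free_zero_in[OF K]]
      by simp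
  qed
  show ?thesis
  proof (rule free_module_induct[OF K u])
    show "f (\<lambda>i. \<zero>\<^bsub>K\<^esub>) = g (\<lambda>i. \<zero>\<^bsub>K\<^esub>)" using z[OF f] z[OF g] by simp
    fix v c assume v: "v \<in> V" and c: "c \<in> carrier K"
    have e: "free_basis K v c = c \<odot>\<^bsub>free_module K V\<^esub> free_basis K v \<one>\<^bsub>K\<^esub>"
      using c by (auto simp: free_module_smult free_basis_def)
    show "f (free_basis K v c) = g (free_basis K v c)"
      unfolding e using linear_map_smult[OF f c free_basis_in[OF K v P.R.one_closed]]
        linear_map_smult[OF g c free_basis_in[OF K v P.R.one_closed]] eq[OF v] by simp
  next
    fix u w assume "u \<in> carrier (free_module K V)" "w \<in> carrier (free_module K V)" "f u = g u" "f w = g w"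
    then show "f (\<lambda>i. u i \<oplus>\<^bsub>K\<^esub> w i) = g (\<lambda>i. u i \<oplus>\<^bsub>K\<^esub> w i)"
      using linear_map_add[OF f, of u w] linear_map_add[OF g, of u w] by (simp add: free_module_add)
  qed
qed

lemma linear_support_sum:
  assumes P: "module K P" and t: "\<And>v. v \<in> V \<Longrightarrow> t v \<in> carrier P"
  shows "linear_map K (free_module K V) P (support_sum P K (\<lambda>v c. c \<odot>\<^bsub>P\<^esub> t v))"
proof -
  interpret P: module K P by fact
  have K: "abelian_group K" by (rule P.R.abelian_group_axioms)
  note s = support_sum_closed[OF K P.abelian_group_axioms, of V "\<lambda>v c. c \<odot>\<^bsub>P\<^esub> t v"]
    support_sum_add[OF K P.abelian_group_axioms, of V "\<lambda>v c. c \<odot>\<^bsub>P\<^esub> t v"]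
    support_sum_basis[OF K P.abelian_group_axioms, of V "\<lambda>v c. c \<odot>\<^bsub>P\<^esub> t v"]
    support_sum_zero[OF K P.abelian_group_axioms, of V "\<lambda>v c. c \<odot>\<^bsub>P\<^esub> t v"]
  show ?thesis
  proof (rule linear_mapI)
    fix c u assume c: "c \<in> carrier K" and u: "u \<in> carrier (free_module K V)"
    have su: "(\<lambda>i. c \<otimes>\<^bsub>K\<^esub> w i) \<in> carrier (free_module K V)" if "w \<in> carrier (free_module K V)" for w
    proof -
      have "{i. c \<otimes>\<^bsub>K\<^esub> w i \<noteq> \<zero>\<^bsub>K\<^esub>} \<subseteq> {i. w i \<noteq> \<zero>\<^bsub>K\<^esub>}" using c by auto
      then show ?thesis using that c unfolding free_module_carrier by (auto intro: finite_subset)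
    qed
    show "support_sum P K (\<lambda>v c. c \<odot>\<^bsub>P\<^esub> t v) (c \<odot>\<^bsub>free_module K V\<^esub> u) = c \<odot>\<^bsub>P\<^esub> support_sum P K (\<lambda>v c. c \<odot>\<^bsub>P\<^esub> t v) u"
      unfolding free_module_smult
    proof (rule free_module_induct[OF K u])
      show "support_sum P K (\<lambda>v c. c \<odot>\<^bsub>P\<^esub> t v) (\<lambda>i. c \<otimes>\<^bsub>K\<^esub> \<zero>\<^bsub>K\<^esub>) = c \<odot>\<^bsub>P\<^esub> support_sum P K (\<lambda>v c. c \<odot>\<^bsub>P\<^esub> t v) (\<lambda>i. \<zero>\<^bsub>K\<^esub>)"
        using c s(4) t by (simp add: P.smult_l_distr P.smult_r_null)
    next
      fix v d assume vd: "v \<in> V" "d \<in> carrier K"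
      have "(\<lambda>i. c \<otimes>\<^bsub>K\<^esub> free_basis K v d i) = free_basis K v (c \<otimes>\<^bsub>K\<^esub> d)"
        using c by (auto simp: free_basis_def)
      then show "support_sum P K (\<lambda>v c. c \<odot>\<^bsub>P\<^esub> t v) (\<lambda>i. c \<otimes>\<^bsub>K\<^esub> free_basis K v d i) =
          c \<odot>\<^bsub>P\<^esub> support_sum P K (\<lambda>v c. c \<odot>\<^bsub>P\<^esub> t v) (free_basis K v d)"
        using s(3)[of v "c \<otimes>\<^bsub>K\<^esub> d"] s(3)[of v d] c vd t by (simp add: P.smult_l_distr P.smult_assoc1)
    next
      fix u w assume uw: "u \<in> carrier (free_module K V)" "w \<in> carrier (free_module K V)"
        and "support_sum P K (\<lambda>v c. c \<odot>\<^bsub>P\<^esub> t v) (\<lambda>i. c \<otimes>\<^bsub>K\<^esub> u i) = c \<odot>\<^bsub>P\<^esub> support_sum P K (\<lambda>v c. c \<odot>\<^bsub>P\<^esub> t v) u"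
          "support_sum P K (\<lambda>v c. c \<odot>\<^bsub>P\<^esub> t v) (\<lambda>i. c \<otimes>\<^bsub>K\<^esub> w i) = c \<odot>\<^bsub>P\<^esub> support_sum P K (\<lambda>v c. c \<odot>\<^bsub>P\<^esub> t v) w"
      moreover have "(\<lambda>i. c \<otimes>\<^bsub>K\<^esub> (u i \<oplus>\<^bsub>K\<^esub> w i)) = (\<lambda>i. c \<otimes>\<^bsub>K\<^esub> u i \<oplus>\<^bsub>K\<^esub> c \<otimes>\<^bsub>K\<^esub> w i)"
        using uw c by (auto simp: free_module_carrier P.R.r_distr)
      ultimately show "support_sum P K (\<lambda>v c. c \<odot>\<^bsub>P\<^esub> t v) (\<lambda>i. c \<otimes>\<^bsub>K\<^esub> (u i \<oplus>\<^bsub>K\<^esub> w i)) =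
          c \<odot>\<^bsub>P\<^esub> support_sum P K (\<lambda>v c. c \<odot>\<^bsub>P\<^esub> t v) (\<lambda>i. u i \<oplus>\<^bsub>K\<^esub> w i)"
        using s(1)[of u] s(1)[of w] s(2)[of u w] s(2)[of "\<lambda>i. c \<otimes>\<^bsub>K\<^esub> u i" "\<lambda>i. c \<otimes>\<^bsub>K\<^esub> w i"] su c t
        by (simp add: P.smult_l_distr P.smult_r_distr)
    qed
  next
    fix u w assume "u \<in> carrier (free_module K V)" "w \<in> carrier (free_module K V)"
    then show "support_sum P K (\<lambda>v c. c \<odot>\<^bsub>P\<^esub> t v) (u \<oplus>\<^bsub>free_module K V\<^esub> w) =
        support_sum P K (\<lambda>v c. c \<odot>\<^bsub>P\<^esub> t v) u \<oplus>\<^bsub>P\<^esub> support_sum P K (\<lambda>v c. c \<odot>\<^bsub>P\<^esub> t v) w"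
      using s(2)[of u w] t by (simp add: P.smult_l_distr free_module_add)
  qed (use s(1) t in \<open>simp add: P.smult_l_distr\<close>)
qed

text \<open>Basis elements are sent to chosen preimages, and the resulting map is composed with the
  splitting \<open>i\<close>. Assumption \<open>sub\<close> asks for the image of \<open>f\<close>
  only, which suits the canonical map: it reaches \<open>\<EE>\<close>, which may be smaller than
  \<open>A \<otimes> H\<close>.\<close>

lemma projective_module_lift:
  fixes M :: "('k, 'm, 'y) module_scheme"
  assumes M: "projective_module K M" and N: "module K N" and Q: "module K Q"
    and g: "linear_map K N Q g" and f: "linear_map K M Q f"
    and sub: "\<And>m. m \<in> carrier M \<Longrightarrow> f m \<in> g ` carrier N"
  obtains h where "linear_map K M N h" "\<And>m. m \<in> carrier M \<Longrightarrow> g (h m) = f m"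
proof -
  obtain V :: "'m set" and i p where i: "linear_map K M (free_module K V) i" and p: "linear_map K (free_module K V) M p"
    and pi: "\<And>m. m \<in> carrier M \<Longrightarrow> p (i m) = m"
    using M unfolding projective_module_def by blast
  interpret N: module K N by fact
  interpret Q: module K Q by fact
  have K: "abelian_group K" by (rule N.R.abelian_group_axioms)
  define e where "e v = free_basis K v \<one>\<^bsub>K\<^esub>" for v :: 'm
  have e: "v \<in> V \<Longrightarrow> e v \<in> carrier (free_module K V)" for v
    unfolding e_def by (rule free_basis_in[OF K]) simp_all
  have "\<exists>t. \<forall>v\<in>V. t v \<in> carrier N \<and> g (t v) = f (p (e v))"
    by (rule bchoice) (use sub linear_map_closed[OF p e] in force)
  then obtain t where t: "\<And>v. v \<in> V \<Longrightarrow> t v \<in> carrier N" "\<And>v. v \<in> V \<Longrightarrow> g (t v) = f (p (e v))"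
    by blast
  let ?F = "support_sum N K (\<lambda>v c. c \<odot>\<^bsub>N\<^esub> t v)"
  have F: "linear_map K (free_module K V) N ?F" by (rule linear_support_sum[OF N t(1)])
  have "g (?F u) = f (p u)" if "u \<in> carrier (free_module K V)" for u
  proof (rule linear_map_from_free_eqI[OF Q linear_map_comp[OF g F] linear_map_comp[OF f p] _ that])
    fix v assume v: "v \<in> V"
    have "?F (free_basis K v \<one>\<^bsub>K\<^esub>) = t v"
      using support_sum_basis[OF K N.abelian_group_axioms, of V "\<lambda>v c. c \<odot>\<^bsub>N\<^esub> t v" v "\<one>\<^bsub>K\<^esub>"] t(1) v
      by (simp add: N.smult_l_distr)
    then show "g (?F (free_basis K v \<one>\<^bsub>K\<^esub>)) = f (p (free_basis K v \<one>\<^bsub>K\<^esub>))"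
      using t(2)[OF v] by (simp add: e_def)
  qed
  then show thesis
    using pi linear_map_closed[OF i] by (intro that[OF linear_map_comp[OF F i]]) simp
qed

section \<open>Projectivity of \<open>A\<close> over the coinvariants\<close>

context cosep_setup
begin

lemma regular_A:
  "carrier (regular_module A) = carrier A" "x \<oplus>\<^bsub>regular_module A\<^esub> y = x \<oplus>\<^bsub>A\<^esub> y"
  "x \<odot>\<^bsub>regular_module A\<^esub> y = x \<cdot> y"
  by (simp_all add: regular_module_def)

text \<open>\<open>J\<close> maps \<open>B \<otimes> A\<close> into the free \<open>B\<close>-module
  on \<open>V\<close>, and \<open>?p\<close> maps that module to \<open>A\<close>. Their composite
  is the multiplication, which \<open>sec\<close> splits \<open>B\<close>-linearly, so
  \<open>J \<circ> sec\<close> and \<open>?p\<close> exhibit \<open>A\<close> as a summand.\<close>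

lemma projective_over_coinvariants:
  assumes "projective_module K A"
  shows "projective_module Bm (regular_module A)"
proof -
  obtain V :: "'a set" and i p where i: "linear_map K A (free_module K V) i" and p: "linear_map K (free_module K V) A p"
    and pi: "\<And>m. m \<in> carrier A \<Longrightarrow> p (i m) = m"
    using assms unfolding projective_module_def by blast
  interpret m: module K A by (rule modA)
  have K: "abelian_group K" by (rule m.R.abelian_group_axioms)
  have Bg: "abelian_group Bm" by (rule abelian_group_coinv)
  define e where "e v = p (free_basis K v \<one>\<^bsub>K\<^esub>)" for v
  have e: "v \<in> V \<Longrightarrow> e v \<in> carrier A" for v
    unfolding e_def by (rule linear_map_closed[OF p free_basis_in[OF K]]) simp_all
  have i_coord: "linear_map K A KK (\<lambda>x. i x w)" for w
    using i unfolding linear_map_def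
    by (auto simp: carrier_KK free_module_carrier free_module_add free_module_smult regular_module_def Pi_iff)
  note [mlin] = linear_map_comp[OF i_coord]
  have i_in[mlin]: "x \<in> carrier A \<Longrightarrow> i x w \<in> carrier K" for x w
    using linear_map_closed[OF i_coord] by (simp add: carrier_KK)
  \<comment> \<open>This is the identity of \<open>B\<close> tensored with \<open>i\<close>, where
    \<open>B\<close> tensored with the free \<open>K\<close>-module on \<open>V\<close> is
    identified with the free \<open>B\<close>-module on \<open>V\<close>.\<close>
  define J where "J t = (\<lambda>w. sw Bm t (\<lambda>b x. i x w \<odot>\<^bsub>Bm\<^esub> b))" for t
  have bil: "bilin K Bm A Bm (\<lambda>b x. i x w \<odot>\<^bsub>Bm\<^esub> b)" for w by (assumption | rule mlin)+
  have J_lin: "linear_map K BA Bm (\<lambda>t. J t w)" for w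
    unfolding J_def by (assumption | rule bil mlin)+
  have J_pure: "J (kpure K Bm A b x) = (\<lambda>w. i x w *A b)" if "b \<in> carrier Bm" "x \<in> carrier A" for b x
    unfolding J_def by (rule ext, subst sw_kpure[OF _ _ _ bil]) (assumption | rule mlin that | simp)+
  have J_add: "J (s \<oplus>\<^bsub>BA\<^esub> t) = (\<lambda>w. J s w \<oplus>\<^bsub>Bm\<^esub> J t w)" if "s \<in> carrier BA" "t \<in> carrier BA" for s t
    using linear_map_add[OF J_lin that] by auto
  have J_zero: "J \<zero>\<^bsub>BA\<^esub> = (\<lambda>w. \<zero>\<^bsub>Bm\<^esub>)"
    using linear_map_zero[OF _ _ J_lin] module.axioms(2)[OF module_ktensor[OF module_coinv modA]] Bg by auto
  have J_in: "J t \<in> carrier (free_module Bm V)" if t: "t \<in> carrier BA" for t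
  proof (rule two_modules.ktensor_induct[OF two_modules.intro[OF module_coinv modA] t])
    show "J \<zero>\<^bsub>BA\<^esub> \<in> carrier (free_module Bm V)" unfolding J_zero by (rule free_zero_in[OF Bg])
    fix b x assume b: "b \<in> carrier Bm" and x: "x \<in> carrier A"
    have ix: "i x \<in> carrier (free_module K V)" by (rule linear_map_closed[OF i x])
    have "{w. i x w *A b \<noteq> \<zero>\<^bsub>A\<^esub>} \<subseteq> {w. i x w \<noteq> \<zero>\<^bsub>K\<^esub>}"
      using b coinv_in by auto
    then show "J (kpure K Bm A b x) \<in> carrier (free_module Bm V)"
      unfolding J_pure[OF b x] using ix i_in[OF x] b coinv_smult
      unfolding free_module_carrier by (auto intro: finite_subset)
  next
    fix s t assume "s \<in> carrier BA" "t \<in> carrier BA"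
      and "J s \<in> carrier (free_module Bm V)" "J t \<in> carrier (free_module Bm V)"
    then show "J (s \<oplus>\<^bsub>BA\<^esub> t) \<in> carrier (free_module Bm V)"
      using free_add_in[OF Bg] by (simp only: J_add)
  qed
  let ?p = "support_sum A Bm (\<lambda>v b. b \<cdot> e v)"
  have act: "\<And>v b. \<lbrakk>v \<in> V; b \<in> carrier Bm\<rbrakk> \<Longrightarrow> b \<cdot> e v \<in> carrier A"
    "\<And>v b c. \<lbrakk>v \<in> V; b \<in> carrier Bm; c \<in> carrier Bm\<rbrakk> \<Longrightarrow> (b \<oplus>\<^bsub>Bm\<^esub> c) \<cdot> e v = b \<cdot> e v \<oplus>\<^bsub>A\<^esub> c \<cdot> e v"
    using e coinv_in by (auto simp: RA.l_distr)
  note ss = Bg RA.abelian_group_axioms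
  have s1: "?p u \<in> carrier A" if "u \<in> carrier (free_module Bm V)" for u
    by (rule support_sum_closed[where V = V, OF ss]) (use that act in simp_all)
  have s2: "?p (\<lambda>i. u i \<oplus>\<^bsub>Bm\<^esub> w i) = ?p u \<oplus>\<^bsub>A\<^esub> ?p w"
    if "u \<in> carrier (free_module Bm V)" "w \<in> carrier (free_module Bm V)" for u w
    by (rule support_sum_add[where V = V, OF ss]) (use that act in simp_all)
  have s3: "?p (free_basis Bm v b) = b \<cdot> e v" if "v \<in> V" "b \<in> carrier Bm" for v b
    by (rule support_sum_basis[where V = V, OF ss]) (use that act in simp_all)
  have s4: "?p (\<lambda>i. \<zero>\<^bsub>Bm\<^esub>) = \<zero>\<^bsub>A\<^esub>"
    by (rule support_sum_zero[where V = V, OF ss]) (use act in simp_all)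
  \<comment> \<open>Applied to \<open>u = i x\<close> this gives
    \<open>?p (J (b \<otimes> x)) = b x\<close>, as \<open>p (i x) = x\<close>.\<close>
  have p_scaled: "?p (\<lambda>w. u w *A b) = b \<cdot> p u" if b: "b \<in> carrier Bm" and u: "u \<in> carrier (free_module K V)" for b u
  proof -
    have bA: "b \<in> carrier A" using b coinv_in by simp
    have fin: "(\<lambda>w. u w *A b) \<in> carrier (free_module Bm V)" if u: "u \<in> carrier (free_module K V)" for u
    proof -
      have "{w. u w *A b \<noteq> \<zero>\<^bsub>A\<^esub>} \<subseteq> {w. u w \<noteq> \<zero>\<^bsub>K\<^esub>}" using bA by auto
      then show ?thesis using u b coinv_smult unfolding free_module_carrier by (auto intro: finite_subset)
    qed
    show ?thesis
    proof (rule free_module_induct[OF K u])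
      have "p (\<lambda>i. \<zero>\<^bsub>K\<^esub>) = \<zero>\<^bsub>A\<^esub>"
        using linear_map_smult[OF p m.R.zero_closed free_zero_in[OF K]] linear_map_closed[OF p free_zero_in[OF K]]
        by (simp add: free_module_smult)
      then show "?p (\<lambda>w. \<zero>\<^bsub>K\<^esub> *A b) = b \<cdot> p (\<lambda>i. \<zero>\<^bsub>K\<^esub>)" using bA s4 by simp
    next
      fix v c assume v: "v \<in> V" and c: "c \<in> carrier K"
      have "(\<lambda>w. free_basis K v c w *A b) = free_basis Bm v (c *A b)"
        using bA by (auto simp: free_basis_def)
      then have "?p (\<lambda>w. free_basis K v c w *A b) = (c *A b) \<cdot> e v"
        using s3[OF v, of "c *A b"] coinv_smult[OF c] b by simp
      also have "\<dots> = b \<cdot> (c *A e v)"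
        using assoc_algebra.smult_mult_left[OF algebra_A c bA e[OF v]]
          assoc_algebra.smult_mult_right[OF algebra_A c bA e[OF v]] by simp
      also have "c *A e v = p (free_basis K v c)"
      proof -
        have "free_basis K v c = c \<odot>\<^bsub>free_module K V\<^esub> free_basis K v \<one>\<^bsub>K\<^esub>"
          using c by (auto simp: free_module_smult free_basis_def)
        then show ?thesis
          using linear_map_smult[OF p c free_basis_in[OF K v m.R.one_closed]] by (simp add: e_def)
      qed
      finally show "?p (\<lambda>w. free_basis K v c w *A b) = b \<cdot> p (free_basis K v c)" .
    next
      fix u w assume uw: "u \<in> carrier (free_module K V)" "w \<in> carrier (free_module K V)"
        and IH: "?p (\<lambda>i. u i *A b) = b \<cdot> p u" "?p (\<lambda>i. w i *A b) = b \<cdot> p w"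
      have "(\<lambda>i. (u i \<oplus>\<^bsub>K\<^esub> w i) *A b) = (\<lambda>i. u i *A b \<oplus>\<^bsub>A\<^esub> w i *A b)"
        using uw bA by (auto simp: free_module_carrier m.smult_l_distr)
      then show "?p (\<lambda>i. (u i \<oplus>\<^bsub>K\<^esub> w i) *A b) = b \<cdot> p (\<lambda>i. u i \<oplus>\<^bsub>K\<^esub> w i)"
        using s2[OF fin[OF uw(1)] fin[OF uw(2)]] IH linear_map_add[OF p uw] linear_map_closed[OF p] uw bA
        by (simp add: free_module_add RA.r_distr)
    qed
  qed
  have p_J: "?p (J t) = sw A t (monoid.mult A)" if t: "t \<in> carrier BA" for t
  proof (rule two_modules.kadditive_eqI[OF two_modules.intro[OF module_coinv modA] RA.abelian_group_axioms,
        where g = "\<lambda>t. ?p (J t)" and h = "\<lambda>t. sw A t (monoid.mult A)", OF _ _ _ _ _ t])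
    have lm: "linear_map K BA A (\<lambda>t. sw A t (monoid.mult A))" by (assumption | rule bilin_coinv_mult mlin)+
    show "?p (J t) \<in> carrier A" if "t \<in> carrier BA" for t using s1[OF J_in[OF that]] .
    show "?p (J (s \<oplus>\<^bsub>BA\<^esub> t)) = ?p (J s) \<oplus>\<^bsub>A\<^esub> ?p (J t)" if "s \<in> carrier BA" "t \<in> carrier BA" for s t
      unfolding J_add[OF that] by (rule s2[OF J_in[OF that(1)] J_in[OF that(2)]])
    show "sw A t (monoid.mult A) \<in> carrier A" if "t \<in> carrier BA" for t using linear_map_closed[OF lm that] .
    show "sw A (s \<oplus>\<^bsub>BA\<^esub> t) (monoid.mult A) = sw A s (monoid.mult A) \<oplus>\<^bsub>A\<^esub> sw A t (monoid.mult A)"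
      if "s \<in> carrier BA" "t \<in> carrier BA" for s t using linear_map_add[OF lm that] .
    fix b x assume bx: "b \<in> carrier Bm" "x \<in> carrier A"
    then show "?p (J (kpure K Bm A b x)) = sw A (kpure K Bm A b x) (monoid.mult A)"
      unfolding J_pure[OF bx] p_scaled[OF bx(1) linear_map_closed[OF i bx(2)]]
      by (subst sw_kpure[OF module_coinv modA modA bilin_coinv_mult]) (simp_all add: pi)
  qed
  show ?thesis
    unfolding projective_module_def
  proof (intro exI conjI ballI)
    show "linear_map Bm (regular_module A) (free_module Bm V) (\<lambda>a. J (sec a))"
    proof (rule linear_mapI; unfold regular_A)
      fix a assume "a \<in> carrier A"
      then show "J (sec a) \<in> carrier (free_module Bm V)" by (intro J_in linear_map_closed[OF lin_sec])
    next
      fix a c assume "a \<in> carrier A" "c \<in> carrier A"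
      then show "J (sec (a \<oplus>\<^bsub>A\<^esub> c)) = J (sec a) \<oplus>\<^bsub>free_module Bm V\<^esub> J (sec c)"
        using linear_map_closed[OF lin_sec] by (simp add: linear_map_add[OF lin_sec] J_add free_module_add)
    next
      fix b a assume b: "b \<in> carrier Bm" and a[mlin]: "a \<in> carrier A"
      have b': "b \<in> B" using b by simp
      note [mlin] = lin_coinv_mult[OF b']
      have bB[mlin]: "x \<in> carrier Bm \<Longrightarrow> b \<cdot> x \<in> carrier Bm" for x using coinv_mult[OF b'] by simp
      have "J (sec (b \<cdot> a)) w = b \<cdot> J (sec a) w" for w
      proof -
        have "J (sec (b \<cdot> a)) w = sw Bm (sec a) (\<lambda>x y. J (kpure K Bm A (b \<cdot> x) y) w)"
          unfolding sec_coinv_linear[OF b' a]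
          by (rule linear_sw[OF module_coinv modA _ _ _ J_lin]) (assumption | rule mlin)+
        also have "\<dots> = sw Bm (sec a) (\<lambda>x y. i y w \<odot>\<^bsub>Bm\<^esub> (b \<cdot> x))"
          by (rule sw_cong[OF module_coinv modA], (assumption | rule mlin)+, subst J_pure) (assumption | rule bB | simp)+
        also have "\<dots> = sw Bm (sec a) (\<lambda>x y. b \<cdot> (i y w \<odot>\<^bsub>Bm\<^esub> x))"
        proof (rule sw_cong[OF module_coinv modA])
          fix x y assume "x \<in> carrier Bm" "y \<in> carrier A"
          then show "i y w \<odot>\<^bsub>Bm\<^esub> (b \<cdot> x) = b \<cdot> (i y w \<odot>\<^bsub>Bm\<^esub> x)"
            using assoc_algebra.smult_mult_right[OF algebra_A i_in[of y w] coinv_in[OF b'] coinv_in, of x] by simp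
        qed (assumption | rule mlin)+
        also have "\<dots> = b \<cdot> J (sec a) w"
          unfolding J_def by (rule linear_sw[symmetric, where g = "\<lambda>x. b \<cdot> x" and M = Bm and N = A]) (assumption | rule bil mlin)+
        finally show ?thesis .
      qed
      then show "J (sec (b \<cdot> a)) = b \<odot>\<^bsub>free_module Bm V\<^esub> J (sec a)"
        by (simp add: free_module_smult fun_eq_iff)
    qed
    show "linear_map Bm (free_module Bm V) (regular_module A) ?p"
    proof (rule linear_mapI; unfold regular_A free_module_add free_module_smult)
      fix b u assume b: "b \<in> carrier Bm" and u: "u \<in> carrier (free_module Bm V)"
      have bA: "b \<in> B" "b \<in> carrier A" using b coinv_in by auto
      have bu: "(\<lambda>i. b \<cdot> w i) \<in> carrier (free_module Bm V)" if "w \<in> carrier (free_module Bm V)" for w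
      proof -
        have "{i. b \<cdot> w i \<noteq> \<zero>\<^bsub>A\<^esub>} \<subseteq> {i. w i \<noteq> \<zero>\<^bsub>A\<^esub>}" using bA by auto
        then show ?thesis using that coinv_mult[OF bA(1)] unfolding free_module_carrier by (auto intro: finite_subset)
      qed
      have "?p (\<lambda>i. b \<cdot> u i) = b \<cdot> ?p u"
      proof (rule free_module_induct[OF Bg u])
        show "?p (\<lambda>i. b \<cdot> \<zero>\<^bsub>Bm\<^esub>) = b \<cdot> ?p (\<lambda>i. \<zero>\<^bsub>Bm\<^esub>)" using bA s4 by simp
        fix v c assume v: "v \<in> V" and c: "c \<in> carrier Bm"
        have "(\<lambda>i. b \<cdot> free_basis Bm v c i) = free_basis Bm v (b \<cdot> c)"
          using bA by (auto simp: free_basis_def)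
        then show "?p (\<lambda>i. b \<cdot> free_basis Bm v c i) = b \<cdot> ?p (free_basis Bm v c)"
          using s3[OF v c] s3[OF v, of "b \<cdot> c"] coinv_mult[OF bA(1)] c coinv_in e[OF v] bA
          by (simp add: RA.m_assoc)
      next
        fix u w assume uw: "u \<in> carrier (free_module Bm V)" "w \<in> carrier (free_module Bm V)"
          and IH: "?p (\<lambda>i. b \<cdot> u i) = b \<cdot> ?p u" "?p (\<lambda>i. b \<cdot> w i) = b \<cdot> ?p w"
        have "(\<lambda>i. b \<cdot> (u i \<oplus>\<^bsub>Bm\<^esub> w i)) = (\<lambda>i. (b \<cdot> u i) \<oplus>\<^bsub>Bm\<^esub> (b \<cdot> w i))"
          using uw bA coinv_in by (auto simp: free_module_carrier RA.r_distr)
        then show "?p (\<lambda>i. b \<cdot> (u i \<oplus>\<^bsub>Bm\<^esub> w i)) = b \<cdot> ?p (\<lambda>i. u i \<oplus>\<^bsub>Bm\<^esub> w i)"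
          using s2[OF bu[OF uw(1)] bu[OF uw(2)]] s2[OF uw] IH s1[OF uw(1)] s1[OF uw(2)] bA
          by (simp only: RA.r_distr)
      qed
      then show "?p (\<lambda>i. b \<otimes>\<^bsub>Bm\<^esub> u i) = b \<cdot> ?p u" by simp
    qed (rule s1 s2; assumption)+
    fix a assume "a \<in> carrier (regular_module A)"
    then have a: "a \<in> carrier A" by (simp add: regular_A)
    show "?p (J (sec a)) = a"
      using p_J[OF linear_map_closed[OF lin_sec a]] sec_mult[OF a] by simp
  qed
qed

lemma equivariantly_projective:
  assumes "projective_module K A"
  shows "equivariantly_projective K H A \<rho>"
  unfolding equivariantly_projective_def Let_def
  using projective_over_coinvariants[OF assms] lin_sec sec_equivariant sec_mult sec_coinv_linear
  by auto

end

section \<open>The canonical map\<close>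

context weak_comodule_setup
begin

text \<open>\<open>ract\<close> and \<open>lact\<close> are the \<open>A\<close>-actions of \<open>\<EE>\<close>; in particular \<open>p_R t = ract t 1\<close>.\<close>

definition ract where "ract t b = sw AH t (\<lambda>a h. sw AH (\<rho> b) (\<lambda>x y. kpure K A H (a \<cdot> x) (h \<bullet> y)))"
definition lact where "lact b t = sw AH t (\<lambda>a h. kpure K A H (b \<cdot> a) h)"
definition canp where "canp a b = sw AH (\<rho> b) (\<lambda>x h. kpure K A H (a \<cdot> x) h)"

lemma linear_ract_right: "t \<in> carrier AH \<Longrightarrow> linear_map K A AH (ract t)"
  and linear_ract: "b \<in> carrier A \<Longrightarrow> linear_map K AH AH (\<lambda>t. ract t b)"
  and linear_lact_left: "t \<in> carrier AH \<Longrightarrow> linear_map K A AH (\<lambda>b. lact b t)"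
  and linear_lact: "b \<in> carrier A \<Longrightarrow> linear_map K AH AH (lact b)"
  and linear_canp_left: "b \<in> carrier A \<Longrightarrow> linear_map K A AH (\<lambda>a. canp a b)"
  and linear_canp: "a \<in> carrier A \<Longrightarrow> linear_map K A AH (canp a)"
  unfolding ract_def lact_def canp_def by (assumption | rule mlin)+

lemmas ract_closed = linear_map_closed[OF linear_ract]
lemmas lact_closed = linear_map_closed[OF linear_lact]
lemmas canp_closed = linear_map_closed[OF linear_canp]

lemmas [mlin] = linear_map_comp[OF linear_ract] linear_map_comp[OF linear_ract_right] ract_closed
  linear_map_comp[OF linear_lact] linear_map_comp[OF linear_lact_left] lact_closed
  linear_map_comp[OF linear_canp] linear_map_comp[OF linear_canp_left] canp_closed

lemma ract_kpure:
  assumes [mlin]: "a \<in> carrier A" "h \<in> carrier H" "b \<in> carrier A"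
  shows "ract (kpure K A H a h) b = sw AH (\<rho> b) (\<lambda>x y. kpure K A H (a \<cdot> x) (h \<bullet> y))"
  unfolding ract_def by (rule sw_kpure) (assumption | rule mlin)+

lemma lact_kpure:
  assumes [mlin]: "a \<in> carrier A" "h \<in> carrier H" "b \<in> carrier A"
  shows "lact b (kpure K A H a h) = kpure K A H (b \<cdot> a) h"
  unfolding lact_def by (rule sw_kpure) (assumption | rule mlin)+

lemma ract_ract:
  assumes t[mlin]: "t \<in> carrier AH" and [mlin]: "b \<in> carrier A" "c \<in> carrier A"
  shows "ract (ract t b) c = ract t (b \<cdot> c)"
proof (rule tensor_eqI[OF modA modH _ _ _ _ t, where P = AH and g = "\<lambda>t. ract (ract t b) c" and h = "\<lambda>t. ract t (b \<cdot> c)"])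
  fix a h assume [mlin]: "a \<in> carrier A" "h \<in> carrier H"
  have "ract (ract (kpure K A H a h) b) c = ract (sw AH (\<rho> b) (\<lambda>x y. kpure K A H (a \<cdot> x) (h \<bullet> y))) c"
    by (subst ract_kpure) ((assumption | rule mlin)+, rule refl)
  also have "\<dots> = sw AH (\<rho> b) (\<lambda>x y. ract (kpure K A H (a \<cdot> x) (h \<bullet> y)) c)"
    by (rule linear_sw[where M = A and N = H and g = "\<lambda>t. ract t c"]) (assumption | rule mlin)+
  also have "\<dots> = sw AH (\<rho> b) (\<lambda>x y. sw AH (\<rho> c) (\<lambda>u v. kpure K A H (a \<cdot> x \<cdot> u) (h \<bullet> y \<bullet> v)))"
    by (assumption | rule ract_kpure sw_congs mlin)+
  also have "\<dots> = sw AH (\<rho> b) (\<lambda>x y. sw AH (\<rho> c) (\<lambda>u v. kpure K A H (a \<cdot> (x \<cdot> u)) (h \<bullet> (y \<bullet> v))))"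
    by (rule rho_cong, (assumption | rule mlin)+, rule rho_cong, (assumption | rule mlin)+, subst RA.m_assoc, (assumption | rule mlin)+, subst RH.m_assoc) ((assumption | rule mlin)+, rule refl)
  also have "\<dots> = sw AH (\<rho> (b \<cdot> c)) (\<lambda>u v. kpure K A H (a \<cdot> u) (h \<bullet> v))"
    by (rule rho_mult[symmetric, where f = "\<lambda>u v. kpure K A H (a \<cdot> u) (h \<bullet> v)"]) (assumption | rule mlin)+
  also have "\<dots> = ract (kpure K A H a h) (b \<cdot> c)"
    by (rule ract_kpure[symmetric]) (assumption | rule mlin)+
  finally show "ract (ract (kpure K A H a h) b) c = ract (kpure K A H a h) (b \<cdot> c)" .
qed (assumption | rule mlin)+

lemma la_ract:
  assumes t[mlin]: "t \<in> carrier AH" and [mlin]: "b \<in> carrier A" "c \<in> carrier A"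
  shows "ract (lact b t) c = lact b (ract t c)"
proof (rule tensor_eqI[OF modA modH _ _ _ _ t, where P = AH and g = "\<lambda>t. ract (lact b t) c" and h = "\<lambda>t. lact b (ract t c)"])
  fix a h assume [mlin]: "a \<in> carrier A" "h \<in> carrier H"
  have "lact b (ract (kpure K A H a h) c) = lact b (sw AH (\<rho> c) (\<lambda>x y. kpure K A H (a \<cdot> x) (h \<bullet> y)))"
    by (subst ract_kpure) ((assumption | rule mlin)+, rule refl)
  also have "\<dots> = sw AH (\<rho> c) (\<lambda>x y. lact b (kpure K A H (a \<cdot> x) (h \<bullet> y)))"
    by (rule linear_sw[where M = A and N = H]) (assumption | rule mlin)+
  also have "\<dots> = sw AH (\<rho> c) (\<lambda>x y. kpure K A H (b \<cdot> (a \<cdot> x)) (h \<bullet> y))"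
    by (assumption | rule lact_kpure sw_congs mlin)+
  also have "\<dots> = sw AH (\<rho> c) (\<lambda>x y. kpure K A H (b \<cdot> a \<cdot> x) (h \<bullet> y))"
    by (assumption | rule sw_congs mlin | subst RA.m_assoc | rule refl)+
  also have "\<dots> = ract (kpure K A H (b \<cdot> a) h) c"
    by (rule ract_kpure[symmetric]) (assumption | rule mlin)+
  also have "\<dots> = ract (lact b (kpure K A H a h)) c"
    by (subst lact_kpure) ((assumption | rule mlin)+, rule refl)
  finally show "ract (lact b (kpure K A H a h)) c = lact b (ract (kpure K A H a h) c)" by simp
qed (assumption | rule mlin)+

lemma lact_smult_one:
  assumes t[mlin]: "t \<in> carrier AH" and [mlin]: "c \<in> carrier K"
  shows "lact (c *A 1A) t = c \<odot>\<^bsub>AH\<^esub> t"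
proof (rule tensor_eqI[OF modA modH _ _ _ _ t, where P = AH and g = "\<lambda>t. lact (c *A 1A) t" and h = "\<lambda>t. c \<odot>\<^bsub>AH\<^esub> t"])
  fix a h assume a[mlin]: "a \<in> carrier A" "h \<in> carrier H"
  have "(c *A 1A) \<cdot> a = c *A a"
    using assoc_algebra.smult_mult_left[OF algebra_A \<open>c \<in> carrier K\<close> RA.one_closed a(1)] a by simp
  then show "lact (c *A 1A) (kpure K A H a h) = c \<odot>\<^bsub>AH\<^esub> kpure K A H a h"
    using two_modules.smult_kpure[OF two_modules.intro[OF modA modH] \<open>c \<in> carrier K\<close> a]
    by (subst lact_kpure) (assumption | rule mlin | simp)+
qed (assumption | rule mlin)+

text \<open>Writing the canonical map as \<open>(a \<otimes> 1) b\<close> reduces its bimodule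
  properties to associativity of \<open>ract\<close> and its commutation with
  \<open>lact\<close>.\<close>

lemma canp_eq_ract:
  assumes [mlin]: "a \<in> carrier A" "b \<in> carrier A"
  shows "canp a b = ract (kpure K A H a 1H) b"
  unfolding canp_def by (subst ract_kpure, (assumption | rule mlin)+, rule rho_cong, (assumption | rule mlin)+, subst RH.l_one) ((assumption | rule mlin)+, rule refl)

lemma ract_canp:
  assumes [mlin]: "a \<in> carrier A" "b \<in> carrier A" "c \<in> carrier A"
  shows "ract (canp a b) c = canp a (b \<cdot> c)"
  by (subst canp_eq_ract, (assumption | rule mlin)+, subst canp_eq_ract, (assumption | rule mlin)+, rule ract_ract) (assumption | rule mlin)+

lemma lact_canp:
  assumes [mlin]: "a \<in> carrier A" "b \<in> carrier A" "c \<in> carrier A"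
  shows "lact c (canp a b) = canp (c \<cdot> a) b"
  by (subst canp_eq_ract, (assumption | rule mlin)+, subst canp_eq_ract, (assumption | rule mlin)+, subst la_ract[symmetric], (assumption | rule mlin)+, subst lact_kpure) ((assumption | rule mlin)+, rule refl)

lemma canp_one:
  assumes [mlin]: "b \<in> carrier A"
  shows "canp 1A b = \<rho> b"
proof -
  have "canp 1A b = sw AH (\<rho> b) (kpure K A H)"
    unfolding canp_def by (rule rho_cong, (assumption | rule mlin)+, subst RA.l_one) (assumption, rule refl)
  also have "\<dots> = \<rho> b" by (rule sw_pure_id) (assumption | rule mlin)+
  finally show ?thesis .
qed

text \<open>This is the coinvariance condition on \<open>b\<close>, multiplied by \<open>a\<close>
  from the left. It makes the canonical map balanced over \<open>B\<close>.\<close>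

lemma canp_coinv:
  assumes b: "b \<in> B" and [mlin]: "a \<in> carrier A" "c \<in> carrier A"
  shows "canp (a \<cdot> b) c = canp a (b \<cdot> c)"
proof -
  note [mlin] = coinv_in[OF b]
  have "canp a (b \<cdot> c) = sw AH (\<rho> c) (\<lambda>x h. kpure K A H (a \<cdot> (b \<cdot> x)) h)"
    unfolding canp_def by (rule sw_rho_coinv[OF b]) (assumption | rule mlin)+
  also have "\<dots> = canp (a \<cdot> b) c"
    unfolding canp_def by (assumption | rule sw_congs mlin | subst RA.m_assoc | rule refl)+
  finally show ?thesis by simp
qed

lemma p_R_eq: "p_R K H A \<rho> t = ract t 1A"
  unfolding p_R_def ract_def ..

lemma can_map_eq: "can_map K H A \<rho> t = sw AH t canp"
  unfolding can_map_def canp_def[abs_def] ..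

section \<open>The bimodule \<open>\<EE>\<close>\<close>

abbreviation "Eb \<equiv> E_bimodule K H A \<rho>"

lemma Eb_sel: "carrier Eb = (\<lambda>t. ract t 1A) ` carrier AH" "ring.add Eb = ring.add AH" "\<zero>\<^bsub>Eb\<^esub> = \<zero>\<^bsub>AH\<^esub>"
  "smult Eb = lact" "rsmult Eb = ract"
  unfolding E_bimodule_def Let_def by (simp_all add: p_R_eq lact_def[abs_def] ract_def[abs_def])

text \<open>The projection is idempotent, since \<open>ract\<close> is associative and
  \<open>1 1 = 1\<close>. Its image is thus cut out by a linear equation, from which the closure
  properties follow.\<close>

lemma Eb_iff: "t \<in> carrier Eb \<longleftrightarrow> t \<in> carrier AH \<and> ract t 1A = t"
proof
  assume "t \<in> carrier Eb"
  then obtain s where s: "s \<in> carrier AH" "t = ract s 1A" by (auto simp: Eb_sel)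
  then show "t \<in> carrier AH \<and> ract t 1A = t" using ract_closed[OF RA.one_closed s(1)] ract_ract[OF s(1), of "1A" "1A"] by simp
next
  assume "t \<in> carrier AH \<and> ract t 1A = t"
  then show "t \<in> carrier Eb" unfolding Eb_sel by (intro image_eqI[of t _ t]) simp_all
qed

lemma ract_in_Eb: "\<lbrakk>t \<in> carrier AH; b \<in> carrier A\<rbrakk> \<Longrightarrow> ract t b \<in> carrier Eb"
  unfolding Eb_iff using ract_closed ract_ract[of t b "1A"] by simp

lemma lact_in_Eb: "\<lbrakk>t \<in> carrier Eb; b \<in> carrier A\<rbrakk> \<Longrightarrow> lact b t \<in> carrier Eb"
  unfolding Eb_iff using lact_closed la_ract[of t b "1A"] by simp

lemma canp_in_Eb: "\<lbrakk>a \<in> carrier A; b \<in> carrier A\<rbrakk> \<Longrightarrow> canp a b \<in> carrier Eb"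
  unfolding Eb_iff using canp_closed ract_canp[of a b "1A"] by simp

lemma module_AH: "module K AH" by (assumption | rule mlin)+

lemma abelian_group_Eb: "abelian_group Eb"
proof -
  interpret m: module K AH by (rule module_AH)
  note r = linear_map_add[OF linear_ract[OF RA.one_closed]] linear_map_smult[OF linear_ract[OF RA.one_closed]]
  show ?thesis
  proof (rule abelian_groupI; (unfold Eb_sel(2,3))?)
    fix x assume x: "x \<in> carrier Eb"
    have "(\<ominus>\<^bsub>K\<^esub> \<one>\<^bsub>K\<^esub>) \<odot>\<^bsub>AH\<^esub> x \<in> carrier Eb" using x r unfolding Eb_iff by simp
    then have "\<ominus>\<^bsub>AH\<^esub> x \<in> carrier Eb" using x by (simp add: Eb_iff m.smult_l_minus)
    then show "\<exists>y\<in>carrier Eb. y \<oplus>\<^bsub>AH\<^esub> x = \<zero>\<^bsub>AH\<^esub>" using x by (intro bexI[of _ "\<ominus>\<^bsub>AH\<^esub> x"]) (auto simp: Eb_iff m.l_neg)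
  next
    have "ract \<zero>\<^bsub>AH\<^esub> 1A = \<zero>\<^bsub>AH\<^esub>"
      by (rule linear_map_zero[OF _ _ linear_ract]) (auto intro: m.abelian_group_axioms)
    then show "\<zero>\<^bsub>AH\<^esub> \<in> carrier Eb" unfolding Eb_iff by simp
  next
    fix x y assume "x \<in> carrier Eb" "y \<in> carrier Eb"
    then show "x \<oplus>\<^bsub>AH\<^esub> y = y \<oplus>\<^bsub>AH\<^esub> x" using m.a_comm Eb_iff by blast
  qed (use r in \<open>auto simp: Eb_iff m.a_assoc\<close>)
qed

sublocale EE: balanced_setting Eb ract A lact Eb
proof (intro balanced_setting.intro balanced_setting_axioms.intro abelian_group_Eb)
  show "m \<in> carrier Eb \<Longrightarrow> r \<in> carrier A \<Longrightarrow> ract m r \<in> carrier Eb" for m r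
    using ract_in_Eb Eb_iff by blast
  show "r \<in> carrier A \<Longrightarrow> n \<in> carrier Eb \<Longrightarrow> lact r n \<in> carrier Eb" for r n
    by (rule lact_in_Eb)
qed

section \<open>The Sweedler bimodule and the canonical map on
  \<open>A \<otimes>\<^sub>B A\<close>\<close>

sublocale SB: balanced_setting A "monoid.mult A" Bm "monoid.mult A" A
  by (intro balanced_setting.intro balanced_setting_axioms.intro RA.abelian_group_axioms)
     (use coinv_in in auto)

abbreviation "Wb \<equiv> sweedler_bimodule A B"

definition slact where "slact a t = sw SB.TN t (\<lambda>x y. SB.pure (a \<cdot> x) y)"
definition sract where "sract t a = sw SB.TN t (\<lambda>x y. SB.pure x (y \<cdot> a))"

lemma Wb_sel: "carrier Wb = carrier SB.TN" "ring.add Wb = ring.add SB.TN" "\<zero>\<^bsub>Wb\<^esub> = \<zero>\<^bsub>SB.TN\<^esub>"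
  "smult Wb = slact" "rsmult Wb = sract"
  unfolding sweedler_bimodule_def Let_def by (simp_all add: slact_def[abs_def] sract_def[abs_def])

lemma slact_balanced:
  assumes "a \<in> carrier A"
  shows "balanced_map A (monoid.mult A) Bm (monoid.mult A) A SB.TN (\<lambda>x y. SB.pure (a \<cdot> x) y)"
proof (rule balanced_mapI)
  fix m r n assume "m \<in> carrier A" "r \<in> carrier Bm" "n \<in> carrier A"
  then show "SB.pure (a \<cdot> (m \<cdot> r)) n = SB.pure (a \<cdot> m) (r \<cdot> n)"
    using SB.pure_act[of "a \<cdot> m" r n] assms coinv_in by (simp add: RA.m_assoc)
qed (use assms in \<open>simp_all add: SB.pure_closed SB.pure_add_left SB.pure_add_right RA.r_distr\<close>)

lemma sract_balanced:
  assumes "a \<in> carrier A"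
  shows "balanced_map A (monoid.mult A) Bm (monoid.mult A) A SB.TN (\<lambda>x y. SB.pure x (y \<cdot> a))"
proof (rule balanced_mapI)
  fix m r n assume "m \<in> carrier A" "r \<in> carrier Bm" "n \<in> carrier A"
  then show "SB.pure (m \<cdot> r) (n \<cdot> a) = SB.pure m (r \<cdot> n \<cdot> a)"
    using SB.pure_act[of m r "n \<cdot> a"] assms coinv_in by (simp add: RA.m_assoc)
qed (use assms in \<open>simp_all add: SB.pure_closed SB.pure_add_left SB.pure_add_right RA.l_distr\<close>)

lemmas slact_closed = SB.lift_closed[OF SB.tensor_abelian_group slact_balanced, folded slact_def]
lemmas slact_add = SB.lift_add[OF SB.tensor_abelian_group slact_balanced, folded slact_def]
lemmas slact_pure = SB.lift_pure[OF SB.tensor_abelian_group slact_balanced, folded slact_def]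
lemmas sract_closed = SB.lift_closed[OF SB.tensor_abelian_group sract_balanced, folded sract_def]
lemmas sract_add = SB.lift_add[OF SB.tensor_abelian_group sract_balanced, folded sract_def]
lemmas sract_pure = SB.lift_pure[OF SB.tensor_abelian_group sract_balanced, folded sract_def]

lemma abelian_group_Wb: "abelian_group Wb"
  by (rule abelian_group_same_group[OF _ _ _ SB.tensor_abelian_group]) (simp_all add: Wb_sel)

sublocale WW: balanced_setting Wb sract A slact Wb
  by (intro balanced_setting.intro balanced_setting_axioms.intro abelian_group_Wb)
     (simp_all add: Wb_sel slact_closed sract_closed)

lemma canp_bilin: "bilin K A A AH canp"
  by (rule bilinI) (assumption | rule mlin)+

lemma linear_can: "linear_map K AA AH (\<lambda>t. sw AH t canp)"
  by (assumption | rule canp_bilin mlin)+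

lemma canp_balanced: "balanced_map A (monoid.mult A) Bm (monoid.mult A) A AH canp"
  using bilin_balanced[OF canp_bilin] canp_coinv unfolding balanced_map_def by simp

abbreviation "can t \<equiv> sw AH t canp"

lemmas can_closed = SB.lift_closed[OF module.axioms(2)[OF module_AH] canp_balanced]
lemmas can_add = SB.lift_add[OF module.axioms(2)[OF module_AH] canp_balanced]
lemmas can_pure = SB.lift_pure[OF module.axioms(2)[OF module_AH] canp_balanced]

lemma can_in_Eb: "t \<in> carrier SB.TN \<Longrightarrow> can t \<in> carrier Eb"
proof (induction t rule: SB.tensor_induct)
  case zero
  then show ?case
    using SB.lift_zero[OF module.axioms(2)[OF module_AH] canp_balanced] EE.M.zero_closed by (simp add: Eb_sel(3))
next
  case (add s t)
  then show ?case using EE.M.a_closed[of "can s" "can t"] by (simp add: can_add Eb_sel(2))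
qed (simp add: can_pure canp_in_Eb)

text \<open>The projection from \<open>A \<otimes>\<^sub>k A\<close> onto
  \<open>A \<otimes>\<^sub>B A\<close>.\<close>

definition quot where "quot t = sw SB.TN t SB.pure"

text \<open>A scalar \<open>c\<close> acts on either side through \<open>c 1\<close>, which is
  coinvariant, so balancedness over \<open>B\<close> covers it.\<close>

lemma pure_K_balanced: "balanced_map A (\<lambda>m c. c *A m) K (smult A) A SB.TN SB.pure"
proof (rule balanced_mapI)
  fix m c n assume a: "m \<in> carrier A" "c \<in> carrier K" "n \<in> carrier A"
  have "c *A m = m \<cdot> (c *A 1A)" "c *A n = (c *A 1A) \<cdot> n"
    using assoc_algebra.smult_mult_right[OF algebra_A a(2,1) RA.one_closed]
      assoc_algebra.smult_mult_left[OF algebra_A a(2) RA.one_closed a(3)] a by simp_all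
  then show "SB.pure (c *A m) n = SB.pure m (c *A n)"
    using SB.pure_act[of m "c *A 1A" n] a coinv_smult[OF a(2) coinv_one] by simp
qed (simp_all add: SB.pure_closed SB.pure_add_left SB.pure_add_right)

lemmas quot_closed = two_modules.blift_closed[OF two_modules.intro[OF modA modA] SB.tensor_abelian_group pure_K_balanced, folded quot_def]
lemmas quot_add = two_modules.blift_add[OF two_modules.intro[OF modA modA] SB.tensor_abelian_group pure_K_balanced, folded quot_def]
lemmas quot_pure = two_modules.blift_pure[OF two_modules.intro[OF modA modA] SB.tensor_abelian_group pure_K_balanced, folded quot_def]
lemmas quot_zero = two_modules.blift_zero[OF two_modules.intro[OF modA modA] SB.tensor_abelian_group pure_K_balanced, folded quot_def]

text \<open>\<open>can\<close> is one term evaluated on two tensor products, as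
  \<open>tensor_lift\<close> does not record the balancing ring. That the two readings agree along
  the projection is checked on pure tensors.\<close>

lemma can_quot: "t \<in> carrier AA \<Longrightarrow> can (quot t) = can t"
  by (rule two_modules.kadditive_eqI[OF two_modules.intro[OF modA modA] module.axioms(2)[OF module_AH],
        where g = "\<lambda>t. can (quot t)" and h = "\<lambda>t. can t"])
     (simp_all add: quot_closed quot_add quot_pure can_closed can_add can_pure linear_map_closed[OF linear_can]
        linear_map_add[OF linear_can] sw_kpure[OF modA modA module_AH canp_bilin])

lemma quot_surj: "quot ` carrier AA = carrier SB.TN"
proof
  show "quot ` carrier AA \<subseteq> carrier SB.TN" using quot_closed by auto
  show "carrier SB.TN \<subseteq> quot ` carrier AA"
  proof
    interpret m: module K AA by (assumption | rule mlin)+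
    fix t assume "t \<in> carrier SB.TN"
    then show "t \<in> quot ` carrier AA"
    proof (induction t rule: SB.tensor_induct)
      case zero
      then show ?case using quot_zero m.zero_closed by (intro image_eqI[of _ _ "\<zero>\<^bsub>AA\<^esub>"]) simp_all
    next
      case (pure m n)
      then show ?case by (intro image_eqI[of _ _ "kpure K A A m n"]) (simp_all add: quot_pure kpure_in modA)
    next
      case (add s t)
      then obtain s' t' where "s' \<in> carrier AA" "s = quot s'" "t' \<in> carrier AA" "t = quot t'" by auto
      then show ?case by (intro image_eqI[of _ _ "s' \<oplus>\<^bsub>AA\<^esub> t'"]) (simp_all add: quot_add)
    qed
  qed
qed

lemma can_slact: "\<lbrakk>a \<in> carrier A; t \<in> carrier SB.TN\<rbrakk> \<Longrightarrow> can (slact a t) = lact a (can t)"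
  by (rule SB.additive_eqI[OF module.axioms(2)[OF module_AH],
        where g = "\<lambda>t. can (slact a t)" and h = "\<lambda>t. lact a (can t)"])
     (simp_all add: slact_closed slact_add slact_pure can_closed can_add can_pure lact_closed lact_canp
        linear_map_add[OF linear_lact])

lemma can_sract: "\<lbrakk>a \<in> carrier A; t \<in> carrier SB.TN\<rbrakk> \<Longrightarrow> can (sract t a) = ract (can t) a"
  by (rule SB.additive_eqI[OF module.axioms(2)[OF module_AH],
        where g = "\<lambda>t. can (sract t a)" and h = "\<lambda>t. ract (can t) a"])
     (simp_all add: sract_closed sract_add sract_pure can_closed can_add can_pure ract_closed ract_canp
        linear_map_add[OF linear_ract])

lemma mult_balanced: "balanced_map A (monoid.mult A) Bm (monoid.mult A) A A (monoid.mult A)"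
  using coinv_in by (intro balanced_mapI) (auto simp: RA.l_distr RA.r_distr RA.m_assoc)

lemma E_counit_can:
  assumes t: "t \<in> carrier SB.TN"
  shows "sw A (can t) (\<lambda>a h. \<epsilon> h *A a) = sw A t (monoid.mult A)"
proof (rule SB.additive_eqI[OF RA.abelian_group_axioms _ _ _ _ _ t,
      where g = "\<lambda>t. sw A (can t) (\<lambda>a h. \<epsilon> h *A a)" and h = "\<lambda>t. sw A t (monoid.mult A)"])
  note ml = SB.lift_closed[OF RA.abelian_group_axioms mult_balanced] SB.lift_add[OF RA.abelian_group_axioms mult_balanced]
    SB.lift_pure[OF RA.abelian_group_axioms mult_balanced]
  have l: "linear_map K AH A (\<lambda>t. sw A t (\<lambda>a h. \<epsilon> h *A a))" by (assumption | rule mlin)+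
  show "sw A (can t) (\<lambda>a h. \<epsilon> h *A a) \<in> carrier A" if "t \<in> carrier SB.TN" for t
    by (rule linear_map_closed[OF l can_closed[OF that]])
  show "sw A (can (s \<oplus>\<^bsub>SB.TN\<^esub> t)) (\<lambda>a h. \<epsilon> h *A a) = sw A (can s) (\<lambda>a h. \<epsilon> h *A a) \<oplus>\<^bsub>A\<^esub> sw A (can t) (\<lambda>a h. \<epsilon> h *A a)"
    if "s \<in> carrier SB.TN" "t \<in> carrier SB.TN" for s t
    unfolding can_add[OF that] by (rule linear_map_add[OF l can_closed[OF that(1)] can_closed[OF that(2)]])
  fix a b assume ab[mlin]: "a \<in> carrier A" "b \<in> carrier A"
  have "sw A (canp a b) (\<lambda>a h. \<epsilon> h *A a) = sw A (\<rho> b) (\<lambda>x h. sw A (kpure K A H (a \<cdot> x) h) (\<lambda>a h. \<epsilon> h *A a))"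
    unfolding canp_def by (rule linear_sw[where M = A and N = H, OF _ _ _ _ _ l]) (assumption | rule mlin)+
  also have "\<dots> = sw A (\<rho> b) (\<lambda>x h. \<epsilon> h *A (a \<cdot> x))"
    by (assumption | rule sw_kpure sw_congs mlin)+
  also have "\<dots> = a \<cdot> b" by (rule rho_counit) (assumption | rule mlin)+
  finally show "sw A (can (SB.pure a b)) (\<lambda>a h. \<epsilon> h *A a) = sw A (SB.pure a b) (monoid.mult A)"
    using ab by (simp add: can_pure ml)
next
  note ml = SB.lift_closed[OF RA.abelian_group_axioms mult_balanced] SB.lift_add[OF RA.abelian_group_axioms mult_balanced]
  show "t \<in> carrier SB.TN \<Longrightarrow> sw A t (monoid.mult A) \<in> carrier A" for t by (rule ml)
  show "s \<in> carrier SB.TN \<Longrightarrow> t \<in> carrier SB.TN \<Longrightarrow> sw A (s \<oplus>\<^bsub>SB.TN\<^esub> t) (monoid.mult A) =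
    sw A s (monoid.mult A) \<oplus>\<^bsub>A\<^esub> sw A t (monoid.mult A)" for s t by (rule ml)
qed

section \<open>The coproducts of the two corings\<close>

definition sweedler_comult where
  "sweedler_comult t = sw WW.TN t (\<lambda>a a'. WW.pure (SB.pure a 1A) (SB.pure 1A a'))"

definition E_comult where
  "E_comult t = sw EE.TN t (\<lambda>a h. sw EE.TN (\<Delta> h) (\<lambda>h1 h2.
     EE.pure (ract (kpure K A H a h1) 1A) (ract (kpure K A H 1A h2) 1A)))"

definition diag where "diag s t = EE.pure (ract s 1A) (ract t 1A)"

text \<open>A scalar crosses \<open>\<otimes>\<^sub>A\<close> as the element \<open>c 1\<close> of
  \<open>A\<close>. Associativity of \<open>ract\<close> exhibits it as a right action on the left
  factor, and \<open>lact_smult_one\<close> as a left action on the right factor.\<close>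

lemma diag_balanced: "balanced_map AH (\<lambda>m c. c \<odot>\<^bsub>AH\<^esub> m) K (smult AH) AH EE.TN diag"
proof (rule balanced_mapI)
  note r = linear_map_add[OF linear_ract[OF RA.one_closed]]
  note E = ract_in_Eb[OF _ RA.one_closed]
  show "m \<in> carrier AH \<Longrightarrow> n \<in> carrier AH \<Longrightarrow> diag m n \<in> carrier EE.TN" for m n
    unfolding diag_def by (intro EE.pure_closed E)
  show "m \<in> carrier AH \<Longrightarrow> m' \<in> carrier AH \<Longrightarrow> n \<in> carrier AH \<Longrightarrow>
      diag (m \<oplus>\<^bsub>AH\<^esub> m') n = diag m n \<oplus>\<^bsub>EE.TN\<^esub> diag m' n" for m m' n
    unfolding diag_def using EE.pure_add_left[OF E E E, of m m' n] by (simp add: r Eb_sel(2))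
  show "m \<in> carrier AH \<Longrightarrow> n \<in> carrier AH \<Longrightarrow> n' \<in> carrier AH \<Longrightarrow>
      diag m (n \<oplus>\<^bsub>AH\<^esub> n') = diag m n \<oplus>\<^bsub>EE.TN\<^esub> diag m n'" for m n n'
    unfolding diag_def using EE.pure_add_right[OF E E E, of m n n'] by (simp add: r Eb_sel(2))
  fix m c n assume a: "m \<in> carrier AH" "c \<in> carrier K" "n \<in> carrier AH"
  have c1: "c *A 1A \<in> carrier A" by (rule module.smult_closed[OF modA a(2) RA.one_closed])
  have "ract (c \<odot>\<^bsub>AH\<^esub> m) 1A = c \<odot>\<^bsub>AH\<^esub> ract m 1A" by (rule linear_map_smult[OF linear_ract[OF RA.one_closed] a(2,1)])
  also have "\<dots> = ract m (c *A 1A)"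
    using linear_map_smult[OF linear_ract_right[OF a(1)] a(2) RA.one_closed] by simp
  also have "\<dots> = ract (ract m 1A) (c *A 1A)" using ract_ract[OF a(1) RA.one_closed c1] c1 by simp
  finally have 1: "ract (c \<odot>\<^bsub>AH\<^esub> m) 1A = ract (ract m 1A) (c *A 1A)" .
  have 2: "ract (c \<odot>\<^bsub>AH\<^esub> n) 1A = lact (c *A 1A) (ract n 1A)"
    using linear_map_smult[OF linear_ract[OF RA.one_closed] a(2,3)] lact_smult_one[OF ract_closed[OF RA.one_closed a(3)] a(2)]
    by simp
  show "diag (c \<odot>\<^bsub>AH\<^esub> m) n = diag m (c \<odot>\<^bsub>AH\<^esub> n)"
    unfolding diag_def 1 2 by (rule EE.pure_act[OF E[OF a(1)] c1 E[OF a(3)]])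
qed

abbreviation "AHAH \<equiv> ktensor K AH AH"
definition "qd t = sw EE.TN t diag"
text \<open>The coproduct of \<open>\<EE>\<close> before projection: it duplicates the
  \<open>H\<close>-leg inside a tensor product over \<open>K\<close>, where it is linear.
  \<open>qd\<close> then applies \<open>p_R\<close> to both factors and passes to
  \<open>\<otimes>\<^sub>A\<close>.\<close>

definition "dup t = sw AHAH t (\<lambda>a h. sw AHAH (\<Delta> h) (\<lambda>h1 h2. kpure K AH AH (kpure K A H a h1) (kpure K A H 1A h2)))"

lemma linear_dup: "linear_map K AH AHAH dup" unfolding dup_def by (assumption | rule mlin)+

lemma module_AHAH: "module K AHAH" by (assumption | rule mlin)+

lemmas qd_rules = two_modules.blift_closed[OF two_modules.intro[OF module_AH module_AH] EE.tensor_abelian_group diag_balanced, folded qd_def]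
  two_modules.blift_add[OF two_modules.intro[OF module_AH module_AH] EE.tensor_abelian_group diag_balanced, folded qd_def]
  two_modules.blift_pure[OF two_modules.intro[OF module_AH module_AH] EE.tensor_abelian_group diag_balanced, folded qd_def]

text \<open>\<open>\<EE> \<otimes>\<^sub>A \<EE>\<close> carries no \<open>K\<close>-module structure here, so additive maps into it are obtained by composing
  \<open>K\<close>-linear maps with the quotient map \<open>qd\<close>; likewise \<open>quot\<close> for \<open>A \<otimes>\<^sub>B A\<close>.\<close>

lemma qd_sw:
  assumes m: "module K M" "module K N" and f: "bilin K M N AHAH f" and t: "t \<in> carrier (ktensor K M N)"
  shows "qd (sw AHAH t f) = sw EE.TN t (\<lambda>m n. qd (f m n))"
  by (rule two_modules.additive_lift[OF two_modules.intro[OF m] module.axioms(2)[OF module_AHAH]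
        EE.tensor_abelian_group bilin_balanced[OF f] _ _ t]) (rule qd_rules; assumption)+

lemma quot_sw:
  assumes m: "module K M" "module K N" and f: "bilin K M N AA f" and t: "t \<in> carrier (ktensor K M N)"
  shows "quot (sw AA t f) = sw SB.TN t (\<lambda>m n. quot (f m n))"
  by (rule two_modules.additive_lift[OF two_modules.intro[OF m] module.axioms(2)[OF module_ktensor[OF modA modA]]
        SB.tensor_abelian_group bilin_balanced[OF f] _ _ t]) (rule quot_closed quot_add; assumption)+

lemma E_comult_eq:
  assumes t[mlin]: "t \<in> carrier AH"
  shows "E_comult t = qd (dup t)"
proof -
  have "qd (dup t) = sw EE.TN t (\<lambda>a h. qd (sw AHAH (\<Delta> h) (\<lambda>h1 h2. kpure K AH AH (kpure K A H a h1) (kpure K A H 1A h2))))"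
    unfolding dup_def by (rule qd_sw) (assumption | rule mlin)+
  also have "\<dots> = E_comult t"
    unfolding E_comult_def
  proof (rule sw_cong[OF modA modH t])
    fix a h assume [mlin]: "a \<in> carrier A" "h \<in> carrier H"
    have "qd (sw AHAH (\<Delta> h) (\<lambda>h1 h2. kpure K AH AH (kpure K A H a h1) (kpure K A H 1A h2))) =
      sw EE.TN (\<Delta> h) (\<lambda>h1 h2. qd (kpure K AH AH (kpure K A H a h1) (kpure K A H 1A h2)))"
      by (rule qd_sw) (assumption | rule mlin)+
    also have "\<dots> = sw EE.TN (\<Delta> h) (\<lambda>h1 h2. EE.pure (ract (kpure K A H a h1) 1A) (ract (kpure K A H 1A h2) 1A))"
      unfolding diag_def[symmetric] by (rule Delta_cong, (assumption | rule mlin)+, rule qd_rules(3)) (assumption | rule mlin)+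
    finally show "qd (sw AHAH (\<Delta> h) (\<lambda>h1 h2. kpure K AH AH (kpure K A H a h1) (kpure K A H 1A h2))) = \<dots>" .
  qed
  finally show ?thesis by simp
qed

text \<open>
  Here \<open>p_R (a b\<^sub>0 \<otimes> b\<^sub>1) = a \<rho>(1) \<cdot> b\<^sub>0\<close>, and \<open>b\<^sub>0\<close> is moved across \<open>\<otimes>\<^sub>A\<close>.
\<close>

lemma E_comult_canp:
  assumes ab[mlin]: "a \<in> carrier A" "b \<in> carrier A"
  shows "E_comult (canp a b) = EE.pure (canp a 1A) (canp 1A b)"
proof -
  have "dup (canp a b) = sw AHAH (\<rho> b) (\<lambda>x h. dup (kpure K A H (a \<cdot> x) h))"
    unfolding canp_def by (rule linear_sw[where M = A and N = H, OF _ _ _ _ _ linear_dup]) (assumption | rule mlin)+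
  also have "\<dots> = sw AHAH (\<rho> b) (\<lambda>x h. sw AHAH (\<Delta> h) (\<lambda>h1 h2. kpure K AH AH (kpure K A H (a \<cdot> x) h1) (kpure K A H 1A h2)))"
    unfolding dup_def by (assumption | rule sw_kpure sw_congs mlin)+
  also have "\<dots> = sw AHAH (\<rho> b) (\<lambda>x h. sw AHAH (\<rho> x) (\<lambda>u g. kpure K AH AH (kpure K A H (a \<cdot> u) g) (kpure K A H 1A h)))"
    by (rule rho_coassoc[symmetric, where f = "\<lambda>u g h. kpure K AH AH (kpure K A H (a \<cdot> u) g) (kpure K A H 1A h)"]) (assumption | rule mlin)+
  also have "\<dots> = sw AHAH (\<rho> b) (\<lambda>x h. kpure K AH AH (canp a x) (kpure K A H 1A h))"
    by (rule rho_cong, (assumption | rule mlin)+, unfold canp_def, rule linear_sw[symmetric, where M = A and N = H and P = AH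
          and g = "\<lambda>s. kpure K AH AH s _"]) (assumption | rule mlin)+
  finally have "qd (dup (canp a b)) = sw EE.TN (\<rho> b) (\<lambda>x h. qd (kpure K AH AH (canp a x) (kpure K A H 1A h)))"
    by (simp only:) (rule qd_sw, (assumption | rule mlin)+)
  also have "\<dots> = sw EE.TN (\<rho> b) (\<lambda>x h. EE.pure (canp a 1A) (ract (kpure K A H x h) 1A))"
  proof (rule rho_cong[OF ab(2)])
    fix x h assume xh[mlin]: "x \<in> carrier A" "h \<in> carrier H"
    have "qd (kpure K AH AH (canp a x) (kpure K A H 1A h)) = EE.pure (ract (canp a x) 1A) (ract (kpure K A H 1A h) 1A)"
      unfolding diag_def[symmetric] by (rule qd_rules(3)) (assumption | rule mlin)+
    also have "ract (canp a x) 1A = ract (canp a 1A) x" using ract_canp[of a x "1A"] ract_canp[of a "1A" x] ab xh by simp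
    also have "EE.pure (ract (canp a 1A) x) (ract (kpure K A H 1A h) 1A) = EE.pure (canp a 1A) (lact x (ract (kpure K A H 1A h) 1A))"
      by (rule EE.pure_act) (rule canp_in_Eb ract_in_Eb mlin ab xh)+
    also have "lact x (ract (kpure K A H 1A h) 1A) = ract (lact x (kpure K A H 1A h)) 1A"
      by (rule la_ract[symmetric]) (assumption | rule mlin)+
    also have "lact x (kpure K A H 1A h) = kpure K A H x h" using lact_kpure[of "1A" h x] xh by simp
    finally show "qd (kpure K AH AH (canp a x) (kpure K A H 1A h)) = EE.pure (canp a 1A) (ract (kpure K A H x h) 1A)" .
  qed
  \<comment> \<open>The first factor no longer depends on the legs of \<open>\<rho> b\<close>, so
    the sum can be taken inside the second one.\<close>
  also have "\<dots> = EE.pure (canp a 1A) (ract (sw AH (\<rho> b) (kpure K A H)) 1A)"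
  proof (rule two_modules.additive_lift[symmetric, OF two_modules.intro[OF modA modH] module.axioms(2)[OF module_AH]
        EE.tensor_abelian_group bilin_balanced, where g = "\<lambda>s. EE.pure (canp a 1A) (ract s 1A)"])
    show "bilin K A H AH (kpure K A H)" by (rule two_modules.kpure_bilin[OF two_modules.intro[OF modA modH]])
    show "\<rho> b \<in> carrier AH" by (assumption | rule mlin)+
    have c: "canp a 1A \<in> carrier Eb" by (rule canp_in_Eb) (assumption | rule mlin)+
    show "x \<in> carrier AH \<Longrightarrow> EE.pure (canp a 1A) (ract x 1A) \<in> carrier EE.TN" for x
      by (rule EE.pure_closed[OF c ract_in_Eb[OF _ RA.one_closed]])
    show "x \<in> carrier AH \<Longrightarrow> y \<in> carrier AH \<Longrightarrow> EE.pure (canp a 1A) (ract (x \<oplus>\<^bsub>AH\<^esub> y) 1A) =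
        EE.pure (canp a 1A) (ract x 1A) \<oplus>\<^bsub>EE.TN\<^esub> EE.pure (canp a 1A) (ract y 1A)" for x y
      using EE.pure_add_right[OF c ract_in_Eb[OF _ RA.one_closed] ract_in_Eb[OF _ RA.one_closed], of x y]
      by (simp add: linear_map_add[OF linear_ract[OF RA.one_closed]] Eb_sel(2))
  qed
  also have "sw AH (\<rho> b) (kpure K A H) = canp 1A b"
    using canp_one[OF ab(2)] sw_pure_id[OF modA modH, of "\<rho> b"] linear_map_closed[OF lin_rho ab(2)] by simp
  also have "ract (canp 1A b) 1A = canp 1A b" using canp_in_Eb[OF RA.one_closed ab(2)] by (simp add: Eb_iff)
  finally show ?thesis using E_comult_eq[OF canp_closed[OF ab]] by simp
qed

text \<open>A coinvariant crosses \<open>\<otimes>\<^sub>B\<close> in the left copy, acts there as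
  an element of \<open>A\<close> from the right, crosses \<open>\<otimes>\<^sub>A\<close>, and
  enters the right copy by the mirrored step.\<close>

lemma sweedler_comult_balanced:
  "balanced_map A (monoid.mult A) Bm (monoid.mult A) A WW.TN (\<lambda>a a'. WW.pure (SB.pure a 1A) (SB.pure 1A a'))"
proof (rule balanced_mapI)
  have W: "SB.pure a b \<in> carrier Wb" if "a \<in> carrier A" "b \<in> carrier A" for a b
    using SB.pure_closed[OF that] by (simp add: Wb_sel)
  note o = RA.one_closed
  show "m \<in> carrier A \<Longrightarrow> n \<in> carrier A \<Longrightarrow> WW.pure (SB.pure m 1A) (SB.pure 1A n) \<in> carrier WW.TN" for m n
    by (intro WW.pure_closed W o)
  show "m \<in> carrier A \<Longrightarrow> m' \<in> carrier A \<Longrightarrow> n \<in> carrier A \<Longrightarrow> WW.pure (SB.pure (m \<oplus>\<^bsub>A\<^esub> m') 1A) (SB.pure 1A n) =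
      WW.pure (SB.pure m 1A) (SB.pure 1A n) \<oplus>\<^bsub>WW.TN\<^esub> WW.pure (SB.pure m' 1A) (SB.pure 1A n)" for m m' n
    using WW.pure_add_left[OF W W W, of m "1A" m' "1A" "1A" n] by (simp add: SB.pure_add_left Wb_sel)
  show "m \<in> carrier A \<Longrightarrow> n \<in> carrier A \<Longrightarrow> n' \<in> carrier A \<Longrightarrow> WW.pure (SB.pure m 1A) (SB.pure 1A (n \<oplus>\<^bsub>A\<^esub> n')) =
      WW.pure (SB.pure m 1A) (SB.pure 1A n) \<oplus>\<^bsub>WW.TN\<^esub> WW.pure (SB.pure m 1A) (SB.pure 1A n')" for m n n'
    using WW.pure_add_right[OF W W W, of m "1A" "1A" n "1A" n'] by (simp add: SB.pure_add_right Wb_sel)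
  fix m b n assume a: "m \<in> carrier A" "b \<in> carrier Bm" "n \<in> carrier A"
  then have b: "b \<in> carrier A" using coinv_in by simp
  have "SB.pure (m \<cdot> b) 1A = sract (SB.pure m 1A) b"
    using SB.pure_act[OF a(1,2) o] a b by (simp add: sract_pure)
  moreover have "SB.pure 1A (b \<cdot> n) = slact b (SB.pure 1A n)"
    using SB.pure_act[OF o a(2,3)] a b by (simp add: slact_pure)
  ultimately show "WW.pure (SB.pure (m \<cdot> b) 1A) (SB.pure 1A n) = WW.pure (SB.pure m 1A) (SB.pure 1A (b \<cdot> n))"
    using WW.pure_act[OF W[OF a(1) o] b W[OF o a(3)]] by simp
qed

lemma can_can_balanced: "balanced_map Wb sract A slact Wb EE.TN (\<lambda>x y. EE.pure (can x) (can y))"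
proof (rule balanced_mapI; unfold Wb_sel)
  show "m \<in> carrier SB.TN \<Longrightarrow> n \<in> carrier SB.TN \<Longrightarrow> EE.pure (can m) (can n) \<in> carrier EE.TN" for m n
    by (intro EE.pure_closed can_in_Eb)
  show "m \<in> carrier SB.TN \<Longrightarrow> m' \<in> carrier SB.TN \<Longrightarrow> n \<in> carrier SB.TN \<Longrightarrow> EE.pure (can (m \<oplus>\<^bsub>SB.TN\<^esub> m')) (can n) =
     EE.pure (can m) (can n) \<oplus>\<^bsub>EE.TN\<^esub> EE.pure (can m') (can n)" for m m' n
    using EE.pure_add_left[OF can_in_Eb can_in_Eb can_in_Eb, of m m' n] by (simp add: can_add Eb_sel(2))
  show "m \<in> carrier SB.TN \<Longrightarrow> n \<in> carrier SB.TN \<Longrightarrow> n' \<in> carrier SB.TN \<Longrightarrow> EE.pure (can m) (can (n \<oplus>\<^bsub>SB.TN\<^esub> n')) =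
     EE.pure (can m) (can n) \<oplus>\<^bsub>EE.TN\<^esub> EE.pure (can m) (can n')" for m n n'
    using EE.pure_add_right[OF can_in_Eb can_in_Eb can_in_Eb, of m n n'] by (simp add: can_add Eb_sel(2))
  show "m \<in> carrier SB.TN \<Longrightarrow> r \<in> carrier A \<Longrightarrow> n \<in> carrier SB.TN \<Longrightarrow>
      EE.pure (can (sract m r)) (can n) = EE.pure (can m) (can (slact r n))" for m r n
    using EE.pure_act[OF can_in_Eb _ can_in_Eb, of m r n] by (simp add: can_slact can_sract)
qed

text \<open>Additivity reduces the claim to \<open>a \<otimes> b\<close>, where both sides are
  \<open>can (a \<otimes> 1) \<otimes>\<^sub>A can (1 \<otimes> b)\<close> by
  \<open>E_comult_canp\<close>.\<close>

lemma E_comult_can: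
  assumes t: "t \<in> carrier SB.TN"
  shows "E_comult (can t) = sw EE.TN (sweedler_comult t) (\<lambda>x y. EE.pure (can x) (can y))"
proof (rule SB.additive_eqI[OF EE.tensor_abelian_group _ _ _ _ _ t, where g = "\<lambda>t. E_comult (can t)"
      and h = "\<lambda>t. sw EE.TN (sweedler_comult t) (\<lambda>x y. EE.pure (can x) (can y))"])
  note sc = SB.lift_closed[OF WW.tensor_abelian_group sweedler_comult_balanced, folded sweedler_comult_def]
    SB.lift_add[OF WW.tensor_abelian_group sweedler_comult_balanced, folded sweedler_comult_def]
    SB.lift_pure[OF WW.tensor_abelian_group sweedler_comult_balanced, folded sweedler_comult_def]
  note cc = WW.lift_closed[OF EE.tensor_abelian_group can_can_balanced]
    WW.lift_add[OF EE.tensor_abelian_group can_can_balanced]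
    WW.lift_pure[OF EE.tensor_abelian_group can_can_balanced]
  show "E_comult (can t) \<in> carrier EE.TN" if "t \<in> carrier SB.TN" for t
    using can_closed[OF that] by (simp add: E_comult_eq qd_rules linear_map_closed[OF linear_dup])
  show "E_comult (can (s \<oplus>\<^bsub>SB.TN\<^esub> t)) = E_comult (can s) \<oplus>\<^bsub>EE.TN\<^esub> E_comult (can t)"
    if "s \<in> carrier SB.TN" "t \<in> carrier SB.TN" for s t
    using that can_closed[OF that(1)] can_closed[OF that(2)] can_closed[of "s \<oplus>\<^bsub>SB.TN\<^esub> t"] SB.T.a_closed[OF that]
    by (simp add: E_comult_eq can_add qd_rules linear_map_add[OF linear_dup] linear_map_closed[OF linear_dup])
  show "sw EE.TN (sweedler_comult t) (\<lambda>x y. EE.pure (can x) (can y)) \<in> carrier EE.TN" if "t \<in> carrier SB.TN" for t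
    by (rule cc(1)[OF sc(1)[OF that]])
  show "sw EE.TN (sweedler_comult (s \<oplus>\<^bsub>SB.TN\<^esub> t)) (\<lambda>x y. EE.pure (can x) (can y)) =
      sw EE.TN (sweedler_comult s) (\<lambda>x y. EE.pure (can x) (can y)) \<oplus>\<^bsub>EE.TN\<^esub>
      sw EE.TN (sweedler_comult t) (\<lambda>x y. EE.pure (can x) (can y))"
    if "s \<in> carrier SB.TN" "t \<in> carrier SB.TN" for s t
    unfolding sc(2)[OF that] by (rule cc(2)[OF sc(1)[OF that(1)] sc(1)[OF that(2)]])
  fix a b assume ab: "a \<in> carrier A" "b \<in> carrier A"
  then show "E_comult (can (SB.pure a b)) = sw EE.TN (sweedler_comult (SB.pure a b)) (\<lambda>x y. EE.pure (can x) (can y))"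
    by (simp add: can_pure E_comult_canp sc cc Wb_sel SB.pure_closed)
qed

section \<open>The two corings as records and the isomorphism criterion\<close>

abbreviation "Dc \<equiv> E_coring K H \<Delta> \<epsilon> A \<rho>"
abbreviation "Cc \<equiv> sweedler_coring A B"

lemma bitensor_Eb: "bitensor A Eb Eb = EE.TN" "bipure A Eb Eb = EE.pure"
  and bitensor_Wb: "bitensor A Wb Wb = WW.TN" "bipure A Wb Wb = WW.pure"
  unfolding bitensor_def bipure_def by (simp_all add: Eb_sel Wb_sel)

lemma Dc_sel: "carrier Dc = carrier Eb" "ring.add Dc = ring.add AH" "smult Dc = lact" "rsmult Dc = ract"
  "comult Dc = E_comult" "counit Dc t = sw A t (\<lambda>a h. \<epsilon> h *A a)"
  unfolding E_coring_def Let_def bitensor_Eb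
  by (simp_all add: bimodule.defs coring.defs Eb_sel p_R_eq E_comult_def[abs_def])

lemma Cc_sel: "carrier Cc = carrier SB.TN" "ring.add Cc = ring.add SB.TN" "smult Cc = slact" "rsmult Cc = sract"
  "comult Cc = sweedler_comult" "counit Cc t = sw A t (monoid.mult A)"
  unfolding sweedler_coring_def Let_def bitensor_Wb
  by (simp_all add: bimodule.defs coring.defs Wb_sel sweedler_comult_def[abs_def])

text \<open>\<open>coring_iso\<close> tensors the coring record with itself, whereas the coproduct
  is built over the underlying bimodule. Carrier, addition and actions coincide, hence so do the
  relations.\<close>

lemma bitensor_Dc: "bitensor A Dc Dc = EE.TN" "bipure A Dc Dc = EE.pure"
proof -
  have r: "tensor_relations Dc ract A lact Dc = EE.TR"
    unfolding tensor_relations_def by (simp add: Dc_sel Eb_sel)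
  show "bitensor A Dc Dc = EE.TN" "bipure A Dc Dc = EE.pure"
    unfolding bitensor_def bipure_def balanced_tensor_def balanced_pure_def
    by (simp_all add: Dc_sel(3,4) r) (simp_all add: Dc_sel(1))
qed

text \<open>The canonical map is always a morphism of corings, so bijectivity is all that
  remains.\<close>

lemma can_coring_iso:
  assumes bij: "bij_betw (\<lambda>t. can t) (carrier SB.TN) (carrier Eb)"
  shows "weak_hopf_galois K H \<Delta> \<epsilon> A \<rho>"
  unfolding weak_hopf_galois_def coring_iso_def linear_map_def bitensor_Dc can_map_eq[abs_def] Dc_sel Cc_sel
  using bij can_in_Eb can_add can_slact can_sract E_comult_can E_counit_can by simp

end

section \<open>Bijectivity of the canonical map\<close>

context cosep_setup
begin

text \<open>On \<open>a \<otimes> b\<close> the value is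
  \<open>\<Sum> a tr (b\<^sub>0 x) \<otimes> y\<close> with \<open>x \<otimes> y\<close> from
  \<open>\<tau> (b\<^sub>1)\<close>. The trace lies in \<open>B\<close> and crosses
  \<open>\<otimes>\<^sub>B\<close>, after which \<open>sw_rho_tau_tr\<close> collapses the second
  leg to \<open>b\<close>.\<close>

lemma quot_can_inv_can:
  assumes t: "t \<in> carrier SB.TN"
  shows "quot (can_inv (can t)) = t"
proof (rule SB.additive_eqI[OF SB.tensor_abelian_group _ _ _ _ _ t, where g = "\<lambda>t. quot (can_inv (can t))" and h = "\<lambda>t. t"])
  note l = linear_map_closed[OF lin_can_inv] linear_map_add[OF lin_can_inv]
  show "quot (can_inv (can t)) \<in> carrier SB.TN" if "t \<in> carrier SB.TN" for t
    by (intro quot_closed l can_closed that)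
  show "quot (can_inv (can (s \<oplus>\<^bsub>SB.TN\<^esub> t))) = quot (can_inv (can s)) \<oplus>\<^bsub>SB.TN\<^esub> quot (can_inv (can t))"
    if "s \<in> carrier SB.TN" "t \<in> carrier SB.TN" for s t
    using that by (simp add: can_add l can_closed quot_add)
  fix a b assume ab[mlin]: "a \<in> carrier A" "b \<in> carrier A"
  have "quot (can_inv (canp a b)) = quot (sw AA (\<rho> b) (\<lambda>c h. sw AA (\<tau> h) (\<lambda>x y. kpure K A A (a \<cdot> tr (c \<cdot> x)) y)))"
    unfolding canp_def by (subst can_inv_can) ((assumption | rule mlin)+, rule refl)
  also have "\<dots> = sw SB.TN (\<rho> b) (\<lambda>c h. quot (sw AA (\<tau> h) (\<lambda>x y. kpure K A A (a \<cdot> tr (c \<cdot> x)) y)))"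
    by (rule quot_sw) (assumption | rule mlin)+
  also have "\<dots> = sw SB.TN (\<rho> b) (\<lambda>c h. sw SB.TN (\<tau> h) (\<lambda>x y. quot (kpure K A A (a \<cdot> tr (c \<cdot> x)) y)))"
    by (assumption | rule quot_sw sw_congs mlin)+
  also have "\<dots> = sw SB.TN (\<rho> b) (\<lambda>c h. sw SB.TN (\<tau> h) (\<lambda>x y. SB.pure a (tr (c \<cdot> x) \<cdot> y)))"
    by (rule rho_cong, (assumption | rule mlin)+, rule tau_cong, (assumption | rule mlin)+, subst quot_pure, (assumption | rule mlin)+, rule SB.pure_act) (assumption | rule mlin)+
  also have "\<dots> = sw SB.TN (\<rho> b) (\<lambda>c h. SB.pure a (sw A (\<tau> h) (\<lambda>x y. tr (c \<cdot> x) \<cdot> y)))"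
  proof (rule rho_cong[OF ab(2)])
    fix c h assume [mlin]: "c \<in> carrier A" "h \<in> carrier H"
    show "sw SB.TN (\<tau> h) (\<lambda>x y. SB.pure a (tr (c \<cdot> x) \<cdot> y)) = SB.pure a (sw A (\<tau> h) (\<lambda>x y. tr (c \<cdot> x) \<cdot> y))"
      by (rule two_modules.additive_lift[symmetric, OF two_modules.intro[OF modA modA] RA.abelian_group_axioms
            SB.tensor_abelian_group bilin_balanced SB.pure_closed[OF ab(1)] SB.pure_add_right[OF ab(1)]]) (assumption | rule mlin)+
  qed
  also have "\<dots> = SB.pure a (sw A (\<rho> b) (\<lambda>c h. sw A (\<tau> h) (\<lambda>x y. tr (c \<cdot> x) \<cdot> y)))"
    by (rule two_modules.additive_lift[symmetric, OF two_modules.intro[OF modA modH] RA.abelian_group_axioms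
          SB.tensor_abelian_group bilin_balanced SB.pure_closed[OF ab(1)] SB.pure_add_right[OF ab(1)]]) (assumption | rule mlin)+
  also have "\<dots> = SB.pure a b" by (simp add: sw_rho_tau_tr ab)
  finally show "quot (can_inv (can (SB.pure a b))) = SB.pure a b" using ab by (simp add: can_pure)
qed simp_all

lemma weak_hopf_galois:
  assumes surj: "can_map K H A \<rho> ` carrier AA = carrier Dc"
  shows "weak_hopf_galois K H \<Delta> \<epsilon> A \<rho>"
proof (rule can_coring_iso, unfold bij_betw_def, intro conjI)
  show "inj_on (\<lambda>t. can t) (carrier SB.TN)"
    using quot_can_inv_can by (rule inj_on_inverseI)
  \<comment> \<open>Surjectivity is inherited, because \<open>A \<otimes>\<^sub>k A\<close> projects
    onto \<open>A \<otimes>\<^sub>B A\<close> compatibly with \<open>can\<close>.\<close>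
  have "(\<lambda>t. can t) ` carrier SB.TN = (\<lambda>t. can t) ` carrier AA"
    unfolding quot_surj[symmetric] image_image by (rule image_cong) (simp_all add: can_quot)
  then show "(\<lambda>t. can t) ` carrier SB.TN = carrier Eb"
    using surj by (simp add: can_map_eq[abs_def] Dc_sel)
qed

end

lemma (in weak_comodule_setup) exists_cosep_setup:
  assumes cosep: "coseparable K H \<Delta>" and proj: "projective_module K H"
    and surj: "can_map K H A \<rho> ` carrier AA = carrier Dc"
  obtains r \<tau>\<^sub>0 where "cosep_setup K H \<Delta> \<epsilon> S A \<rho> r \<tau>\<^sub>0"
proof -
  obtain r where r: "linear_map K HH H r"
    "\<forall>x\<in>carrier H. \<forall>y\<in>carrier H. \<Delta> (r (kpure K H H x y)) =
       sw HH (\<Delta> x) (\<lambda>x1 x2. kpure K H H x1 (r (kpure K H H x2 y)))"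
    "\<forall>x\<in>carrier H. \<forall>y\<in>carrier H. \<Delta> (r (kpure K H H x y)) =
       sw HH (\<Delta> y) (\<lambda>y1 y2. kpure K H H (r (kpure K H H x y1)) y2)"
    "\<forall>x\<in>carrier H. r (\<Delta> x) = x"
    using cosep unfolding coseparable_def by blast
  let ?f = "\<lambda>h. sw AH (\<rho> 1A) (\<lambda>x g. kpure K A H x (h \<bullet> g))"
  have lf: "linear_map K H AH ?f" by (assumption | rule mlin)+
  \<comment> \<open>\<open>?f h\<close> is \<open>p_R (1 \<otimes> h)\<close>, an element of
    \<open>\<EE>\<close>, and \<open>\<EE>\<close> is the image of \<open>can\<close> by assumption.
    Projectivity of \<open>H\<close> then makes the choice of preimages linear in
    \<open>h\<close>.\<close>
  have "?f h \<in> (\<lambda>t. can t) ` carrier AA" if [mlin]: "h \<in> carrier H" for h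
  proof -
    have "ract (kpure K A H 1A h) 1A = sw AH (\<rho> 1A) (\<lambda>x g. kpure K A H (1A \<cdot> x) (h \<bullet> g))"
      by (rule ract_kpure) (assumption | rule mlin)+
    also have "\<dots> = ?f h" by (rule rho_cong, (assumption | rule mlin)+, subst RA.l_one) (assumption, rule refl)
    finally have "?f h = ract (kpure K A H 1A h) 1A" by simp
    also have "\<dots> \<in> carrier Eb" by (rule ract_in_Eb) (assumption | rule mlin)+
    finally show ?thesis using surj by (simp add: can_map_eq[abs_def] Dc_sel)
  qed
  then obtain \<tau>\<^sub>0 where \<tau>: "linear_map K H AA \<tau>\<^sub>0" "\<And>h. h \<in> carrier H \<Longrightarrow> can (\<tau>\<^sub>0 h) = ?f h"
    using projective_module_lift[OF proj module_ktensor[OF modA modA] module_AH linear_can lf] by metis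
  have "cosep_setup K H \<Delta> \<epsilon> S A \<rho> r \<tau>\<^sub>0"
    using r \<tau> by (intro cosep_setup.intro weak_comodule_setup.intro W C cosep_setup_axioms.intro)
      (simp_all add: canp_def[abs_def])
  then show thesis by (rule that)
qed

theorem corollary5p4:
  fixes K :: "'k ring" and H :: "('k, 'h) module" and A :: "('k, 'a) module"
    and \<Delta> :: "'h \<Rightarrow> ('h, 'h) tensor" and \<epsilon> :: "'h \<Rightarrow> 'k" and S :: "'h \<Rightarrow> 'h"
    and \<rho> :: "'a \<Rightarrow> ('a, 'h) tensor"
  assumes "weak_hopf_algebra K H \<Delta> \<epsilon> S"
    and "coseparable K H \<Delta>"
    and "projective_module K H"
    and "bij_betw S (carrier H) (carrier H)"
    and "right_comodule_algebra K H \<Delta> \<epsilon> A \<rho>"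
    and "projective_module K A"
    and "can_map K H A \<rho> ` carrier (ktensor K A A) = carrier (E_coring K H \<Delta> \<epsilon> A \<rho>)"
  shows "weak_hopf_galois K H \<Delta> \<epsilon> A \<rho> \<and> equivariantly_projective K H A \<rho>"
proof -
  interpret weak_comodule_setup K H \<Delta> \<epsilon> S A \<rho>
    by (rule weak_comodule_setup.intro[OF assms(1,5)])
  obtain r \<tau>\<^sub>0 where "cosep_setup K H \<Delta> \<epsilon> S A \<rho> r \<tau>\<^sub>0"
    using exists_cosep_setup[OF assms(2,3,7)] by blast
  then interpret cosep_setup K H \<Delta> \<epsilon> S A \<rho> r \<tau>\<^sub>0 .
  show ?thesis using weak_hopf_galois[OF assms(7)] equivariantly_projective[OF assms(6)] by simp
qed

end
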